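(* Let $s>\frac{9}{2}$, $f\in C^{\lfloor s\rfloor +1}(\mathbb{R})$ with $f(0)=0$, let $\varphi,\psi \in H^{s}(\mathbb{R})$, and let $u\in C^{2}\left([0,T], H^{s}(\mathbb{R})\right)$ be the solution of the initial-value problem $$u_{tt} =(\beta \ast f(u))_{xx},\quad x\in \mathbb{R},\ t>0,\qquad u(x,0)=\varphi(x),\quad u_{t}(x,0)=\psi(x),\quad x\in\mathbb{R}.$$ For $h>0$ let $\mathbf{u}_{h}\in C^{2}\left([0,T_{h}),l^{\infty}\right)$ be the solution, with maximal existence time $T_h$, of $$\frac{d^{2}\mathbf{v}}{dt^{2}} =D^{+}D^{-}\big(\boldsymbol{\beta}_{h}\ast f(\mathbf{v})\big)$$ with initial data $\mathbf{v}(0)=\boldsymbol{\varphi}_{h}=(\varphi(ih))_{i\in\mathbb{Z}}$, $\mathbf{v}'(0)=\boldsymbol{\psi}_{h}=(\psi(ih))_{i\in\mathbb{Z}}$. Let $\mathbf{u}(t)=(u(ih,t))_{i\in\mathbb{Z}}$ and $\mathbf{u}_t(t)=(u_t(ih,t))_{i\in\mathbb{Z}}$. Then there is some $h_{0}>0$ so that for $h\leq h_{0}$, the maximal existence time $T_{h}$ of $\mathbf{u}_{h}$ is at least $T$ and $$\Vert \mathbf{u}(t)-\mathbf{u}_{h}(t)\Vert_{l^{\infty}}+\Vert \mathbf{u}_{t}(t)-\mathbf{u}_{h}^{\prime }(t)\Vert_{l^{\infty}}=\mathcal{O}(h^{2})$$ for all $t\in [0,T]$.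
   Context: Standing assumptions on the kernel: $\beta:\mathbb{R}\to\mathbb{R}$ is even with $\int_{\mathbb{R}}\beta(x)\,dx=1$, $\beta\in W^{1,1}(\mathbb{R})$ (identified with its continuous representative), and its second distributional derivative $\beta''=\mu$ is a finite Borel measure on $\mathbb{R}$. The continuous convolution is $(\beta\ast v)(x)=\int_{\mathbb{R}}\beta(x-y)v(y)\,dy$, in the space variable. $H^s(\mathbb{R})$ is the usual $L^2$-based Sobolev space. Sequences: $\mathbf{u}=(u_i)_{i\in\mathbb{Z}}$ denotes a two-sided infinite real sequence; $l^\infty=l^\infty(\mathbb{Z})$ with $\Vert\mathbf{u}\Vert_{l^\infty}=\sup_{i\in\mathbb{Z}}|u_i|$. The kernel restriction is $\boldsymbol{\beta}_h=(\beta(ih))_{i\in\mathbb{Z}}$ and $f(\mathbf{v})=(f(v_i))_{i\in\mathbb{Z}}$. The discrete convolution is $(\mathbf{u}\ast\mathbf{v})_i=\sum_{j\in\mathbb{Z}}h\,u_{i-j}v_j$. The difference operators are $(D^+\mathbf{u})_i=\frac1h(u_{i+1}-u_i)$, $(D^-\mathbf{u})_i=\frac1h(u_i-u_{i-1})$, so $(D^+D^-\mathbf{u})_i=\frac1{h^2}(u_{i+1}-2u_i+u_{i-1})$. The semi-discrete initial-value problem has, for each $h>0$ and each initial data in $l^\infty$, a unique maximal solution in $C^2([0,T_h),l^\infty)$. The notation $\mathcal{O}(h^2)$ means bounded by $Ch^2$ with a constant $C$ independent of $h\le h_0$ and of $t\in[0,T]$ ($C$ may depend on $\beta,u,f,T$).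 *)

theory Defs
  imports "HOL-Analysis.Analysis"
begin

definition C_k :: "nat \<Rightarrow> (real \<Rightarrow> real) \<Rightarrow> bool" where
  "C_k k f \<longleftrightarrow>
     (\<forall>j<k. \<forall>x. (deriv ^^ j) f field_differentiable (at x)) \<and> continuous_on UNIV ((deriv ^^ k) f)"

definition test_function :: "(real \<Rightarrow> real) \<Rightarrow> bool" where
  "test_function \<theta> \<longleftrightarrow> (\<forall>k. C_k k \<theta>) \<and> (\<exists>R. \<forall>x. \<bar>x\<bar> > R \<longrightarrow> \<theta> x = 0)"

definition schwartz :: "(real \<Rightarrow> real) \<Rightarrow> bool" where
  "schwartz \<theta> \<longleftrightarrow>
     (\<forall>k. C_k k \<theta>) \<and> (\<forall>m n. bounded (range (\<lambda>x. x ^ m * (deriv ^^ n) \<theta> x)))"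

(* The measure \<beta>'' is a finite signed Borel measure, written as a difference P - N of two
   finite positive ones.  (A nonzero positive \<beta>'' is impossible for an integrable \<beta>.) *)
definition admissible_kernel :: "(real \<Rightarrow> real) \<Rightarrow> bool" where
  "admissible_kernel \<beta> \<longleftrightarrow>
     (\<forall>x. \<beta> (- x) = \<beta> x) \<and>
     continuous_on UNIV \<beta> \<and>
     integrable lborel \<beta> \<and> (LINT x|lborel. \<beta> x) = 1 \<and>
     (\<exists>g. integrable lborel g \<and>
        (\<forall>\<theta>. test_function \<theta> \<longrightarrow>
           (LINT x|lborel. \<beta> x * deriv \<theta> x) = - (LINT x|lborel. g x * \<theta> x))) \<and>
     (\<exists>P N. finite_measure P \<and> sets P = sets borel \<and> finite_measure N \<and> sets N = sets borel \<and>
        (\<forall>\<theta>. test_function \<theta> \<longrightarrow>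
           (LINT x|lborel. \<beta> x * (deriv ^^ 2) \<theta> x) = (LINT x|P. \<theta> x) - (LINT x|N. \<theta> x)))"

definition convol :: "(real \<Rightarrow> real) \<Rightarrow> (real \<Rightarrow> real) \<Rightarrow> real \<Rightarrow> real" where
  "convol \<beta> v x = (LINT y|lborel. \<beta> (x - y) * v y)"


definition fourier :: "(real \<Rightarrow> real) \<Rightarrow> real \<Rightarrow> complex" where
  "fourier \<theta> \<xi> = (LINT x|lborel. cis (- (x * \<xi>)) * of_real (\<theta> x))"

(* w is the Fourier transform of v in the sense of tempered distributions; by linearity it is
   enough to test against real-valued Schwartz functions. *)
definition is_fourier_transform :: "(real \<Rightarrow> real) \<Rightarrow> (real \<Rightarrow> complex) \<Rightarrow> bool" where
  "is_fourier_transform v w \<longleftrightarrow>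
     w \<in> borel_measurable borel \<and>
     (\<forall>\<theta>. schwartz \<theta> \<longrightarrow>
        integrable lborel (\<lambda>\<xi>. w \<xi> * of_real (\<theta> \<xi>)) \<and>
        (LINT \<xi>|lborel. w \<xi> * of_real (\<theta> \<xi>)) = (LINT x|lborel. of_real (v x) * fourier \<theta> x))"

definition sobolev_transform :: "real \<Rightarrow> (real \<Rightarrow> real) \<Rightarrow> (real \<Rightarrow> complex) \<Rightarrow> bool" where
  "sobolev_transform s v w \<longleftrightarrow>
     is_fourier_transform v w \<and>
     integrable lborel (\<lambda>\<xi>. (1 + \<xi>\<^sup>2) powr s * (cmod (w \<xi>))\<^sup>2)"

(* H^s for s > 1/2, each class being represented by its unique continuous member, so that the
   elements can be evaluated at grid points. *)
definition sobolev_space :: "real \<Rightarrow> (real \<Rightarrow> real) set" where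
  "sobolev_space s =
     {v. continuous_on UNIV v \<and> integrable lborel (\<lambda>x. (v x)\<^sup>2) \<and> (\<exists>w. sobolev_transform s v w)}"

(* The Fourier transform is unique up to null sets, so the value does not depend on the choice. *)
definition sobolev_norm :: "real \<Rightarrow> (real \<Rightarrow> real) \<Rightarrow> real" where
  "sobolev_norm s v =
     sqrt (LINT \<xi>|lborel. (1 + \<xi>\<^sup>2) powr s * (cmod ((SOME w. sobolev_transform s v w) \<xi>))\<^sup>2)"

(* u \<in> C^2([0,T], H^s) with H^s-valued time derivatives u_t = u1 and u_tt = u2; here u t x stands
   for u(x,t). *)
definition sobolev_C2 ::
  "real \<Rightarrow> real \<Rightarrow> (real \<Rightarrow> real \<Rightarrow> real) \<Rightarrow> (real \<Rightarrow> real \<Rightarrow> real) \<Rightarrow> (real \<Rightarrow> real \<Rightarrow> real) \<Rightarrow> bool"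
  where
  "sobolev_C2 s T u u1 u2 \<longleftrightarrow>
     (\<forall>t\<in>{0..T}. u t \<in> sobolev_space s \<and> u1 t \<in> sobolev_space s \<and> u2 t \<in> sobolev_space s) \<and>
     (\<forall>t\<in>{0..T}.
        ((\<lambda>\<tau>. sobolev_norm s (\<lambda>x. (u \<tau> x - u t x) / (\<tau> - t) - u1 t x)) \<longlongrightarrow> 0) (at t within {0..T}) \<and>
        ((\<lambda>\<tau>. sobolev_norm s (\<lambda>x. (u1 \<tau> x - u1 t x) / (\<tau> - t) - u2 t x)) \<longlongrightarrow> 0) (at t within {0..T}) \<and>
        ((\<lambda>\<tau>. sobolev_norm s (\<lambda>x. u2 \<tau> x - u2 t x)) \<longlongrightarrow> 0) (at t within {0..T}))"

(* u is the solution and u1 its time derivative u_t. *)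
definition continuous_solution ::
  "(real \<Rightarrow> real) \<Rightarrow> (real \<Rightarrow> real) \<Rightarrow> (real \<Rightarrow> real) \<Rightarrow> (real \<Rightarrow> real) \<Rightarrow> real \<Rightarrow> real \<Rightarrow>
   (real \<Rightarrow> real \<Rightarrow> real) \<Rightarrow> (real \<Rightarrow> real \<Rightarrow> real) \<Rightarrow> bool"
  where
  "continuous_solution \<beta> f \<phi> \<psi> s T u u1 \<longleftrightarrow>
     (\<exists>u2. sobolev_C2 s T u u1 u2 \<and>
        (\<forall>t. 0 < t \<and> t \<le> T \<longrightarrow>
           (\<exists>w. (\<forall>x. (convol \<beta> (\<lambda>y. f (u t y)) has_real_derivative w x) (at x)) \<and>
                (\<forall>x. (w has_real_derivative u2 t x) (at x))))) \<and>
     u 0 = \<phi> \<and> u1 0 = \<psi>"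


(* Since int carries the discrete topology, this is the space of bounded two-sided real sequences
   with the supremum norm. *)
type_synonym linf = "int \<Rightarrow>\<^sub>C real"

lemma int_bcontfun_iff: "(g :: int \<Rightarrow> real) \<in> bcontfun \<longleftrightarrow> bounded (range g)"
  by (auto simp: bcontfun_def continuous_on_discrete)

lemma norm_linf: "norm (v :: linf) = (SUP i. \<bar>apply_bcontfun v i\<bar>)"
  by (simp add: norm_bcontfun_def dist_bcontfun.rep_eq zero_bcontfun.rep_eq)

(* Meaningful for g bounded on the grid; elements of H^s with s > 1/2 are bounded. *)
definition grid_seq :: "real \<Rightarrow> (real \<Rightarrow> real) \<Rightarrow> linf" where
  "grid_seq h g = Bcontfun (\<lambda>i. g (of_int i * h))"

definition discrete_convol :: "real \<Rightarrow> (int \<Rightarrow> real) \<Rightarrow> (int \<Rightarrow> real) \<Rightarrow> int \<Rightarrow> real" where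
  "discrete_convol h u v i = (\<Sum>\<^sub>\<infinity>j\<in>UNIV. h * u (i - j) * v j)"

definition D_plus :: "real \<Rightarrow> (int \<Rightarrow> real) \<Rightarrow> int \<Rightarrow> real" where
  "D_plus h u i = (u (i + 1) - u i) / h"

definition D_minus :: "real \<Rightarrow> (int \<Rightarrow> real) \<Rightarrow> int \<Rightarrow> real" where
  "D_minus h u i = (u i - u (i - 1)) / h"

definition semidiscrete_rhs ::
  "(real \<Rightarrow> real) \<Rightarrow> (real \<Rightarrow> real) \<Rightarrow> real \<Rightarrow> (int \<Rightarrow> real) \<Rightarrow> int \<Rightarrow> real" where
  "semidiscrete_rhs \<beta> f h v =
     D_plus h (D_minus h (discrete_convol h (\<lambda>i. \<beta> (of_int i * h)) (\<lambda>i. f (v i))))"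

(* v \<in> C^2([0,Tm), linf) solves the semi-discrete problem and v1 is its time derivative. *)
definition semidiscrete_solution ::
  "(real \<Rightarrow> real) \<Rightarrow> (real \<Rightarrow> real) \<Rightarrow> (real \<Rightarrow> real) \<Rightarrow> (real \<Rightarrow> real) \<Rightarrow> real \<Rightarrow>
   ereal \<Rightarrow> (real \<Rightarrow> linf) \<Rightarrow> (real \<Rightarrow> linf) \<Rightarrow> bool"
  where
  "semidiscrete_solution \<beta> f \<phi> \<psi> h Tm v v1 \<longleftrightarrow>
     0 < Tm \<and>
     (let I = {t. 0 \<le> t \<and> ereal t < Tm} in
        \<exists>v2. (\<forall>t\<in>I. (v has_vector_derivative v1 t) (at t within I)) \<and>
             (\<forall>t\<in>I. (v1 has_vector_derivative v2 t) (at t within I)) \<and>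
             continuous_on I v2 \<and>
             (\<forall>t\<in>I. \<forall>i. apply_bcontfun (v2 t) i =
                          semidiscrete_rhs \<beta> f h (apply_bcontfun (v t)) i)) \<and>
     v 0 = grid_seq h \<phi> \<and> v1 0 = grid_seq h \<psi>"

definition maximal_semidiscrete_solution ::
  "(real \<Rightarrow> real) \<Rightarrow> (real \<Rightarrow> real) \<Rightarrow> (real \<Rightarrow> real) \<Rightarrow> (real \<Rightarrow> real) \<Rightarrow> real \<Rightarrow>
   ereal \<Rightarrow> (real \<Rightarrow> linf) \<Rightarrow> (real \<Rightarrow> linf) \<Rightarrow> bool"
  where
  "maximal_semidiscrete_solution \<beta> f \<phi> \<psi> h Tm v v1 \<longleftrightarrow>
     semidiscrete_solution \<beta> f \<phi> \<psi> h Tm v v1 \<and>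
     \<not> (\<exists>Tm' w w1. Tm < Tm' \<and> semidiscrete_solution \<beta> f \<phi> \<psi> h Tm' w w1 \<and>
          (\<forall>t. 0 \<le> t \<and> ereal t < Tm \<longrightarrow> w t = v t))"

end

theory Submission
  imports Defs "HOL-Probability.Probability" "HOL-Real_Asymp.Real_Asymp"
begin

text \<open>
  Testing \<open>\<beta>'' = P - N\<close> against mollified hat functions shows that the second difference of \<open>\<beta>\<close> with
  step \<open>h\<close> at \<open>x\<close> is the integral of the hat function of width \<open>h\<close> centred at \<open>x\<close> with respect to
  \<open>P - N\<close>.  Hence \<open>(D\<^sup>+ D\<^sup>- (\<beta>\<^sub>h * v))\<^sub>i\<close> is the integral against \<open>P - N\<close> of the piecewise linear interpolant
  of \<open>v (ih - y)\<close>, whereas \<open>(\<beta> * v)\<^sub>x\<^sub>x (ih)\<close> is the integral of \<open>v (ih - y)\<close> itself.  So the consistency error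
  is at most \<open>\<bar>\<mu>\<bar>(\<real>)\<close> times the interpolation error, which is \<open>O(h\<^sup>2)\<close> as soon as \<open>v = f(u)\<close> has two bounded
  derivatives, and the discrete right-hand side is Lipschitz in the supremum norm uniformly in \<open>h\<close>.

  After replacing \<open>f\<close> by a bounded Lipschitz function that agrees with it on a neighbourhood of the range
  of \<open>u\<close>, the discrete problem has a global solution, and Gronwall's inequality keeps it within \<open>O(h\<^sup>2)\<close> of
  \<open>u\<close> on \<open>[0, T]\<close>.  For small \<open>h\<close> it therefore does not see the truncation until slightly after \<open>T\<close>, so by
  uniqueness it coincides with the maximal solution there.
\<close>

section \<open>Smooth functions and mollifiers\<close>

text \<open>The measures are known only through smooth test functions, whereas grid sums need point
  values of \<open>\<beta>\<close>. The pointwise identity \<open>second_difference\<close> bridges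
  this gap without a derivative of \<open>\<beta>\<close>. It serves twice, since a second
  difference of a convolution can be put on the kernel: with the mesh size as step for the discrete
  operator, and with a step tending to 0 for the continuous one. The factor 1/h^2 of the difference
  operators does not spoil the Lipschitz constant because hats divided by h form a partition of
  unity; only the masses of \<open>P\<close> and \<open>N\<close> remain.

  \<open>sobolev_norm\<close> relies on a choice of transform and is informative only for members of
  \<open>sobolev_space\<close>. Difference quotients in time are therefore first shown to lie in the
  space; the embedding then turns their norms into pointwise bounds, and uniform bounds in time are
  derived from these.

  The equation is given for t > 0, so solutions are compared through derivatives on the open
  interval and continuity on the closed one. Truncation beyond M + 1, with M a bound for u, leaves a
  margin of 1 that the error must not use up; this fixes \<open>h0\<close>.\<close>

coinductive smooth :: "(real \<Rightarrow> real) \<Rightarrow> bool" where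
  smoothI: "(\<And>x. (f has_real_derivative g x) (at x)) \<Longrightarrow> smooth g \<Longrightarrow> smooth f"

lemma smooth_deriv: "smooth f \<Longrightarrow> smooth (deriv f)"
proof (erule smooth.cases)
  fix f' g assume f: "f = f'" "\<And>x. (f' has_real_derivative g x) (at x)" "smooth g"
  have "deriv f = g" using f by (auto intro!: DERIV_imp_deriv)
  then show ?thesis using f by simp
qed

lemma smooth_has_deriv: "smooth f \<Longrightarrow> (f has_real_derivative deriv f x) (at x)"
  by (erule smooth.cases) (metis DERIV_imp_deriv)

lemma smooth_deriv_funpow: "smooth f \<Longrightarrow> smooth ((deriv ^^ j) f)"
  by (induction j) (auto intro: smooth_deriv)

lemma smooth_isCont: "smooth f \<Longrightarrow> isCont f x"
  using smooth_has_deriv DERIV_isCont by blast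

lemma smooth_imp_C_k: "smooth f \<Longrightarrow> C_k k f"
  unfolding C_k_def field_differentiable_def
  by (meson continuous_at_imp_continuous_on smooth_deriv_funpow smooth_has_deriv smooth_isCont)

text \<open>Coinduction principle for \<open>smooth\<close>: it suffices to exhibit one class of
  functions that is closed under differentiation, so no n-th derivative is ever computed.\<close>

lemma smooth_class:
  assumes "\<And>g. g \<in> S \<Longrightarrow> \<exists>g'\<in>S. \<forall>x. (g has_real_derivative g' x) (at x)" and "f \<in> S"
  shows "smooth f"
  using \<open>f \<in> S\<close>
proof (coinduction arbitrary: f)
  case smooth
  then show ?case using assms(1) by blast
qed

lemma smooth_add: assumes "smooth f" "smooth g" shows "smooth (\<lambda>x. f x + g x)"
proof (rule smooth_class[where S="{\<lambda>x. f x + g x |f g. smooth f \<and> smooth g}"])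
  fix k assume "k \<in> {\<lambda>x. f x + g x |f g. smooth f \<and> smooth g}"
  then obtain f g where "k = (\<lambda>x. f x + g x)" "smooth f" "smooth g" by blast
  then show "\<exists>g'\<in>{\<lambda>x. f x + g x |f g. smooth f \<and> smooth g}. \<forall>x. (k has_real_derivative g' x) (at x)"
    by (intro bexI[of _ "\<lambda>x. deriv f x + deriv g x"])
       (auto intro!: derivative_eq_intros smooth_has_deriv dest: smooth_deriv)
qed (use assms in blast)

lemma smooth_affine: assumes "smooth f" shows "smooth (\<lambda>x. c * f (a * x + b))"
proof (rule smooth_class[where S="{\<lambda>x. c * f (a * x + b) |f c. smooth f}"])
  fix k assume "k \<in> {\<lambda>x. c * f (a * x + b) |f c. smooth f}"
  then obtain f c where k: "k = (\<lambda>x. c * f (a * x + b))" and f: "smooth f" by blast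
  have "(k has_real_derivative (c * a) * deriv f (a * x + b)) (at x)" for x
    unfolding k by (auto intro!: derivative_eq_intros DERIV_chain2[OF smooth_has_deriv[OF f]])
  then show "\<exists>g'\<in>{\<lambda>x. c * f (a * x + b) |f c. smooth f}. \<forall>x. (k has_real_derivative g' x) (at x)"
    using smooth_deriv[OF f] by (intro bexI[of _ "\<lambda>x. (c * a) * deriv f (a * x + b)"]) auto
qed (use assms in blast)

text \<open>The derivative of a product is a sum of two products. Finite sums of products are thus
  the class, closed by the Leibniz rule, on which coinduction for \<open>smooth_mult\<close>
  runs.\<close>

inductive prod_span :: "(real \<Rightarrow> real) \<Rightarrow> bool" where
  base: "smooth f \<Longrightarrow> smooth g \<Longrightarrow> prod_span (\<lambda>x. f x * g x)"
| add: "prod_span f \<Longrightarrow> prod_span g \<Longrightarrow> prod_span (\<lambda>x. f x + g x)"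

lemma smooth_mult: assumes "smooth f" "smooth g" shows "smooth (\<lambda>x. f x * g x)"
proof (rule smooth_class[where S="Collect prod_span"])
  fix k assume "k \<in> Collect prod_span"
  then have "prod_span k" by simp
  then have "\<exists>g'. prod_span g' \<and> (\<forall>x. (k has_real_derivative g' x) (at x))"
  proof induction
    case (base f g)
    have "((\<lambda>x. f x * g x) has_real_derivative deriv f x * g x + f x * deriv g x) (at x)" for x
      using base by (auto intro!: derivative_eq_intros smooth_has_deriv)
    moreover have "prod_span (\<lambda>x. deriv f x * g x + f x * deriv g x)"
      using base by (intro prod_span.intros smooth_deriv)
    ultimately show ?case by (intro exI[of _ "\<lambda>x. deriv f x * g x + f x * deriv g x"]) simp
  next
    case (add f g)
    then obtain f' g' where "prod_span f'" "\<forall>x. (f has_real_derivative f' x) (at x)"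
      "prod_span g'" "\<forall>x. (g has_real_derivative g' x) (at x)" by (elim exE conjE)
    then show ?case
      by (intro exI[of _ "\<lambda>x. f' x + g' x"]) (auto intro: prod_span.add derivative_intros)
  qed
  then show "\<exists>g'\<in>Collect prod_span. \<forall>x. (k has_real_derivative g' x) (at x)" by blast
qed (use assms prod_span.base in blast)

lemma poly_times_exp_minus_tendsto_0: "((\<lambda>t::real. poly p t * exp (- t)) \<longlongrightarrow> 0) at_top"
proof -
  have "((\<lambda>t::real. \<Sum>i\<le>degree p. coeff p i * (t ^ i / exp t)) \<longlongrightarrow> (\<Sum>i\<le>degree p. coeff p i * 0)) at_top"
    by (intro tendsto_intros tendsto_power_div_exp_0)
  then show ?thesis
    by (simp add: poly_altdef exp_minus divide_inverse sum_distrib_right mult.assoc)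
qed

text \<open>The closed class consists of p(1/x) exp(-1/x), extended by 0, for all polynomials p.
  Only the origin needs care: there the exponential beats every polynomial in 1/x, so the difference
  quotient tends to 0.\<close>

lemma smooth_exp_inverse: "smooth (\<lambda>x. if 0 < x then exp (- (1 / x)) else 0)"
proof (rule smooth_class[where S="{\<lambda>x::real. if 0 < x then poly p (1 / x) * exp (- (1 / x)) else 0 |p. True}"])
  fix k :: "real \<Rightarrow> real" assume "k \<in> {\<lambda>x. if 0 < x then poly p (1 / x) * exp (- (1 / x)) else 0 |p. True}"
  then obtain p :: "real poly" where k: "k = (\<lambda>x. if 0 < x then poly p (1 / x) * exp (- (1 / x)) else 0)"
    by blast
  \<comment> \<open>With t = 1/x, the derivative of p(t) exp(-t) in x is t^2 (p(t) - p'(t))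
    exp(-t).\<close>
  define q where "q = [:0, 0, 1:] * (p - pderiv p)"
  have "(k has_real_derivative (if 0 < x then poly q (1 / x) * exp (- (1 / x)) else 0)) (at x)" for x
  proof -
    consider "x > 0" | "x < 0" | "x = 0" by linarith
    then show ?thesis
    proof cases
      case 1
      have "((\<lambda>x. poly p (1 / x) * exp (- (1 / x))) has_real_derivative poly q (1 / x) * exp (- (1 / x))) (at x)"
        using 1 by (auto intro!: derivative_eq_intros DERIV_chain2[OF poly_DERIV] simp: q_def field_simps power2_eq_square)
      moreover have "eventually (\<lambda>y. y \<in> {0<..}) (nhds x)" using 1 by (intro eventually_nhds_in_open) auto
      ultimately show ?thesis using 1
        by (subst DERIV_cong_ev[OF refl _ refl, of _ "\<lambda>x. poly p (1 / x) * exp (- (1 / x))"])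
           (auto simp: k elim!: eventually_mono)
    next
      case 2
      have "eventually (\<lambda>y. y \<in> {..<0}) (nhds x)" using 2 by (intro eventually_nhds_in_open) auto
      then show ?thesis using 2
        by (subst DERIV_cong_ev[OF refl _ refl, of _ "\<lambda>x. 0"])
           (auto simp: k elim!: eventually_mono)
    next
      case 3
      have "((\<lambda>y. k y / y) \<longlongrightarrow> 0) (at_left 0)"
        by (rule tendsto_eventually) (auto simp: k eventually_at_filter)
      moreover have "((\<lambda>y. k y / y) \<longlongrightarrow> 0) (at_right 0)"
      proof -
        \<comment> \<open>\<open>pCons 0 p\<close> multiplies p by its variable, which absorbs the
          factor 1/y of the difference quotient.\<close>
        have "((\<lambda>y. poly (pCons 0 p) (inverse y) * exp (- (inverse y))) \<longlongrightarrow> 0) (at_right 0)"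
          by (rule filterlim_compose[OF poly_times_exp_minus_tendsto_0 filterlim_inverse_at_top_right])
        then show ?thesis
          by (rule Lim_transform_eventually) (auto simp: k eventually_at_filter divide_inverse)
      qed
      ultimately have "((\<lambda>y. k y / y) \<longlongrightarrow> 0) (at 0)" by (simp add: filterlim_split_at)
      then show ?thesis using 3 by (simp add: has_field_derivative_iff k)
    qed
  qed
  then show "\<exists>g'\<in>{\<lambda>x. if 0 < x then poly p (1 / x) * exp (- (1 / x)) else 0 |p. True}.
      \<forall>x. (k has_real_derivative g' x) (at x)"
    by (intro bexI[of _ "\<lambda>x. if 0 < x then poly q (1 / x) * exp (- (1 / x)) else 0"]) auto
next
  show "(\<lambda>x. if 0 < x then exp (- (1 / x)) else 0) \<in>
      {\<lambda>x. if 0 < x then poly p (1 / x) * exp (- (1 / x)) else (0::real) |p. True}"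
    by (rule CollectI, rule exI[of _ 1]) auto
qed

lemma exists_bump:
  "\<exists>b::real \<Rightarrow> real. smooth b \<and> (\<forall>x. 0 \<le> b x) \<and> (\<forall>x. \<bar>x\<bar> < 1 \<longrightarrow> 0 < b x) \<and> (\<forall>x. 1 \<le> \<bar>x\<bar> \<longrightarrow> b x = 0)"
proof (intro exI conjI allI impI)
  let ?e = "\<lambda>x::real. if 0 < x then exp (- (1 / x)) else 0"
  \<comment> \<open>e(1 + x) e(1 - x) is positive exactly on (-1, 1). The trivial factors 1 match
    the shape of \<open>smooth_affine\<close>.\<close>
  let ?b = "\<lambda>x. (1 * ?e (1 * x + 1)) * (1 * ?e ((-1) * x + 1))"
  show "smooth ?b"
    by (intro smooth_mult smooth_affine smooth_exp_inverse)
  show "0 \<le> ?b x" for x by auto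
  show "0 < ?b x" if "\<bar>x\<bar> < 1" for x using that by auto
  show "?b x = 0" if "1 \<le> \<bar>x\<bar>" for x using that by auto
qed

lemma continuous_antiderivative:
  fixes f :: "real \<Rightarrow> real"
  assumes "\<And>x. isCont f x"
  shows "\<exists>F. \<forall>x. (F has_real_derivative f x) (at x)"
proof (intro exI allI)
  fix x :: real
  define a b where "a = min 0 x - 1" and "b = max 0 x + 1"
  have ab: "a \<le> 0" "0 \<le> b" "a < x" "x < b" by (auto simp: a_def b_def)
  have "((\<lambda>u. LBINT y=0..u. f y) has_vector_derivative f x) (at x within {a..b})"
    using interval_integral_FTC2[of a 0 b f x] assms ab
    by (simp add: zero_ereal_def continuous_at_imp_continuous_on)
  then show "((\<lambda>u. LBINT y=0..u. f y) has_real_derivative f x) (at x)"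
    using ab at_within_Icc_at[of a x b] by (simp add: has_real_derivative_iff_has_vector_derivative)
qed

text \<open>Integrating a normalised bump \<open>\<rho>\<close> twice gives a smooth version
  \<open>R\<close> of the positive part, the fundamental solution of the second derivative. Second
  differences of \<open>R\<close> are then smoothed hats of bounded support whose second derivatives
  are mollifiers. The offset \<open>d\<close> cancels in them, so its value is immaterial.\<close>

lemma exists_mollifier:
  obtains \<rho> R :: "real \<Rightarrow> real" and C d where "smooth R" "\<And>x. (R has_real_derivative deriv R x) (at x)"
    "\<And>x. (deriv R has_real_derivative \<rho> x) (at x)" "smooth \<rho>" "\<And>x. 0 \<le> \<rho> x"
    "\<And>x. 1 \<le> \<bar>x\<bar> \<Longrightarrow> \<rho> x = 0" "has_bochner_integral lborel \<rho> 1"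
    "\<And>x. x \<le> -1 \<Longrightarrow> R x = 0" "\<And>x. 1 \<le> x \<Longrightarrow> R x = x + d" "\<And>x. \<bar>R x - max x 0\<bar> \<le> C"
proof -
  obtain b :: "real \<Rightarrow> real" where b: "smooth b" "\<And>x. 0 \<le> b x" "\<And>x. \<bar>x\<bar> < 1 \<Longrightarrow> 0 < b x"
    "\<And>x. 1 \<le> \<bar>x\<bar> \<Longrightarrow> b x = 0" using exists_bump by blast
  obtain B where B: "\<And>x. (B has_real_derivative b x) (at x)"
    using continuous_antiderivative[OF smooth_isCont[OF b(1)]] by blast
  \<comment> \<open>The integral of the bump; dividing by it makes \<open>R1\<close> rise from 0 to
    1.\<close>
  define \<kappa> where "\<kappa> = B 1 - B (-1)"
  have "B (-1) < B 1"
  proof (rule DERIV_pos_imp_increasing_open[where f=B])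
    show "\<exists>y. (B has_real_derivative y) (at x) \<and> 0 < y" if "- 1 < x" "x < 1" for x
      using that by (intro exI[of _ "b x"] conjI B b(3)) auto
    show "continuous_on {-1..1} B" by (intro continuous_at_imp_continuous_on ballI DERIV_isCont[OF B])
  qed simp
  then have \<kappa>: "\<kappa> > 0" by (simp add: \<kappa>_def)
  define \<rho> where "\<rho> x = b x / \<kappa>" for x
  define R1 where "R1 x = (B x - B (-1)) / \<kappa>" for x
  have R1: "(R1 has_real_derivative \<rho> x) (at x)" for x
    unfolding R1_def \<rho>_def using \<kappa> B[of x] by (auto intro!: derivative_eq_intros)
  have \<rho>: "smooth \<rho>" using smooth_affine[OF b(1), of "1/\<kappa>" 1 0] by (simp add: \<rho>_def[abs_def])
  have "smooth R1" using smoothI R1 \<rho> by blast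
  obtain R0 where R0: "\<And>x. (R0 has_real_derivative R1 x) (at x)"
    using continuous_antiderivative[OF smooth_isCont[OF \<open>smooth R1\<close>]] by blast
  define R where "R x = R0 x - R0 (-1)" for x
  have R: "(R has_real_derivative R1 x) (at x)" for x
    unfolding R_def using R0[of x] by (auto intro!: derivative_eq_intros)
  then have dR: "deriv R = R1" by (auto intro!: DERIV_imp_deriv)
  have "smooth R" using smoothI R \<open>smooth R1\<close> by blast
  have \<rho>0: "\<rho> x \<ge> 0" for x using b(2)[of x] \<kappa> by (simp add: \<rho>_def)
  have \<rho>s: "\<rho> x = 0" if "1 \<le> \<bar>x\<bar>" for x using b(4) that by (simp add: \<rho>_def)
  have R1l: "R1 x = 0" if "x \<le> -1" for x
  proof (cases "x = -1")
    case False
    then have "x < -1" using that by simp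
    then obtain z where z: "x < z" "z < -1" "R1 (-1) - R1 x = (-1 - x) * \<rho> z"
      using MVT2[of x "-1" R1 \<rho>] R1 by auto
    then have "R1 x = R1 (-1)" using \<rho>s[of z] by simp
    then show ?thesis by (simp add: R1_def)
  qed (simp add: R1_def)
  have R1r: "R1 x = 1" if "1 \<le> x" for x
  proof (cases "x = 1")
    case False
    then have "1 < x" using that by simp
    then obtain z where z: "1 < z" "z < x" "R1 x - R1 1 = (x - 1) * \<rho> z"
      using MVT2[of 1 x R1 \<rho>] R1 by auto
    then have "R1 x = R1 1" using \<rho>s[of z] by simp
    then show ?thesis using \<kappa> by (simp add: R1_def \<kappa>_def)
  qed (use \<kappa> in \<open>simp add: R1_def \<kappa>_def\<close>)
  have Rl: "R x = 0" if "x \<le> -1" for x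
  proof (cases "x = -1")
    case False
    then have "x < -1" using that by simp
    then obtain z where z: "x < z" "z < -1" "R (-1) - R x = (-1 - x) * R1 z"
      using MVT2[of x "-1" R R1] R by auto
    then have "R x = R (-1)" using R1l[of z] by simp
    then show ?thesis by (simp add: R_def)
  qed (simp add: R_def)
  define d where "d = R 1 - 1"
  have Rr: "R x = x + d" if "1 \<le> x" for x
  proof (cases "x = 1")
    case False
    then have "1 < x" using that by simp
    then obtain z where z: "1 < z" "z < x" "R x - R 1 = (x - 1) * R1 z"
      using MVT2[of 1 x R R1] R by auto
    then show ?thesis using R1r[of z] by (simp add: d_def)
  qed (simp add: d_def)
  have "continuous_on {-1..1} (\<lambda>x. R x - max x 0)"
    using R by (intro continuous_intros) (meson DERIV_isCont continuous_at_imp_continuous_on)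
  then have "bounded ((\<lambda>x. R x - max x 0) ` {-1..1})"
    by (intro compact_imp_bounded compact_continuous_image) auto
  then obtain C where C: "\<And>x. x \<in> {-1..1} \<Longrightarrow> \<bar>R x - max x 0\<bar> \<le> C"
    unfolding bounded_iff by fastforce
  have *: "\<bar>R x - max x 0\<bar> \<le> \<bar>C\<bar> + \<bar>d\<bar>" for x
    using C[of x] Rl[of x] Rr[of x] by (cases "x \<le> -1"; cases "1 \<le> x") auto
  have "has_bochner_integral lborel (\<lambda>x. \<rho> x * indicator {-1..1} x) (R1 1 - R1 (-1))"
    using R1 smooth_isCont[OF \<rho>] by (intro has_bochner_integral_FTC_Icc_real) auto
  moreover have "\<rho> x * indicator {-1..1} x = \<rho> x" for x
    using \<rho>s[of x] by (cases "1 \<le> \<bar>x\<bar>") (auto simp: indicator_def)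
  ultimately have i: "has_bochner_integral lborel \<rho> 1" using R1l[of "-1"] R1r[of 1] by simp
  show ?thesis
    by (rule that[of R \<rho> d "\<bar>C\<bar> + \<bar>d\<bar>", unfolded dR,
          OF \<open>smooth R\<close> R R1 \<rho> \<rho>0 \<rho>s i Rl Rr *])
qed

section \<open>Second differences of the kernel\<close>

text \<open>Left unnormalised, with height h and integral h^2: this is exactly the second difference
  of the positive part with step h, and it is monotone in h.\<close>

definition hat :: "real \<Rightarrow> real \<Rightarrow> real" where
  "hat h r = max 0 (h - \<bar>r\<bar>)"

lemma hat_nonneg: "0 \<le> hat h r"
  by (simp add: hat_def)

lemma hat_le: "0 \<le> h \<Longrightarrow> hat h r \<le> h"
  by (simp add: hat_def)

lemma hat_mono: "h \<le> h' \<Longrightarrow> hat h r \<le> hat h' r"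
  by (simp add: hat_def)

lemma hat_eq_0: "h \<le> \<bar>r\<bar> \<Longrightarrow> hat h r = 0"
  by (simp add: hat_def)

lemma hat_minus [simp]: "hat h (- r) = hat h r"
  by (simp add: hat_def)

lemma borel_measurable_hat [measurable]:
  assumes [measurable]: "f \<in> borel_measurable M"
  shows "(\<lambda>x. hat h (f x)) \<in> borel_measurable M"
  unfolding hat_def by simp

lemma hat_eq_second_difference:
  assumes "0 \<le> h"
  shows "hat h r = max (r + h) 0 - 2 * max r 0 + max (r - h) 0"
  using assms by (auto simp: hat_def max_def abs_if)

text \<open>Substituting y = a + x / Suc n moves the scaling into the argument of
  \<open>\<beta>\<close>. As \<open>\<rho>\<close> vanishes off (-1, 1), only values of
  \<open>\<beta>\<close> on [a - 1, a + 1] matter, where it is bounded; this gives the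
  domination.\<close>

lemma mollification_tendsto:
  fixes \<beta> \<rho> :: "real \<Rightarrow> real"
  assumes \<beta>: "continuous_on UNIV \<beta>" and \<rho>: "\<And>x. 0 \<le> \<rho> x" "\<And>x. 1 \<le> \<bar>x\<bar> \<Longrightarrow> \<rho> x = 0"
    "has_bochner_integral lborel \<rho> 1"
  shows "integrable lborel (\<lambda>y. \<beta> y * (\<rho> ((y - a) * real (Suc n)) * real (Suc n)))"
    and "(\<lambda>n. LINT y|lborel. \<beta> y * (\<rho> ((y - a) * real (Suc n)) * real (Suc n))) \<longlonglongrightarrow> \<beta> a"
proof -
  let ?J = "\<lambda>n. LINT y|lborel. \<beta> y * (\<rho> ((y - a) * real (Suc n)) * real (Suc n))"
  have [measurable]: "\<beta> \<in> borel_measurable borel"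
    using \<beta> by (rule borel_measurable_continuous_onI)
  have int: "integrable lborel \<rho>" and [measurable]: "\<rho> \<in> borel_measurable borel"
    using \<rho>(3) by (auto simp: has_bochner_integral_iff)
  let ?s = "\<lambda>n x. \<beta> (a + x / real (Suc n)) * \<rho> x"
  have "compact (\<beta> ` {a - 1..a + 1})"
    by (intro compact_continuous_image continuous_on_subset[OF \<beta>]) auto
  then obtain K where K: "\<And>y. y \<in> {a - 1..a + 1} \<Longrightarrow> \<bar>\<beta> y\<bar> \<le> K"
    unfolding bounded_iff[THEN iffD1, OF compact_imp_bounded] by (force dest!: compact_imp_bounded simp: bounded_iff)
  have bd: "norm (?s n x) \<le> K * \<rho> x" for n x
  proof (cases "1 \<le> \<bar>x\<bar>")
    case False
    then have "\<bar>x / real (Suc n)\<bar> \<le> 1" by (simp only: abs_divide) (simp add: divide_le_eq)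
    then have "a + x / real (Suc n) \<in> {a - 1..a + 1}"
      unfolding abs_le_iff atLeastAtMost_iff by linarith
    then show ?thesis using K \<rho>(1)[of x] by (simp add: abs_mult mult_right_mono)
  qed (simp add: \<rho>)
  have int_s: "integrable lborel (?s n)" for n
    by (rule Bochner_Integration.integrable_bound[where f="\<lambda>x. K * \<rho> x"])
       (use int bd in \<open>auto intro!: AE_I2 order.trans[OF _ abs_ge_self]\<close>)
  show "integrable lborel (\<lambda>y. \<beta> y * (\<rho> ((y - a) * real (Suc n)) * real (Suc n)))"
    using integrable_mult_left[OF int_s, of n "real (Suc n)"]
    by (subst lborel_integrable_real_affine_iff[symmetric, of "1 / real (Suc n)" _ a])
       (auto simp: mult.assoc)
  have "?J n = (LINT x|lborel. ?s n x)" for n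
    by (subst lborel_integral_real_affine[of "1 / real (Suc n)" _ a])
       (auto simp: mult.assoc[symmetric])
  moreover have "(\<lambda>n. LINT x|lborel. ?s n x) \<longlonglongrightarrow> (LINT x|lborel. \<beta> a * \<rho> x)"
  proof (rule integral_dominated_convergence[where w="\<lambda>x. K * \<rho> x"])
    have "(\<lambda>n. ?s n x) \<longlonglongrightarrow> \<beta> a * \<rho> x" for x
    proof -
      have "(\<lambda>n. a + x / real (Suc n)) \<longlonglongrightarrow> a + 0"
        by (intro tendsto_intros) real_asymp
      moreover have "isCont \<beta> a" using \<beta> by (simp add: continuous_on_eq_continuous_at)
      ultimately have "(\<lambda>n. \<beta> (a + x / real (Suc n))) \<longlonglongrightarrow> \<beta> a"
        using isCont_tendsto_compose by fastforce
      then show ?thesis by (intro tendsto_intros)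
    qed
    then show "AE x in lborel. (\<lambda>n. ?s n x) \<longlonglongrightarrow> \<beta> a * \<rho> x" by simp
  qed (use bd int in auto)
  ultimately show "?J \<longlonglongrightarrow> \<beta> a"
    using \<rho>(3) by (simp add: has_bochner_integral_iff)
qed

text \<open>The test function is the second difference, with step \<open>h\<close>, of the double primitive of a mollifier.\<close>

lemma second_difference_test_function:
  assumes "h > 0"
  obtains \<theta> :: "nat \<Rightarrow> real \<Rightarrow> real" and \<rho> :: "real \<Rightarrow> real" and C where
    "\<And>n. test_function (\<theta> n)"
    "\<And>x. 0 \<le> \<rho> x" "\<And>x. 1 \<le> \<bar>x\<bar> \<Longrightarrow> \<rho> x = 0" "has_bochner_integral lborel \<rho> 1"
    "\<And>n y. \<bar>\<theta> n y - hat h (y - x)\<bar> \<le> C / real (Suc n)"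
    "\<And>n. (deriv ^^ 2) (\<theta> n) = (\<lambda>y. \<rho> ((y - (x - h)) * real (Suc n)) * real (Suc n)
        - 2 * (\<rho> ((y - x) * real (Suc n)) * real (Suc n)) + \<rho> ((y - (x + h)) * real (Suc n)) * real (Suc n))"
proof -
  obtain \<rho> R :: "real \<Rightarrow> real" and C d where R: "smooth R" "\<And>x. (R has_real_derivative deriv R x) (at x)"
    "\<And>x. (deriv R has_real_derivative \<rho> x) (at x)"
    and \<rho>: "smooth \<rho>" "\<And>x. 0 \<le> \<rho> x"
    "\<And>x. 1 \<le> \<bar>x\<bar> \<Longrightarrow> \<rho> x = 0" "has_bochner_integral lborel \<rho> 1"
    and R': "\<And>x. x \<le> -1 \<Longrightarrow> R x = 0" "\<And>x. 1 \<le> x \<Longrightarrow> R x = x + d" "\<And>x. \<bar>R x - max x 0\<bar> \<le> C"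
    by (rule exists_mollifier) blast
  define r where "r m a y = R ((y - a) * m) / m" for m a y :: real
  have smooth_r: "smooth (\<lambda>y. c * r m a y)" for c m a
    using smooth_affine[OF R(1), of "c / m" m "- (a * m)"] by (simp add: r_def algebra_simps)
  define \<theta> where "\<theta> n y = 1 * r (real (Suc n)) (x - h) y + ((- 2) * r (real (Suc n)) x y + 1 * r (real (Suc n)) (x + h) y)" for n y
  have smooth_\<theta>: "smooth (\<theta> n)" for n
    unfolding \<theta>_def by (intro smooth_add smooth_r)
  have supp: "\<theta> n y = 0" if "\<bar>y\<bar> > \<bar>x\<bar> + h + 1" for n y
  proof -
    define m where "m = real (Suc n)"
    have m: "m \<ge> 1" by (simp add: m_def)
    have "y - (x + h) \<ge> 1 \<or> y - (x - h) \<le> -1" using that assms by arith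
    then consider "y - (x + h) \<ge> 1" | "y - (x - h) \<le> -1" by blast
    then show ?thesis
    proof cases
      \<comment> \<open>To the right, all three translates are affine with equal slope and offset,
        and the weights 1, -2, 1 annihilate affine functions. To the left, all three vanish.\<close>
      case 1
      then have *: "(y - a) * m \<ge> 1" if "a \<le> x + h" for a
        using that m mult_mono[of 1 "y - a" 1 m] by simp
      have "R ((y - a) * m) = (y - a) * m + d" if "a \<le> x + h" for a
        using *[OF that] R'(2) by blast
      from this[of "x - h"] this[of x] this[of "x + h"] show ?thesis
        using m assms unfolding \<theta>_def r_def m_def[symmetric]
        by (simp only:) (simp add: field_simps)
    next
      case 2
      then have *: "(y - a) * m \<le> -1" if "a \<ge> x - h" for a
        using that m mult_mono[of 1 "- (y - a)" 1 m] by (simp add: algebra_simps)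
      show ?thesis using m assms unfolding \<theta>_def r_def m_def[symmetric]
        by (simp add: R'(1) *)
    qed
  qed
  have test: "test_function (\<theta> n)" for n
    using smooth_imp_C_k[OF smooth_\<theta>] supp unfolding test_function_def by blast
  \<comment> \<open>Each rescaled \<open>R\<close> is within C / m of the positive part, and the
    weights 1, -2, 1 have total size 4.\<close>
  have close: "\<bar>\<theta> n y - hat h (y - x)\<bar> \<le> 4 * C / real (Suc n)" for n y
  proof -
    define m where "m = real (Suc n)"
    have m: "m > 0" by (simp add: m_def)
    have *: "\<bar>r m a y - max (y - a) 0\<bar> \<le> C / m" for a
    proof -
      have "r m a y - max (y - a) 0 = (R ((y - a) * m) - max ((y - a) * m) 0) / m"
        using m by (auto simp: r_def field_simps max_def mult_less_0_iff not_le)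
      then show ?thesis using R'(3)[of "(y - a) * m"] m by (simp add: divide_right_mono)
    qed
    have "y - x + h = y - (x - h)" "y - x - h = y - (x + h)" "4 * C / m = 4 * (C / m)" by auto
    moreover have "\<bar>1 * a + (- 2 * b + 1 * c) - (p - 2 * q + w)\<bar> \<le> 4 * e"
      if "\<bar>a - p\<bar> \<le> e" "\<bar>b - q\<bar> \<le> e" "\<bar>c - w\<bar> \<le> e" for a b c p q w e :: real
      using that by arith
    ultimately show ?thesis using *[of "x - h"] *[of x] *[of "x + h"]
      unfolding \<theta>_def m_def[symmetric] hat_eq_second_difference[OF less_imp_le[OF assms]]
      by (simp only:)
  qed
  have "(deriv ^^ 2) (\<theta> n) = (\<lambda>y. \<rho> ((y - (x - h)) * real (Suc n)) * real (Suc n)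
        - 2 * (\<rho> ((y - x) * real (Suc n)) * real (Suc n)) + \<rho> ((y - (x + h)) * real (Suc n)) * real (Suc n))" for n
  proof -
    define m where "m = real (Suc n)"
    have m: "m \<noteq> 0" by (simp add: m_def)
    have r1: "(r m a has_real_derivative deriv R ((y - a) * m)) (at y)" for a y
      unfolding r_def using m by (auto intro!: derivative_eq_intros DERIV_chain2[OF R(2)])
    have r2: "((\<lambda>y. deriv R ((y - a) * m)) has_real_derivative \<rho> ((y - a) * m) * m) (at y)" for a y
      by (auto intro!: derivative_eq_intros DERIV_chain2[OF R(3)])
    have "deriv (\<theta> n) = (\<lambda>y. deriv R ((y - (x - h)) * m) + ((- 2) * deriv R ((y - x) * m) + deriv R ((y - (x + h)) * m)))"
      unfolding \<theta>_def m_def[symmetric]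
      by (rule ext, rule DERIV_imp_deriv) (auto intro!: derivative_eq_intros r1)
    moreover have "deriv \<dots> = (\<lambda>y. \<rho> ((y - (x - h)) * m) * m + ((- 2) * (\<rho> ((y - x) * m) * m) + \<rho> ((y - (x + h)) * m) * m))"
      by (rule ext, rule DERIV_imp_deriv) (auto intro!: derivative_eq_intros r2)
    ultimately show ?thesis by (simp add: numeral_2_eq_2 m_def algebra_simps)
  qed
  with test \<rho>(2-4) close show ?thesis by (rule that)
qed

text \<open>The weak identity for the second derivative of \<open>\<beta>\<close> enters the
  estimates in this pointwise form, which is free of test functions.\<close>

locale second_derivative_kernel =
  P: finite_measure P + N: finite_measure N for P N :: "real measure" +
  fixes \<beta> :: "real \<Rightarrow> real"
  assumes sets_P [measurable_cong, simp]: "sets P = sets borel"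
    and sets_N [measurable_cong, simp]: "sets N = sets borel"
    and cont: "continuous_on UNIV \<beta>"
    and integrable: "integrable lborel \<beta>"
    and second_difference: "\<And>x h. h > 0 \<Longrightarrow> \<beta> (x + h) - 2 * \<beta> x + \<beta> (x - h) =
      (LINT y|P. hat h (y - x)) - (LINT y|N. hat h (y - x))"

text \<open>Both sides of the weak identity converge. On the left, the second derivative of the test
  function consists of three mollifiers that concentrate at x - h, x and x + h; on the right, the
  test functions tend uniformly to the hat, and \<open>P\<close> and \<open>N\<close> are
  finite.\<close>

lemma admissible_kernel_second_difference:
  assumes "admissible_kernel \<beta>"
  obtains P N where "second_derivative_kernel P N \<beta>"
proof -
  obtain P N where PN: "finite_measure P" "sets P = sets borel" "finite_measure N" "sets N = sets borel"
    and mu: "\<And>\<theta>. test_function \<theta> \<Longrightarrow>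
           (LINT x|lborel. \<beta> x * (deriv ^^ 2) \<theta> x) = (LINT x|P. \<theta> x) - (LINT x|N. \<theta> x)"
    using assms unfolding admissible_kernel_def by blast
  have cont: "continuous_on UNIV \<beta>" and int: "integrable lborel \<beta>"
    using assms by (auto simp: admissible_kernel_def)
  have "\<beta> (x + h) - 2 * \<beta> x + \<beta> (x - h) = (LINT y|P. hat h (y - x)) - (LINT y|N. hat h (y - x))"
    if h: "h > 0" for x h
  proof -
    obtain \<theta> :: "nat \<Rightarrow> real \<Rightarrow> real" and \<rho> :: "real \<Rightarrow> real" and C where
      \<theta>: "\<And>n. test_function (\<theta> n)" and
      \<rho>: "\<And>x. 0 \<le> \<rho> x" "\<And>x. 1 \<le> \<bar>x\<bar> \<Longrightarrow> \<rho> x = 0" "has_bochner_integral lborel \<rho> 1" and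
      close: "\<And>n y. \<bar>\<theta> n y - hat h (y - x)\<bar> \<le> C / real (Suc n)" and
      d2: "\<And>n. (deriv ^^ 2) (\<theta> n) = (\<lambda>y. \<rho> ((y - (x - h)) * real (Suc n)) * real (Suc n)
        - 2 * (\<rho> ((y - x) * real (Suc n)) * real (Suc n)) + \<rho> ((y - (x + h)) * real (Suc n)) * real (Suc n))"
      by (rule second_difference_test_function[OF h, where x=x]) blast
    let ?m = "\<lambda>n a y. \<beta> y * (\<rho> ((y - a) * real (Suc n)) * real (Suc n))"
    have moll1: "integrable lborel (?m n a)" for n a
      using cont \<rho> by (rule mollification_tendsto)
    have moll2: "(\<lambda>n. LINT y|lborel. ?m n a y) \<longlonglongrightarrow> \<beta> a" for a
      using cont \<rho> by (rule mollification_tendsto)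
    have "(\<lambda>n. (LINT y|lborel. ?m n (x - h) y) - 2 * (LINT y|lborel. ?m n x y) + (LINT y|lborel. ?m n (x + h) y))
       \<longlonglongrightarrow> \<beta> (x - h) - 2 * \<beta> x + \<beta> (x + h)"
      by (intro tendsto_intros moll2)
    moreover have "(LINT y|lborel. \<beta> y * (deriv ^^ 2) (\<theta> n) y) =
        (LINT y|lborel. ?m n (x - h) y) - 2 * (LINT y|lborel. ?m n x y) + (LINT y|lborel. ?m n (x + h) y)" for n
    proof -
      have "(LINT y|lborel. \<beta> y * (deriv ^^ 2) (\<theta> n) y) = (LINT y|lborel. ?m n (x - h) y - 2 * ?m n x y + ?m n (x + h) y)"
        unfolding d2 by (intro Bochner_Integration.integral_cong) (auto simp: algebra_simps)
      also have "\<dots> = (LINT y|lborel. ?m n (x - h) y) - 2 * (LINT y|lborel. ?m n x y) + (LINT y|lborel. ?m n (x + h) y)"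
        by (subst Bochner_Integration.integral_add Bochner_Integration.integral_diff,
            (intro Bochner_Integration.integrable_diff integrable_mult_right moll1)+)+ simp
      finally show ?thesis .
    qed
    ultimately have lim1: "(\<lambda>n. (LINT y|P. \<theta> n y) - (LINT y|N. \<theta> n y)) \<longlonglongrightarrow> \<beta> (x - h) - 2 * \<beta> x + \<beta> (x + h)"
      using mu[OF \<theta>] by simp
    have lim: "(\<lambda>n. LINT y|M. \<theta> n y) \<longlonglongrightarrow> (LINT y|M. hat h (y - x))"
      if "finite_measure M" and [measurable_cong]: "sets M = sets borel" for M
    proof (rule integral_dominated_convergence[where w="\<lambda>_. h + \<bar>C\<bar>"])
      interpret finite_measure M by fact
      have [measurable]: "\<theta> n \<in> borel_measurable borel" for n
      proof -
        have "C_k 0 (\<theta> n)" using \<theta>[of n] by (simp add: test_function_def)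
        then show ?thesis by (auto simp: C_k_def intro!: borel_measurable_continuous_onI)
      qed
      show "\<theta> n \<in> borel_measurable M" for n by measurable
      show "(\<lambda>y. hat h (y - x)) \<in> borel_measurable M" by measurable
      show "integrable M (\<lambda>_. h + \<bar>C\<bar>)" by simp
      show "AE y in M. (\<lambda>n. \<theta> n y) \<longlonglongrightarrow> hat h (y - x)"
      proof (rule AE_I2)
        fix y
        have "(\<lambda>n. C / real (Suc n)) \<longlonglongrightarrow> 0" by real_asymp
        then have "(\<lambda>n. \<theta> n y - hat h (y - x)) \<longlonglongrightarrow> 0"
          by (rule Lim_null_comparison[rotated]) (use close in auto)
        then show "(\<lambda>n. \<theta> n y) \<longlonglongrightarrow> hat h (y - x)" by (simp add: LIM_zero_iff)
      qed
      show "AE y in M. norm (\<theta> n y) \<le> h + \<bar>C\<bar>" for n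
      proof (rule AE_I2)
        fix y
        have "C / real (Suc n) \<le> \<bar>C\<bar> / 1" by (intro frac_le) auto
        then show "norm (\<theta> n y) \<le> h + \<bar>C\<bar>"
          using close[of n y] hat_nonneg[of h "y - x"] hat_le[of h "y - x"] h by (auto simp: abs_le_iff)
      qed
    qed
    have "(\<lambda>n. (LINT y|P. \<theta> n y) - (LINT y|N. \<theta> n y)) \<longlonglongrightarrow> (LINT y|P. hat h (y - x)) - (LINT y|N. hat h (y - x))"
      using PN by (intro tendsto_intros lim)
    with lim1 have "\<beta> (x - h) - 2 * \<beta> x + \<beta> (x + h) = (LINT y|P. hat h (y - x)) - (LINT y|N. hat h (y - x))"
      using LIMSEQ_unique by blast
    then show ?thesis by simp
  qed
  then have "second_derivative_kernel P N \<beta>"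
    using PN cont int by (simp add: second_derivative_kernel_def second_derivative_kernel_axioms_def)
  then show ?thesis by (rule that)
qed

section \<open>Discrete convolution and piecewise linear interpolation\<close>

definition grid_interpolation :: "real \<Rightarrow> (int \<Rightarrow> real) \<Rightarrow> real \<Rightarrow> real" where
  "grid_interpolation h w y =
     (of_int \<lfloor>y / h\<rfloor> + 1 - y / h) * w \<lfloor>y / h\<rfloor> + (y / h - of_int \<lfloor>y / h\<rfloor>) * w (\<lfloor>y / h\<rfloor> + 1)"

text \<open>At most the two nodes of the cell around y lie closer to y than h. For constant w this
  says that the hats divided by h form a partition of unity, which later provides the dominating
  functions.\<close>

lemma has_sum_hat:
  assumes h: "h > 0"
  shows "((\<lambda>k::int. hat h (y - of_int k * h) * w k) has_sum h * grid_interpolation h w y) UNIV"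
proof -
  define k where "k = \<lfloor>y / h\<rfloor>"
  have k: "of_int k * h \<le> y" "y < (of_int k + 1) * h"
    using h by (auto simp: k_def pos_le_divide_eq[symmetric] pos_divide_less_eq[symmetric])
  show ?thesis
  proof (rule has_sum_finite_neutralI[where B="{k, k + 1}"])
    fix j :: int assume "j \<in> UNIV - {k, k + 1}"
    then have "j + 1 \<le> k \<or> k + 2 \<le> j" by auto
    then have "h \<le> \<bar>y - of_int j * h\<bar>"
    proof
      assume "j + 1 \<le> k"
      then have "(of_int j + 1) * h \<le> of_int k * h" using h by (intro mult_right_mono) linarith+
      then show ?thesis using k by (simp add: algebra_simps)
    next
      assume "k + 2 \<le> j"
      then have "(of_int k + 2) * h \<le> of_int j * h" using h by (intro mult_right_mono) linarith+
      then show ?thesis using k by (simp add: algebra_simps)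
    qed
    then show "hat h (y - of_int j * h) * w j = 0" by (simp add: hat_eq_0)
  next
    have "hat h (y - of_int k * h) = h * (of_int k + 1 - y / h)" "hat h (y - of_int (k + 1) * h) = h * (y / h - of_int k)"
      using k h by (auto simp: hat_def algebra_simps)
    then show "h * grid_interpolation h w y = (\<Sum>j\<in>{k, k + 1}. hat h (y - of_int j * h) * w j)"
      unfolding grid_interpolation_def k_def[symmetric] by (simp add: distrib_left)
  qed auto
qed

lemma grid_interpolation_diff:
  "grid_interpolation h v y - grid_interpolation h w y = grid_interpolation h (\<lambda>k. v k - w k) y"
  by (simp add: grid_interpolation_def algebra_simps)

lemma grid_interpolation_const [simp]: "grid_interpolation h (\<lambda>_. c) y = c"
  by (simp add: grid_interpolation_def algebra_simps)

lemma abs_add_mult_le: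
  fixes a b x y :: real
  assumes "0 \<le> a" "0 \<le> b"
  shows "\<bar>a * x + b * y\<bar> \<le> a * \<bar>x\<bar> + b * \<bar>y\<bar>"
  using abs_triangle_ineq[of "a * x" "b * y"] assms by (simp add: abs_mult)

lemma abs_grid_interpolation_le:
  assumes "\<And>k. \<bar>w k\<bar> \<le> B"
  shows "\<bar>grid_interpolation h w y\<bar> \<le> B"
proof -
  define k a b where "k = \<lfloor>y / h\<rfloor>" and "a = of_int k + 1 - y / h" and "b = y / h - of_int k"
  have ab: "0 \<le> a" "0 \<le> b" "a + b = 1" unfolding a_def b_def k_def by linarith+
  have "\<bar>grid_interpolation h w y\<bar> \<le> a * \<bar>w k\<bar> + b * \<bar>w (k + 1)\<bar>"
    unfolding grid_interpolation_def k_def[symmetric] a_def[symmetric] b_def[symmetric]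
    using ab by (intro abs_add_mult_le)
  also have "\<dots> \<le> a * B + b * B" using ab assms by (intro add_mono mult_left_mono)
  also have "\<dots> = B" using ab(3) by (simp add: distrib_right[symmetric])
  finally show ?thesis .
qed

lemma borel_measurable_grid_interpolation [measurable]:
  assumes h: "h > 0"
  shows "grid_interpolation h w \<in> borel_measurable borel"
  unfolding grid_interpolation_def[abs_def] by measurable

text \<open>The first-order term of the Taylor expansion at \<open>y\<close> drops out of the interpolation.\<close>

lemma grid_interpolation_error:
  assumes h: "h > 0" and G: "\<And>x. (G has_real_derivative G' x) (at x)" "\<And>x. (G' has_real_derivative G'' x) (at x)"
    and B: "\<And>x. \<bar>G'' x\<bar> \<le> B"
  shows "\<bar>grid_interpolation h (\<lambda>k. G (of_int k * h)) y - G y\<bar> \<le> B * h\<^sup>2"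
proof -
  have B0: "0 \<le> B" using B[of 0] by linarith
  have taylor: "\<bar>G x - G y - G' y * (x - y)\<bar> \<le> B * h\<^sup>2" if "\<bar>x - y\<bar> \<le> h" for x
  proof (cases "x = y")
    case False
    define diff where "diff m = (if m = 0 then G else if m = Suc 0 then G' else G'')" for m :: nat
    have "\<exists>t. (if x < y then x < t \<and> t < y else y < t \<and> t < x) \<and>
      G x = (\<Sum>m<2. (diff m y / fact m) * (x - y)^m) + (diff 2 t / fact 2) * (x - y)^2"
      by (rule Taylor[where a="min x y" and b="max x y"]) (use False G in \<open>auto simp: diff_def less_2_cases_iff\<close>)
    then obtain t where "G x = (\<Sum>m<2. (diff m y / fact m) * (x - y)^m) + (diff 2 t / fact 2) * (x - y)^2"
      by blast
    then have "G x - G y - G' y * (x - y) = G'' t / 2 * (x - y)\<^sup>2"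
      by (simp add: diff_def numeral_2_eq_2)
    also have "\<bar>\<dots>\<bar> = \<bar>G'' t\<bar> / 2 * (x - y)\<^sup>2" by (simp add: abs_mult)
    also have "\<dots> \<le> B * h\<^sup>2"
      using B[of t] B0 power_mono[OF that, of 2] by (intro mult_mono) auto
    finally show ?thesis .
  qed (use B0 in simp)
  define k a b where "k = \<lfloor>y / h\<rfloor>" and "a = of_int k + 1 - y / h" and "b = y / h - of_int k"
  have ab: "0 \<le> a" "0 \<le> b" "a + b = 1" unfolding a_def b_def k_def by linarith+
  have k: "of_int k * h \<le> y" "y < (of_int k + 1) * h"
    using h by (auto simp: k_def pos_le_divide_eq[symmetric] pos_divide_less_eq[symmetric])
  define p q where "p = of_int k * h" and "q = of_int (k + 1) * h"
  have lin: "a * p + b * q = y" using h by (simp add: a_def b_def p_def q_def field_simps)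
  have "a * (G p - G y - G' y * (p - y)) + b * (G q - G y - G' y * (q - y))
      = a * G p + b * G q - (a + b) * G y - G' y * (a * p + b * q - (a + b) * y)"
    by (simp add: algebra_simps)
  also have "\<dots> = grid_interpolation h (\<lambda>k. G (of_int k * h)) y - G y"
    unfolding lin ab(3) grid_interpolation_def by (simp add: k_def a_def b_def p_def q_def)
  finally have "\<bar>grid_interpolation h (\<lambda>k. G (of_int k * h)) y - G y\<bar>
     \<le> a * \<bar>G p - G y - G' y * (p - y)\<bar> + b * \<bar>G q - G y - G' y * (q - y)\<bar>"
    using abs_add_mult_le[OF ab(1,2)] by metis
  also have "\<dots> \<le> a * (B * h\<^sup>2) + b * (B * h\<^sup>2)"
    using ab k h by (intro add_mono mult_left_mono taylor) (auto simp: p_def q_def algebra_simps abs_le_iff)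
  also have "\<dots> = B * h\<^sup>2" using ab(3) by (simp add: distrib_right[symmetric])
  finally show ?thesis .
qed

text \<open>The integers are enumerated by \<open>int_decode\<close>, so that termwise integration
  of series applies. The bound ranges over all finite sets and hence covers the partial sums of this
  enumeration; absolute convergence leads back to the unordered sum.\<close>

lemma has_sum_integral:
  fixes F :: "int \<Rightarrow> 'a \<Rightarrow> real"
  assumes meas [measurable]: "\<And>j. F j \<in> borel_measurable M" and G: "integrable M G"
    and bound: "\<And>A y. finite A \<Longrightarrow> (\<Sum>j\<in>A. \<bar>F j y\<bar>) \<le> G y"
    and sum: "\<And>y. ((\<lambda>j. F j y) has_sum S y) UNIV"
  shows "((\<lambda>j. LINT y|M. F j y) has_sum (LINT y|M. S y)) UNIV"
proof -
  define a where "a n = F (int_decode n)" for n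
  have int_a: "integrable M (a n)" for n
  proof (rule Bochner_Integration.integrable_bound[OF G])
    have "\<bar>a n y\<bar> \<le> G y" for y using bound[of "{int_decode n}" y] by (simp add: a_def)
    then show "AE y in M. norm (a n y) \<le> norm (G y)" by (auto intro!: AE_I2 order.trans[OF _ abs_ge_self])
  qed (simp add: a_def)
  have partial: "(\<Sum>n\<le>m. \<bar>a n y\<bar>) \<le> G y" for m y
  proof -
    have "(\<Sum>n\<le>m. \<bar>a n y\<bar>) = (\<Sum>j\<in>int_decode ` {..m}. \<bar>F j y\<bar>)"
      unfolding a_def by (subst sum.reindex) (auto simp: inj_int_decode)
    then show ?thesis using bound by simp
  qed
  have summ: "summable (\<lambda>n. norm (a n y))" for y
    by (rule bounded_imp_summable[where B="G y"]) (use partial in auto)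
  have "summable (\<lambda>n. LINT y|M. norm (a n y))"
  proof (rule bounded_imp_summable[where B="LINT y|M. G y"])
    fix m
    have "(\<Sum>n\<le>m. LINT y|M. norm (a n y)) = (LINT y|M. (\<Sum>n\<le>m. \<bar>a n y\<bar>))"
      using int_a by (subst Bochner_Integration.integral_sum) auto
    also have "\<dots> \<le> (LINT y|M. G y)"
      using int_a G partial by (intro integral_mono Bochner_Integration.integrable_sum) auto
    finally show "(\<Sum>n\<le>m. LINT y|M. norm (a n y)) \<le> (LINT y|M. G y)" .
  qed (auto intro: integral_nonneg)
  note su = this
  have S: "S y = (\<Sum>n. a n y)" for y
  proof -
    have "((\<lambda>n. a n y) has_sum S y) UNIV"
      unfolding a_def using sum[of y] has_sum_reindex_bij_betw[OF bij_int_decode, of "\<lambda>j. F j y"] by simp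
    then show ?thesis using has_sum_imp_sums sums_unique by blast
  qed
  have "(\<lambda>n. LINT y|M. a n y) sums (LINT y|M. S y)"
    unfolding S using int_a summ su by (intro sums_integral) auto
  moreover have "summable (\<lambda>n. norm (LINT y|M. a n y))"
    by (rule summable_comparison_test[OF _ su]) (auto intro!: exI integral_abs_bound)
  ultimately have "((\<lambda>n. LINT y|M. a n y) has_sum (LINT y|M. S y)) UNIV"
    by (intro norm_summable_imp_has_sum)
  then show ?thesis
    unfolding a_def using has_sum_reindex_bij_betw[OF bij_int_decode, of "\<lambda>j. LINT y|M. F j y"] by simp
qed

lemma has_bochner_integral_hat:
  assumes h: "h > 0"
  shows "has_bochner_integral lborel (hat h) (h\<^sup>2)"
proof -
  have 1: "has_bochner_integral lborel (\<lambda>r. (h - r) * indicator {0..h} r) ((h * h - h\<^sup>2 / 2) - (h * 0 - 0\<^sup>2 / 2))"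
    using h by (intro has_bochner_integral_FTC_Icc_real[where F="\<lambda>r. h * r - r\<^sup>2 / 2"])
      (auto intro!: derivative_eq_intros)
  have 2: "has_bochner_integral lborel (\<lambda>r. (h + r) * indicator {-h..0} r) ((h * 0 + 0\<^sup>2 / 2) - (h * (-h) + (-h)\<^sup>2 / 2))"
    using h by (intro has_bochner_integral_FTC_Icc_real[where F="\<lambda>r. h * r + r\<^sup>2 / 2"])
      (auto intro!: derivative_eq_intros)
  have "has_bochner_integral lborel (\<lambda>r. (h - r) * indicator {0..h} r + (h + r) * indicator {-h..0} r) (h\<^sup>2)"
    using has_bochner_integral_add[OF 1 2] by (simp add: power2_eq_square field_simps)
  \<comment> \<open>Both indicators are 1 at r = 0, where the sum is 2 h instead of h; hence
    equality only off a null set.\<close>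
  moreover have "AE r in lborel. (h - r) * indicator {0..h} r + (h + r) * indicator {-h..0} r = hat h r"
    using AE_lborel_singleton[of 0]
    by eventually_elim (use h in \<open>auto simp: hat_def indicator_def max_def\<close>)
  ultimately show ?thesis
    by (subst (asm) has_bochner_integral_cong_AE) auto
qed

lemma abs_integral_le_measure:
  fixes F :: "'a \<Rightarrow> real"
  assumes "finite_measure M" "F \<in> borel_measurable M" "\<And>y. \<bar>F y\<bar> \<le> D"
  shows "integrable M F" and "\<bar>LINT y|M. F y\<bar> \<le> D * measure M (space M)"
proof -
  interpret finite_measure M by fact
  show F: "integrable M F"
    by (rule integrable_const_bound[where B=D]) (use assms in auto)
  have "\<bar>LINT y|M. F y\<bar> \<le> (LINT y|M. \<bar>F y\<bar>)" by (rule integral_abs_bound)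
  also have "\<dots> \<le> (LINT y|M. D)" using F assms by (intro integral_mono) auto
  finally show "\<bar>LINT y|M. F y\<bar> \<le> D * measure M (space M)" by (simp add: mult.commute)
qed

text \<open>Integrates \<open>has_sum_hat\<close> over M. The partition of unity dominates every
  finite sum by the constant h B, which a finite measure integrates.\<close>

lemma has_sum_integral_hat:
  assumes M: "finite_measure M" and [measurable_cong]: "sets M = sets borel"
    and h: "h > 0" and w: "\<And>k. \<bar>w k\<bar> \<le> B"
  shows "((\<lambda>k::int. (LINT y|M. hat h (y - of_int k * h)) * w k) has_sum
           h * (LINT y|M. grid_interpolation h w y)) UNIV"
proof -
  interpret finite_measure M by fact
  have [measurable]: "grid_interpolation h w \<in> borel_measurable M"
    using borel_measurable_grid_interpolation[OF h] by measurable
  have "((\<lambda>k::int. LINT y|M. hat h (y - of_int k * h) * w k) has_sum (LINT y|M. h * grid_interpolation h w y)) UNIV"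
  proof (rule has_sum_integral[where G="\<lambda>_. h * B"])
    fix A :: "int set" and y assume "finite A"
    have "(\<Sum>k\<in>A. \<bar>hat h (y - of_int k * h) * w k\<bar>) \<le> (\<Sum>k\<in>A. hat h (y - of_int k * h) * B)"
      using w hat_nonneg by (intro sum_mono) (simp add: abs_mult mult_left_mono)
    also have "\<dots> \<le> h * grid_interpolation h (\<lambda>_. B) y"
      using w[of 0] by (intro finite_sum_le_has_sum[OF has_sum_hat[OF h] \<open>finite A\<close>]) (auto simp: hat_nonneg)
    finally show "(\<Sum>k\<in>A. \<bar>hat h (y - of_int k * h) * w k\<bar>) \<le> h * B" by simp
  qed (use has_sum_hat[OF h] in auto)
  then show ?thesis by (simp add: integral_mult_left_zero integral_mult_right_zero)
qed

section \<open>The discrete operator as an integral against \<open>P\<close> and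
  \<open>N\<close>\<close>

context second_derivative_kernel
begin

text \<open>\<open>P\<close> and \<open>N\<close> need not be mutually singular, so this number
  dominates the total variation of their difference and may exceed it.\<close>

definition mass :: real where
  "mass = measure P (space P) + measure N (space N)"

lemma mass_nonneg: "0 \<le> mass"
  by (simp add: mass_def)

lemma measurable_beta [measurable]: "\<beta> \<in> borel_measurable borel"
  using cont by (rule borel_measurable_continuous_onI)

lemma integrable_hat:
  assumes "h > 0"
  shows "integrable P (\<lambda>y. hat h (y - x))" "integrable N (\<lambda>y. hat h (y - x))"
  using assms
  by (auto intro!: abs_integral_le_measure[where D=h] P.finite_measure_axioms N.finite_measure_axioms
    simp: hat_le hat_nonneg)

text \<open>Integrate the second difference of \<open>\<beta>\<close> at \<open>x\<close> with step \<open>r\<close> against \<open>hat h r\<close>.\<close>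

lemma weighted_abs_beta_le:
  assumes h: "h > 0"
  shows "h\<^sup>2 * \<bar>\<beta> x\<bar> \<le> (LINT y|lborel. hat h (y - x) * \<bar>\<beta> y\<bar>)
    + h\<^sup>2 / 2 * ((LINT y|P. hat h (y - x)) + (LINT y|N. hat h (y - x)))"
proof -
  define D where "D = (LINT y|P. hat h (y - x)) + (LINT y|N. hat h (y - x))"
  \<comment> \<open>\<open>D\<close> serves all steps of modulus at most h at once, because hats
    grow with their width.\<close>
  have diff: "\<bar>\<beta> (x + r) + \<beta> (x - r) - 2 * \<beta> x\<bar> \<le> D" if "\<bar>r\<bar> \<le> h" for r
  proof (cases "r = 0")
    case True
    then show ?thesis unfolding D_def by (auto intro!: add_nonneg_nonneg Bochner_Integration.integral_nonneg hat_nonneg)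
  next
    case False
    then have r: "\<bar>r\<bar> > 0" by simp
    have "\<beta> (x + r) + \<beta> (x - r) - 2 * \<beta> x = \<beta> (x + \<bar>r\<bar>) - 2 * \<beta> x + \<beta> (x - \<bar>r\<bar>)"
      by (cases "r \<ge> 0") auto
    also have "\<dots> = (LINT y|P. hat \<bar>r\<bar> (y - x)) - (LINT y|N. hat \<bar>r\<bar> (y - x))"
      using r by (rule second_difference)
    finally have "\<bar>\<beta> (x + r) + \<beta> (x - r) - 2 * \<beta> x\<bar> \<le> \<bar>LINT y|P. hat \<bar>r\<bar> (y - x)\<bar> + \<bar>LINT y|N. hat \<bar>r\<bar> (y - x)\<bar>"
      by (simp add: abs_triangle_ineq4)
    also have "\<dots> \<le> D"
      unfolding D_def using integrable_hat[OF r, of x] integrable_hat[OF h, of x] that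
      by (intro add_mono order.trans[OF integral_abs_bound] Bochner_Integration.integral_mono)
         (auto simp: hat_nonneg hat_mono)
    finally show ?thesis .
  qed
  have hb: "integrable lborel (\<lambda>y. hat h (y - x) * \<beta> y)"
    by (rule Bochner_Integration.integrable_bound[OF integrable_mult_right[OF integrable, of h]])
       (use h hat_le hat_nonneg in \<open>auto simp: abs_mult intro!: mult_right_mono\<close>)
  have i1: "integrable lborel (\<lambda>r. hat h r * \<beta> (x + r))" "(LINT r|lborel. hat h r * \<beta> (x + r)) = (LINT y|lborel. hat h (y - x) * \<beta> y)"
    using lborel_integrable_real_affine[OF hb, of 1 x] lborel_integral_real_affine[of 1 "\<lambda>y. hat h (y - x) * \<beta> y" x] by simp_all
  have i2: "integrable lborel (\<lambda>r. hat h r * \<beta> (x - r))" "(LINT r|lborel. hat h r * \<beta> (x - r)) = (LINT y|lborel. hat h (y - x) * \<beta> y)"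
    using lborel_integrable_real_affine[OF hb, of "-1" x] lborel_integral_real_affine[of "-1" "\<lambda>y. hat h (y - x) * \<beta> y" x] by simp_all
  have i3: "integrable lborel (hat h)" "(LINT r|lborel. hat h r) = h\<^sup>2"
    using has_bochner_integral_hat[OF h] by (auto simp: has_bochner_integral_iff)
  \<comment> \<open>Since the hat is even, both shifted terms integrate to the same weighted average
    of \<open>\<beta>\<close>; the last one gives 2 h^2 \<beta> x. Solving for \<beta> x yields the
    claim.\<close>
  let ?g = "\<lambda>r. hat h r * \<beta> (x + r) + hat h r * \<beta> (x - r) - hat h r * (2 * \<beta> x)"
  have ig: "integrable lborel ?g" "(LINT r|lborel. ?g r) = 2 * (LINT y|lborel. hat h (y - x) * \<beta> y) - h\<^sup>2 * (2 * \<beta> x)"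
    using i1 i2 i3 by simp_all
  have "\<bar>?g r\<bar> \<le> hat h r * D" for r
  proof (cases "\<bar>r\<bar> \<le> h")
    case True
    have "?g r = hat h r * (\<beta> (x + r) + \<beta> (x - r) - 2 * \<beta> x)"
      by (simp add: algebra_simps)
    then have "\<bar>?g r\<bar> = hat h r * \<bar>\<beta> (x + r) + \<beta> (x - r) - 2 * \<beta> x\<bar>"
      by (simp add: abs_mult hat_nonneg)
    then show ?thesis using diff[OF True] by (simp add: mult_left_mono hat_nonneg)
  qed (simp add: hat_eq_0)
  then have "\<bar>LINT r|lborel. ?g r\<bar> \<le> (LINT r|lborel. hat h r * D)"
    using ig i3 by (intro integral_abs_bound[THEN order.trans] integral_mono) auto
  then have "\<bar>2 * (LINT y|lborel. hat h (y - x) * \<beta> y) - h\<^sup>2 * (2 * \<beta> x)\<bar> \<le> h\<^sup>2 * D"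
    using ig i3 by simp
  moreover have "\<bar>LINT y|lborel. hat h (y - x) * \<beta> y\<bar> \<le> (LINT y|lborel. hat h (y - x) * \<bar>\<beta> y\<bar>)"
    using integral_abs_bound[of lborel "\<lambda>y. hat h (y - x) * \<beta> y"] by (simp add: abs_mult hat_nonneg)
  moreover have "h\<^sup>2 * \<bar>\<beta> x\<bar> = \<bar>h\<^sup>2 * \<beta> x\<bar>" by (simp add: abs_mult)
  ultimately show ?thesis unfolding D_def[symmetric] by (simp add: abs_le_iff)
qed

text \<open>Integrability alone does not control samples. \<open>weighted_abs_beta_le\<close> bounds
  each sample by an average of the modulus of \<open>\<beta>\<close> near the node plus the
  hat-weighted masses there. Summed over the grid, the hats add up to a constant, so the sums are
  controlled by the integral and by \<open>mass\<close>.\<close>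

lemma summable_beta_grid:
  assumes h: "h > 0"
  shows "(\<lambda>k::int. \<bar>\<beta> (of_int k * h)\<bar>) summable_on UNIV"
proof (rule summable_on_comparison_test)
  let ?b = "\<lambda>k::int. (LINT y|lborel. hat h (y - of_int k * h) * \<bar>\<beta> y\<bar>)
    + h\<^sup>2 / 2 * ((LINT y|P. hat h (y - of_int k * h)) * 1 + (LINT y|N. hat h (y - of_int k * h)) * 1)"
  have 1: "(\<lambda>k::int. LINT y|lborel. hat h (y - of_int k * h) * \<bar>\<beta> y\<bar>) summable_on UNIV"
  proof (rule has_sum_imp_summable, rule has_sum_integral[where G="\<lambda>y. h * \<bar>\<beta> y\<bar>"])
    fix A :: "int set" and y assume "finite A"
    then have "(\<Sum>k\<in>A. hat h (y - of_int k * h) * \<bar>\<beta> y\<bar>) \<le> h * grid_interpolation h (\<lambda>_. \<bar>\<beta> y\<bar>) y"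
      by (intro finite_sum_le_has_sum[OF has_sum_hat[OF h]]) (auto simp: hat_nonneg)
    then show "(\<Sum>k\<in>A. \<bar>hat h (y - of_int k * h) * \<bar>\<beta> y\<bar>\<bar>) \<le> h * \<bar>\<beta> y\<bar>"
      by (simp add: abs_mult hat_nonneg)
  next
    show "((\<lambda>k::int. hat h (y - of_int k * h) * \<bar>\<beta> y\<bar>) has_sum h * grid_interpolation h (\<lambda>_. \<bar>\<beta> y\<bar>) y) UNIV" for y
      by (rule has_sum_hat[OF h])
  qed (use integrable in auto)
  have 2: "(\<lambda>k::int. (LINT y|P. hat h (y - of_int k * h)) * 1) summable_on UNIV"
    using has_sum_integral_hat[OF P.finite_measure_axioms sets_P h, of "\<lambda>_. 1" 1] has_sum_imp_summable by auto
  have 3: "(\<lambda>k::int. (LINT y|N. hat h (y - of_int k * h)) * 1) summable_on UNIV"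
    using has_sum_integral_hat[OF N.finite_measure_axioms sets_N h, of "\<lambda>_. 1" 1] has_sum_imp_summable by auto
  show "(\<lambda>k. ?b k * (1 / h\<^sup>2)) summable_on UNIV"
    by (intro summable_on_cmult_left summable_on_add summable_on_cmult_right 1 2 3)
  show "\<bar>\<beta> (of_int k * h)\<bar> \<le> ?b k * (1 / h\<^sup>2)" for k
    using weighted_abs_beta_le[OF h, of "of_int k * h"] h by (simp add: field_simps)
qed simp

text \<open>Once the convolution is reindexed so that i sits in the argument of the kernel, the
  difference operators act on \<open>\<beta>\<close> alone. \<open>second_difference\<close> turns
  them into hats, and the hats sum to the interpolant. One factor h of the convolution and one of
  \<open>has_sum_hat\<close> cancel the 1/h^2.\<close>

lemma semidiscrete_rhs_eq:
  assumes h: "h > 0" and bound: "\<And>j. \<bar>f (v j)\<bar> \<le> B"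
  shows "semidiscrete_rhs \<beta> f h v i =
    (LINT y|P. grid_interpolation h (\<lambda>k. f (v (i - k))) y) - (LINT y|N. grid_interpolation h (\<lambda>k. f (v (i - k))) y)"
proof -
  define w where "w k = f (v (i - k))" for k
  have w: "\<bar>w k\<bar> \<le> B" for k using bound by (simp add: w_def)
  define c where "c = discrete_convol h (\<lambda>i. \<beta> (of_int i * h)) (\<lambda>j. f (v j))"
  have c: "((\<lambda>k. h * \<beta> (of_int (k + e) * h) * w k) has_sum c (i + e)) UNIV" for e
  proof -
    \<comment> \<open>Summability has to be established: an infinite sum that fails to converge
      would take the default value 0.\<close>
    have "(\<lambda>k. B * \<bar>\<beta> (of_int (k + e) * h)\<bar>) summable_on UNIV"
      using summable_on_reindex_bij_witness[of UNIV "\<lambda>k. k - e" "\<lambda>k. k + e" UNIV "\<lambda>k. \<bar>\<beta> (of_int k * h)\<bar>"]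
        summable_beta_grid[OF h] by (intro summable_on_cmult_right) auto
    then have "(\<lambda>k. norm (\<beta> (of_int (k + e) * h) * w k)) summable_on UNIV"
    proof (rule Infinite_Sum.abs_summable_on_comparison_test')
      show "norm (\<beta> (of_int (k + e) * h) * w k) \<le> B * \<bar>\<beta> (of_int (k + e) * h)\<bar>" for k
        unfolding real_norm_def abs_mult mult.commute[of B] by (intro mult_left_mono w abs_ge_zero)
    qed
    then have "(\<lambda>k. h * (\<beta> (of_int (k + e) * h) * w k)) summable_on UNIV"
      by (rule summable_on_cmult_right[OF abs_summable_summable])
    then have "((\<lambda>k. h * \<beta> (of_int (k + e) * h) * w k) has_sum (\<Sum>\<^sub>\<infinity>k. h * \<beta> (of_int (k + e) * h) * w k)) UNIV"
      by (simp add: mult.assoc)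
    moreover have "(\<Sum>\<^sub>\<infinity>k. h * \<beta> (of_int (k + e) * h) * w k) = c (i + e)"
      unfolding c_def discrete_convol_def w_def
      by (rule infsum_reindex_bij_witness[of UNIV "\<lambda>j. i - j" "\<lambda>k. i - k"]) (auto simp: algebra_simps)
    ultimately show ?thesis by simp
  qed
  let ?b = "\<lambda>k. h * \<beta> (of_int (k + 1) * h) * w k + ((-2) * (h * \<beta> (of_int (k + 0) * h) * w k)
        + h * \<beta> (of_int (k + (-1)) * h) * w k)"
  let ?m = "\<lambda>k. h * ((LINT y|P. hat h (y - of_int k * h)) * w k + (-1) * ((LINT y|N. hat h (y - of_int k * h)) * w k))"
  have s1: "(?b has_sum (c (i + 1) + ((-2) * c (i + 0) + c (i + (-1))))) UNIV"
    by (intro has_sum_add has_sum_cmult_right c)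
  have terms: "?b k
      = ?m k" for k
  proof -
    have "?b k
      = h * w k * (\<beta> (of_int k * h + h) - 2 * \<beta> (of_int k * h) + \<beta> (of_int k * h - h))"
      by (simp add: algebra_simps)
    also have "\<dots> = ?m k"
      unfolding second_difference[OF h] by (simp add: algebra_simps)
    finally show ?thesis .
  qed
  have s2: "(?m
      has_sum h * (h * (LINT y|P. grid_interpolation h w y) + (-1) * (h * (LINT y|N. grid_interpolation h w y)))) UNIV"
    by (intro has_sum_cmult_right has_sum_add has_sum_integral_hat[OF _ _ h w] P.finite_measure_axioms N.finite_measure_axioms sets_P sets_N)
  have eq: "c (i + 1) + ((-2) * c (i + 0) + c (i + (-1)))
     = h * (h * (LINT y|P. grid_interpolation h w y) + (-1) * (h * (LINT y|N. grid_interpolation h w y)))"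
    using infsumI[OF s1[unfolded terms]] infsumI[OF s2] by (rule trans[OF sym])
  have "semidiscrete_rhs \<beta> f h v i = (c (i + 1) + ((-2) * c (i + 0) + c (i + (-1)))) / h\<^sup>2"
    using h unfolding semidiscrete_rhs_def D_plus_def D_minus_def c_def[symmetric]
    by (simp add: field_simps power2_eq_square)
  also have "\<dots> = (LINT y|P. grid_interpolation h w y) - (LINT y|N. grid_interpolation h w y)"
    unfolding eq using h by (simp add: field_simps power2_eq_square)
  finally show ?thesis by (simp add: w_def[abs_def])
qed

lemma abs_integral_difference_le:
  assumes [measurable]: "F \<in> borel_measurable borel" "G \<in> borel_measurable borel"
    and B: "\<And>y. \<bar>F y\<bar> \<le> B" "\<And>y. \<bar>G y\<bar> \<le> B'" and D: "\<And>y. \<bar>F y - G y\<bar> \<le> D"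
  shows "\<bar>((LINT y|P. F y) - (LINT y|N. F y)) - ((LINT y|P. G y) - (LINT y|N. G y))\<bar> \<le> mass * D"
proof -
  have "\<bar>(LINT y|M. F y) - (LINT y|M. G y)\<bar> \<le> D * measure M (space M)"
    if M: "finite_measure M" and [measurable_cong]: "sets M = sets borel" for M
  proof -
    have "integrable M F" "integrable M G"
      using B by (auto intro!: abs_integral_le_measure(1)[OF M])
    then have "(LINT y|M. F y) - (LINT y|M. G y) = (LINT y|M. F y - G y)" by simp
    then show ?thesis using abs_integral_le_measure(2)[OF M _ D] by simp
  qed
  from this[OF P.finite_measure_axioms sets_P] this[OF N.finite_measure_axioms sets_N]
  show ?thesis by (simp add: mass_def abs_le_iff algebra_simps)
qed

text \<open>Interpolation does not increase the supremum, so the constant is \<open>mass\<close> for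
  every h. The bounds B and B' secure convergence and do not enter the estimate. Two different
  nonlinearities are allowed so that one of them may be zero.\<close>

lemma abs_semidiscrete_rhs_diff_le:
  assumes h: "h > 0" and B: "\<And>j. \<bar>f (v j)\<bar> \<le> B" "\<And>j. \<bar>g (w j)\<bar> \<le> B'" and D: "\<And>j. \<bar>f (v j) - g (w j)\<bar> \<le> D"
  shows "\<bar>semidiscrete_rhs \<beta> f h v i - semidiscrete_rhs \<beta> g h w i\<bar> \<le> mass * D"
  unfolding semidiscrete_rhs_eq[where f=f and v=v, OF h B(1)] semidiscrete_rhs_eq[where f=g and v=w, OF h B(2)]
  using borel_measurable_grid_interpolation[OF h] B D
  by (intro abs_integral_difference_le) (auto simp: grid_interpolation_diff intro!: abs_grid_interpolation_le)

lemma semidiscrete_rhs_consistency: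
  assumes h: "h > 0" and g: "\<And>x. (g has_real_derivative g' x) (at x)" "\<And>x. (g' has_real_derivative g'' x) (at x)"
    and B: "\<And>x. \<bar>g x\<bar> \<le> B" "\<And>x. \<bar>g'' x\<bar> \<le> B2" and v: "\<And>j. f (v j) = g (of_int j * h)"
  shows "\<bar>semidiscrete_rhs \<beta> f h v i - ((LINT y|P. g (of_int i * h - y)) - (LINT y|N. g (of_int i * h - y)))\<bar> \<le> mass * (B2 * h\<^sup>2)"
proof -
  \<comment> \<open>Reflection about the node i h turns the values at i - k into samples of one
    function at k h. The two sign changes leave the bound on the second derivative intact.\<close>
  define G where "G z = g (of_int i * h - z)" for z
  have 1: "(G has_real_derivative g' (of_int i * h - z) * (0 - 1)) (at z)" for z
    unfolding G_def by (rule DERIV_chain2[OF g(1)]) (intro derivative_intros)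
  have 2: "((\<lambda>z. g' (of_int i * h - z) * (0 - 1)) has_real_derivative g'' (of_int i * h - z) * (0 - 1) * (0 - 1)) (at z)" for z
    by (rule DERIV_cmult_right, rule DERIV_chain2[OF g(2)]) (intro derivative_intros)
  have "continuous_on UNIV g" using g(1) by (meson DERIV_isCont continuous_at_imp_continuous_on)
  then have [measurable]: "g \<in> borel_measurable borel" by (rule borel_measurable_continuous_onI)
  have w: "(\<lambda>k. f (v (i - k))) = (\<lambda>k. G (of_int k * h))" by (auto simp: v G_def algebra_simps)
  have eq: "semidiscrete_rhs \<beta> f h v i =
    (LINT y|P. grid_interpolation h (\<lambda>k. G (of_int k * h)) y) - (LINT y|N. grid_interpolation h (\<lambda>k. G (of_int k * h)) y)"
    unfolding w[symmetric] by (rule semidiscrete_rhs_eq[OF h, where B=B]) (simp add: v B)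
  show ?thesis unfolding eq G_def[symmetric]
  proof (rule abs_integral_difference_le)
    show "\<bar>grid_interpolation h (\<lambda>k. G (of_int k * h)) y - G y\<bar> \<le> B2 * h\<^sup>2" for y
      by (rule grid_interpolation_error[OF h 1 2]) (simp add: B(2))
  qed (use B(1) borel_measurable_grid_interpolation[OF h] in \<open>auto simp: G_def intro!: abs_grid_interpolation_le\<close>)
qed

end

section \<open>The second derivative of the continuous convolution\<close>

lemma integral_hat_shift:
  assumes "h > 0"
  shows "integrable lborel (\<lambda>y. hat h (y - a))" "(LINT y|lborel. hat h (y - a)) = h\<^sup>2"
  using has_bochner_integral_hat[OF assms] lborel_integrable_real_affine[of "hat h" 1 "-a"]
    lborel_integral_real_affine[of 1 "hat h" "-a"] by (auto simp: has_bochner_integral_iff)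

text \<open>The hat divided by \<epsilon>^2 is an approximate identity at a: on its support v
  differs from v a by at most L \<epsilon>.\<close>

lemma integral_hat_near:
  assumes \<epsilon>: "\<epsilon> > 0" and [measurable]: "v \<in> borel_measurable borel"
    and L: "\<And>x y. \<bar>v x - v y\<bar> \<le> L * \<bar>x - y\<bar>"
  shows "integrable lborel (\<lambda>y. hat \<epsilon> (y - a) * v y)"
    and "\<bar>(LINT y|lborel. hat \<epsilon> (y - a) * v y) - \<epsilon>\<^sup>2 * v a\<bar> \<le> L * \<epsilon> ^ 3"
proof -
  note ih = integral_hat_shift[OF \<epsilon>, of a]
  have L0: "0 \<le> L" using L[of 1 0] abs_ge_zero[of "v 1 - v 0"] by simp
  have bd: "\<bar>hat \<epsilon> (y - a) * (v y - v a)\<bar> \<le> hat \<epsilon> (y - a) * (L * \<epsilon>)" for y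
  proof (cases "\<bar>y - a\<bar> \<le> \<epsilon>")
    case True
    have "\<bar>v y - v a\<bar> \<le> L * \<epsilon>" using L[of y a] mult_left_mono[OF True L0] by linarith
    then show ?thesis by (simp add: abs_mult hat_nonneg mult_left_mono)
  qed (simp add: hat_eq_0)
  have i1: "integrable lborel (\<lambda>y. hat \<epsilon> (y - a) * (v y - v a))"
    by (rule Bochner_Integration.integrable_bound[OF integrable_mult_left[OF ih(1), of "L * \<epsilon>"]])
       (use bd in \<open>auto intro!: AE_I2 order.trans[OF _ abs_ge_self]\<close>)
  have i2: "integrable lborel (\<lambda>y. hat \<epsilon> (y - a) * (v y - v a) + hat \<epsilon> (y - a) * v a)"
    by (intro Bochner_Integration.integrable_add integrable_mult_left i1 ih)
  then show "integrable lborel (\<lambda>y. hat \<epsilon> (y - a) * v y)" by (simp add: algebra_simps)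
  have "(LINT y|lborel. hat \<epsilon> (y - a) * v y) = (LINT y|lborel. hat \<epsilon> (y - a) * (v y - v a) + hat \<epsilon> (y - a) * v a)"
    by (simp add: algebra_simps)
  also have "\<dots> = (LINT y|lborel. hat \<epsilon> (y - a) * (v y - v a)) + \<epsilon>\<^sup>2 * v a"
    using ih i1 by (subst Bochner_Integration.integral_add) auto
  finally have "\<bar>(LINT y|lborel. hat \<epsilon> (y - a) * v y) - \<epsilon>\<^sup>2 * v a\<bar> = \<bar>LINT y|lborel. hat \<epsilon> (y - a) * (v y - v a)\<bar>"
    by simp
  also have "\<dots> \<le> (LINT y|lborel. hat \<epsilon> (y - a) * (L * \<epsilon>))"
    using i1 ih bd by (intro order.trans[OF integral_abs_bound] Bochner_Integration.integral_mono) auto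
  also have "\<dots> = L * \<epsilon> ^ 3" using ih by (simp add: power2_eq_square power3_eq_cube)
  finally show "\<bar>(LINT y|lborel. hat \<epsilon> (y - a) * v y) - \<epsilon>\<^sup>2 * v a\<bar> \<le> L * \<epsilon> ^ 3" .
qed

lemma integral_hat_convolution:
  assumes M: "finite_measure M" and sM [measurable_cong]: "sets M = sets borel"
    and \<epsilon>: "\<epsilon> > 0" and [measurable]: "v \<in> borel_measurable borel"
    and B: "\<And>y. \<bar>v y\<bar> \<le> B" and L: "\<And>x y. \<bar>v x - v y\<bar> \<le> L * \<bar>x - y\<bar>"
  shows "integrable lborel (\<lambda>y. (LINT t|M. hat \<epsilon> (t - (x - y))) * v y)"
    and "\<bar>(LINT y|lborel. (LINT t|M. hat \<epsilon> (t - (x - y))) * v y) - \<epsilon>\<^sup>2 * (LINT t|M. v (x - t))\<bar>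
      \<le> L * \<epsilon> ^ 3 * measure M (space M)"
proof -
  interpret M: finite_measure M by fact
  interpret pair_sigma_finite M lborel ..
  \<comment> \<open>Since t - (x - y) = y - (x - t), the hat is centred at x - t as a function of y.
    After Fubini the inner integral over y is \<epsilon>^2 v (x - t) up to the error of
    \<open>integral_hat_near\<close>.\<close>
  let ?f = "\<lambda>t y. hat \<epsilon> (y - (x - t)) * v y"
  let ?I = "\<lambda>t. LINT y|lborel. ?f t y"
  have meas [measurable]: "case_prod ?f \<in> borel_measurable (M \<Otimes>\<^sub>M lborel)" by measurable
  have iv: "integrable lborel (?f t)" for t
    using integral_hat_near(1)[OF \<epsilon> _ L, of "x - t"] by simp
  have norm_le: "\<bar>LINT y|lborel. \<bar>?f t y\<bar>\<bar> \<le> \<epsilon>\<^sup>2 * B" for t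
  proof -
    note ih = integral_hat_shift[OF \<epsilon>, of "x - t"]
    have "\<bar>LINT y|lborel. \<bar>?f t y\<bar>\<bar> = (LINT y|lborel. \<bar>?f t y\<bar>)" by simp
    also have "\<dots> \<le> (LINT y|lborel. hat \<epsilon> (y - (x - t)) * B)"
      using ih B by (intro Bochner_Integration.integral_mono integrable_abs[OF iv]) (auto simp: abs_mult hat_nonneg mult_left_mono)
    finally show ?thesis using ih by simp
  qed
  have int: "integrable (M \<Otimes>\<^sub>M lborel) (case_prod ?f)"
  proof (rule Fubini_integrable)
    show "integrable M (\<lambda>t. LINT y|lborel. norm (case_prod ?f (t, y)))"
      using norm_le by (intro abs_integral_le_measure(1)[OF M, where D="\<epsilon>\<^sup>2 * B"]) auto
  qed (use iv in auto)
  have eq: "(LINT t|M. hat \<epsilon> (t - (x - y))) * v y = (LINT t|M. ?f t y)" for y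
    by (simp add: algebra_simps)
  show "integrable lborel (\<lambda>y. (LINT t|M. hat \<epsilon> (t - (x - y))) * v y)"
    unfolding eq using int by (rule integrable_snd)
  have F: "(LINT y|lborel. (LINT t|M. hat \<epsilon> (t - (x - y))) * v y) = (LINT t|M. ?I t)"
    unfolding eq using int by (rule Fubini_integral)
  have iI: "integrable M ?I" using integrable_fst[OF int] by simp
  have iV: "integrable M (\<lambda>t. v (x - t))"
    using B by (intro abs_integral_le_measure(1)[OF M, where D=B]) auto
  have "\<bar>LINT t|M. ?I t - \<epsilon>\<^sup>2 * v (x - t)\<bar> \<le> L * \<epsilon> ^ 3 * measure M (space M)"
    using iI iV integral_hat_near(2)[OF \<epsilon> _ L]
    by (intro abs_integral_le_measure(2)[OF M]) (auto intro!: borel_measurable_diff)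
  then show "\<bar>(LINT y|lborel. (LINT t|M. hat \<epsilon> (t - (x - y))) * v y) - \<epsilon>\<^sup>2 * (LINT t|M. v (x - t))\<bar>
      \<le> L * \<epsilon> ^ 3 * measure M (space M)"
    unfolding F using iI iV by simp
qed

text \<open>One use of l'Hopital's rule leaves the symmetric quotient of w, which is the mean of the
  right and left difference quotients at x. Thus w has to be differentiable at x alone.\<close>

lemma second_difference_tendsto:
  fixes W w :: "real \<Rightarrow> real"
  assumes W: "\<And>x. (W has_real_derivative w x) (at x)" and w: "(w has_real_derivative z) (at x)"
  shows "((\<lambda>\<epsilon>. (W (x + \<epsilon>) - 2 * W x + W (x - \<epsilon>)) / \<epsilon>\<^sup>2) \<longlongrightarrow> z) (at_right 0)"
proof (rule lhopital_right_0)
  have W': "((\<lambda>\<epsilon>. W (x + \<epsilon>)) has_real_derivative w (x + \<epsilon>)) (at \<epsilon>)"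
    "((\<lambda>\<epsilon>. W (x - \<epsilon>)) has_real_derivative - w (x - \<epsilon>)) (at \<epsilon>)" for \<epsilon>
  proof -
    have "((\<lambda>\<epsilon>. W (x + \<epsilon>)) has_real_derivative w (x + \<epsilon>) * (0 + 1)) (at \<epsilon>)"
      by (rule DERIV_chain2[OF W]) (intro derivative_intros)
    then show "((\<lambda>\<epsilon>. W (x + \<epsilon>)) has_real_derivative w (x + \<epsilon>)) (at \<epsilon>)" by simp
    have "((\<lambda>\<epsilon>. W (x - \<epsilon>)) has_real_derivative w (x - \<epsilon>) * (0 - 1)) (at \<epsilon>)"
      by (rule DERIV_chain2[OF W]) (intro derivative_intros)
    then show "((\<lambda>\<epsilon>. W (x - \<epsilon>)) has_real_derivative - w (x - \<epsilon>)) (at \<epsilon>)" by simp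
  qed
  let ?f = "\<lambda>\<epsilon>. W (x + \<epsilon>) - 2 * W x + W (x - \<epsilon>)"
  have f: "(?f has_real_derivative w (x + \<epsilon>) - w (x - \<epsilon>)) (at \<epsilon>)" for \<epsilon>
    by (auto intro!: derivative_eq_intros W')
  show "\<forall>\<^sub>F \<epsilon> in at_right 0. (?f has_real_derivative w (x + \<epsilon>) - w (x - \<epsilon>)) (at \<epsilon>)"
    using f by simp
  show "(?f \<longlongrightarrow> 0) (at_right 0)"
    using isContD[OF DERIV_isCont[OF f[of 0]]] by (simp add: filterlim_at_split)
  show "((\<lambda>\<epsilon>::real. \<epsilon>\<^sup>2) \<longlongrightarrow> 0) (at_right 0)" by real_asymp
  show "\<forall>\<^sub>F \<epsilon>::real in at_right 0. ((\<lambda>\<epsilon>. \<epsilon>\<^sup>2) has_real_derivative 2 * \<epsilon>) (at \<epsilon>)"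
    by (intro always_eventually allI) (auto intro!: derivative_eq_intros)
  show "\<forall>\<^sub>F \<epsilon>::real in at_right 0. \<epsilon>\<^sup>2 \<noteq> 0" "\<forall>\<^sub>F \<epsilon>::real in at_right 0. 2 * \<epsilon> \<noteq> 0"
    by (auto simp: eventually_at_filter)
  have "((\<lambda>\<epsilon>. (w (x + \<epsilon>) - w x) / \<epsilon>) \<longlongrightarrow> z) (at 0)"
    using w by (simp add: DERIV_def)
  then have r: "((\<lambda>\<epsilon>. (w (x + \<epsilon>) - w x) / \<epsilon>) \<longlongrightarrow> z) (at_right 0)"
    "((\<lambda>\<epsilon>. (w (x + \<epsilon>) - w x) / \<epsilon>) \<longlongrightarrow> z) (at_left 0)"
    by (auto simp: filterlim_at_split)
  then have "((\<lambda>\<epsilon>. (w (x + - \<epsilon>) - w x) / (- \<epsilon>)) \<longlongrightarrow> z) (at_right 0)"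
    unfolding filterlim_at_left_to_right by simp
  with r(1) have "((\<lambda>\<epsilon>. ((w (x + \<epsilon>) - w x) / \<epsilon> + (w (x + - \<epsilon>) - w x) / (- \<epsilon>)) / 2) \<longlongrightarrow> (z + z) / 2) (at_right 0)"
    by (intro tendsto_intros) auto
  moreover have "\<forall>\<^sub>F \<epsilon> in at_right 0. ((w (x + \<epsilon>) - w x) / \<epsilon> + (w (x + - \<epsilon>) - w x) / (- \<epsilon>)) / 2 = (w (x + \<epsilon>) - w (x - \<epsilon>)) / (2 * \<epsilon>)"
    by (auto simp: eventually_at_filter field_simps intro!: always_eventually)
  ultimately show "((\<lambda>\<epsilon>. (w (x + \<epsilon>) - w (x - \<epsilon>)) / (2 * \<epsilon>)) \<longlongrightarrow> z) (at_right 0)"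
    using Lim_transform_eventually by fastforce
qed

context second_derivative_kernel
begin

text \<open>The notion of solution already grants both derivatives, so only the value z has to be
  identified. It is the limit of second differences, which fall on \<open>\<beta>\<close> and become
  hats; replacing these by point masses costs O(\<epsilon>) because v is Lipschitz. Nothing is
  differentiated under the integral.\<close>

lemma convol_second_derivative:
  assumes B: "\<And>y. \<bar>v y\<bar> \<le> B" and L: "\<And>x y. \<bar>v x - v y\<bar> \<le> L * \<bar>x - y\<bar>"
    and W: "\<And>x. (convol \<beta> v has_real_derivative w x) (at x)" "(w has_real_derivative z) (at x)"
  shows "z = (LINT y|P. v (x - y)) - (LINT y|N. v (x - y))"
proof -
  have "0 \<le> L" using L[of 1 0] abs_ge_zero[of "v 1 - v 0"] by simp
  then have "L-lipschitz_on UNIV v" using L by (intro lipschitz_onI) (auto simp: dist_real_def)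
  then have [measurable]: "v \<in> borel_measurable borel"
    by (intro borel_measurable_continuous_onI lipschitz_on_continuous_on)
  define V where "V = (LINT y|P. v (x - y)) - (LINT y|N. v (x - y))"
  have int: "integrable lborel (\<lambda>y. \<beta> (a - y) * v y)" for a
  proof (rule Bochner_Integration.integrable_bound)
    show "integrable lborel (\<lambda>y. \<beta> (a - y) * B)"
      using lborel_integrable_real_affine[OF integrable, of "-1" a] by (intro integrable_mult_left) auto
    show "AE y in lborel. norm (\<beta> (a - y) * v y) \<le> norm (\<beta> (a - y) * B)"
      by (intro AE_I2) (simp add: abs_mult mult_left_mono order.trans[OF B abs_ge_self])
  qed simp
  let ?c = "\<lambda>\<epsilon>. convol \<beta> v (x + \<epsilon>) - 2 * convol \<beta> v x + convol \<beta> v (x - \<epsilon>)"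
  have bound: "\<bar>?c \<epsilon> / \<epsilon>\<^sup>2 - V\<bar> \<le> L * \<epsilon> * mass"
    if \<epsilon>: "\<epsilon> > 0" for \<epsilon>
  proof -
    let ?J = "\<lambda>M y. (LINT t|M. hat \<epsilon> (t - (x - y))) * v y"
    have J: "integrable lborel (?J P)" "integrable lborel (?J N)"
      "\<bar>(LINT y|lborel. ?J P y) - \<epsilon>\<^sup>2 * (LINT t|P. v (x - t))\<bar> \<le> L * \<epsilon> ^ 3 * measure P (space P)"
      "\<bar>(LINT y|lborel. ?J N y) - \<epsilon>\<^sup>2 * (LINT t|N. v (x - t))\<bar> \<le> L * \<epsilon> ^ 3 * measure N (space N)"
      using P.finite_measure_axioms N.finite_measure_axioms \<epsilon> B L by (auto intro!: integral_hat_convolution)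
    have "?c \<epsilon>
        = (LINT y|lborel. \<beta> (x + \<epsilon> - y) * v y - 2 * (\<beta> (x - y) * v y) + \<beta> (x - \<epsilon> - y) * v y)"
      using int unfolding convol_def by simp
    also have "\<dots> = (LINT y|lborel. ?J P y - ?J N y)"
    proof (intro Bochner_Integration.integral_cong refl)
      fix y
      have "\<beta> (x + \<epsilon> - y) * v y - 2 * (\<beta> (x - y) * v y) + \<beta> (x - \<epsilon> - y) * v y
          = (\<beta> ((x - y) + \<epsilon>) - 2 * \<beta> (x - y) + \<beta> ((x - y) - \<epsilon>)) * v y"
        by (simp add: algebra_simps)
      also have "\<dots> = ?J P y - ?J N y"
        unfolding second_difference[OF \<epsilon>] by (simp add: left_diff_distrib)
      finally show "\<beta> (x + \<epsilon> - y) * v y - 2 * (\<beta> (x - y) * v y) + \<beta> (x - \<epsilon> - y) * v y = ?J P y - ?J N y" .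
    qed
    also have "\<dots> = (LINT y|lborel. ?J P y) - (LINT y|lborel. ?J N y)" using J by simp
    finally have "\<bar>?c \<epsilon> - \<epsilon>\<^sup>2 * V\<bar> \<le> L * \<epsilon> ^ 3 * mass"
      using J(3,4) unfolding V_def mass_def by (simp add: abs_le_iff algebra_simps)
    then have "\<bar>?c \<epsilon> - \<epsilon>\<^sup>2 * V\<bar> / \<epsilon>\<^sup>2 \<le> L * \<epsilon> ^ 3 * mass / \<epsilon>\<^sup>2"
      by (intro divide_right_mono) auto
    moreover have "\<bar>C / \<epsilon>\<^sup>2 - V\<bar> = \<bar>C - \<epsilon>\<^sup>2 * V\<bar> / \<epsilon>\<^sup>2" for C
    proof -
      have "C / \<epsilon>\<^sup>2 - V = (C - \<epsilon>\<^sup>2 * V) / \<epsilon>\<^sup>2" using \<epsilon> by (simp add: diff_divide_distrib)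
      then show ?thesis by (simp only: abs_divide) simp
    qed
    moreover have "L * \<epsilon> ^ 3 * mass / \<epsilon>\<^sup>2 = L * \<epsilon> * mass"
      using \<epsilon> by (simp add: power2_eq_square power3_eq_cube)
    ultimately show ?thesis by (simp only:)
  qed
  have "((\<lambda>\<epsilon>. L * \<epsilon> * mass) \<longlongrightarrow> L * 0 * mass) (at_right 0)" by (intro tendsto_intros)
  then have lim: "((\<lambda>\<epsilon>. L * \<epsilon> * mass) \<longlongrightarrow> 0) (at_right 0)" by simp
  have "((\<lambda>\<epsilon>. ?c \<epsilon> / \<epsilon>\<^sup>2 - V) \<longlongrightarrow> 0) (at_right 0)"
    by (rule Lim_null_comparison[OF _ lim]) (simp add: eventually_at_filter bound)
  then have "((\<lambda>\<epsilon>. ?c \<epsilon> / \<epsilon>\<^sup>2) \<longlongrightarrow> V) (at_right 0)"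
    by (simp add: LIM_zero_iff)
  then have "z = V"
    by (rule tendsto_unique[OF trivial_limit_at_right_real second_difference_tendsto[OF W]])
  then show ?thesis by (simp add: V_def)
qed

end

section \<open>Fourier inversion and Sobolev embedding\<close>

lemma deriv_funpow_in_class:
  assumes "\<And>g. g \<in> S \<Longrightarrow> \<exists>g'\<in>S. \<forall>x. (g has_real_derivative g' x) (at x)" and "f \<in> S"
  shows "(deriv ^^ n) f \<in> S"
proof (induction n)
  case (Suc n)
  then obtain g' where g': "g' \<in> S" "\<forall>x. ((deriv ^^ n) f has_real_derivative g' x) (at x)"
    using assms(1) by blast
  then have "deriv ((deriv ^^ n) f) = g'" by (auto intro!: DERIV_imp_deriv)
  then show ?case using g' by simp
qed (use assms in simp)

lemma power_div_fact_le_exp: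
  fixes t :: real
  assumes "0 \<le> t"
  shows "t ^ n / fact n \<le> exp t"
proof -
  have "(\<lambda>k. t ^ k /\<^sub>R fact k) sums exp t" by (rule exp_converges)
  then have "(\<Sum>k\<in>{n}. t ^ k /\<^sub>R fact k) \<le> exp t"
    unfolding sums_iff using assms sum_le_suminf[of "\<lambda>k. t ^ k /\<^sub>R fact k" "{n}"] by auto
  then show ?thesis by (simp add: divide_inverse mult.commute)
qed

text \<open>Combines (c x^2)^n \<le> n! exp(c x^2) with the bound 1 + x^(2n) for the modulus of x^n,
  which avoids a case distinction on the parity of n.\<close>

lemma abs_power_times_gaussian_le:
  fixes c x :: real
  assumes c: "0 < c"
  shows "\<bar>x ^ n * exp (- (c * x\<^sup>2))\<bar> \<le> 1 + fact n / c ^ n"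
proof -
  have "(c * x\<^sup>2) ^ n \<le> fact n * exp (c * x\<^sup>2)"
    using power_div_fact_le_exp[of "c * x\<^sup>2" n] c by (simp add: divide_le_eq mult.commute)
  then have "(x\<^sup>2) ^ n * exp (- (c * x\<^sup>2)) \<le> fact n / c ^ n"
    using c by (simp add: power_mult_distrib exp_minus field_simps)
  moreover have "\<bar>x ^ n\<bar> \<le> 1 + (x\<^sup>2) ^ n"
  proof -
    have "0 \<le> (\<bar>x ^ n\<bar> - 1)\<^sup>2" by simp
    then have "2 * \<bar>x ^ n\<bar> \<le> 1 + \<bar>x ^ n\<bar>\<^sup>2" by (simp add: power2_diff)
    moreover have "\<bar>x ^ n\<bar>\<^sup>2 = (x\<^sup>2) ^ n" by (simp add: power_mult[symmetric] mult.commute)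
    ultimately show ?thesis using abs_ge_zero[of "x ^ n"] by linarith
  qed
  then have "\<bar>x ^ n\<bar> * exp (- (c * x\<^sup>2)) \<le> (1 + (x\<^sup>2) ^ n) * exp (- (c * x\<^sup>2))"
    by (intro mult_right_mono) auto
  moreover have "exp (- (c * x\<^sup>2)) \<le> 1" using c by simp
  ultimately show ?thesis unfolding abs_mult distrib_right abs_exp_cancel mult_1_left by linarith
qed

lemma bounded_poly_times_gaussian:
  assumes c: "0 < c"
  shows "\<exists>C. \<forall>x::real. \<bar>poly p x * exp (- (c * x\<^sup>2))\<bar> \<le> C"
proof (intro exI allI)
  fix x :: real
  have "poly p x * exp (- (c * x\<^sup>2)) = (\<Sum>i\<le>degree p. coeff p i * (x ^ i * exp (- (c * x\<^sup>2))))"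
    by (simp add: poly_altdef sum_distrib_right mult.assoc)
  also have "\<bar>\<dots>\<bar> \<le> (\<Sum>i\<le>degree p. \<bar>coeff p i * (x ^ i * exp (- (c * x\<^sup>2)))\<bar>)"
    by (rule sum_abs)
  also have "\<dots> \<le> (\<Sum>i\<le>degree p. \<bar>coeff p i\<bar> * (1 + fact i / c ^ i))"
    by (intro sum_mono, subst abs_mult) (intro mult_left_mono abs_power_times_gaussian_le[OF c] abs_ge_zero)
  finally show "\<bar>poly p x * exp (- (c * x\<^sup>2))\<bar> \<le> (\<Sum>i\<le>degree p. \<bar>coeff p i\<bar> * (1 + fact i / c ^ i))" .
qed

text \<open>\<open>is_fourier_transform\<close> tests against real functions, so a Gaussian times
  cis (a x) enters through its real and imaginary parts. Polynomial coefficients make the class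
  closed under differentiation and under multiplication by powers of x.\<close>

lemma schwartz_modulated_gaussian:
  assumes c: "0 < c"
  shows "schwartz (\<lambda>x. (poly p x * cos (a * x) + poly q x * sin (a * x)) * exp (- (c * x\<^sup>2)))"
proof -
  define g where "g p q = (\<lambda>x. (poly p x * cos (a * x) + poly q x * sin (a * x)) * exp (- (c * x\<^sup>2)))" for p q
  define S where "S = {g p q |p q. True}"
  have closed: "\<exists>f'\<in>S. \<forall>x. (f has_real_derivative f' x) (at x)" if f: "f \<in> S" for f
  proof -
    obtain p q where f: "f = g p q" using f by (auto simp: S_def)
    have "(f has_real_derivative g (pderiv p + smult a q + [:0, - 2 * c:] * p) (pderiv q - smult a p + [:0, - 2 * c:] * q) x) (at x)" for x
      unfolding f g_def
      by (auto intro!: derivative_eq_intros simp: algebra_simps)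
    then show ?thesis unfolding S_def by blast
  qed
  have mem: "g p q \<in> S" by (auto simp: S_def)
  have "smooth (g p q)" using closed mem by (rule smooth_class)
  then have "C_k k (g p q)" for k by (rule smooth_imp_C_k)
  moreover have "bounded (range (\<lambda>x. x ^ m * (deriv ^^ n) (g p q) x))" for m n
  proof -
    have "(deriv ^^ n) (g p q) \<in> S" using closed mem by (rule deriv_funpow_in_class)
    then obtain p' q' where d: "(deriv ^^ n) (g p q) = g p' q'" by (auto simp: S_def)
    obtain C1 where C1: "\<forall>x. \<bar>poly (monom 1 m * p') x * exp (- (c * x\<^sup>2))\<bar> \<le> C1" using bounded_poly_times_gaussian[OF c] by blast
    obtain C2 where C2: "\<forall>x. \<bar>poly (monom 1 m * q') x * exp (- (c * x\<^sup>2))\<bar> \<le> C2" using bounded_poly_times_gaussian[OF c] by blast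
    have "\<bar>x ^ m * g p' q' x\<bar> \<le> C1 + C2" for x
    proof -
      have "x ^ m * g p' q' x = (poly (monom 1 m * p') x * exp (- (c * x\<^sup>2))) * cos (a * x) + (poly (monom 1 m * q') x * exp (- (c * x\<^sup>2))) * sin (a * x)"
        by (simp add: g_def poly_monom algebra_simps)
      also have "\<bar>\<dots>\<bar> \<le> \<bar>poly (monom 1 m * p') x * exp (- (c * x\<^sup>2))\<bar> * \<bar>cos (a * x)\<bar> + \<bar>poly (monom 1 m * q') x * exp (- (c * x\<^sup>2))\<bar> * \<bar>sin (a * x)\<bar>"
        by (rule order.trans[OF abs_triangle_ineq]) (simp add: abs_mult)
      also have "\<dots> \<le> C1 * 1 + C2 * 1"
        using C1 C2 by (intro add_mono mult_mono) (auto intro: order.trans[OF abs_ge_zero])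
      finally show ?thesis by simp
    qed
    then show ?thesis unfolding d bounded_iff by auto
  qed
  ultimately show ?thesis unfolding schwartz_def g_def by blast
qed

lemma schwartz_gaussian_cos: "0 < c \<Longrightarrow> schwartz (\<lambda>x. cos (a * x) * exp (- (c * x\<^sup>2)))"
  using schwartz_modulated_gaussian[of c 1 a 0] by simp

lemma schwartz_gaussian_sin: "0 < c \<Longrightarrow> schwartz (\<lambda>x. sin (a * x) * exp (- (c * x\<^sup>2)))"
  using schwartz_modulated_gaussian[of c 0 a 1] by simp

section \<open>Decay of the Fourier transform of a Schwartz function\<close>

lemma has_bochner_integral_inverse_1_plus_square:
  "has_bochner_integral lborel (\<lambda>x::real. 1 / (1 + x\<^sup>2)) pi"
  using integrable_inverse_1_plus_square LBINT_inverse_1_plus_square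
  by (simp add: has_bochner_integral_iff set_integrable_def interval_lebesgue_integral_def
    set_lebesgue_integral_def einterval_eq_UNIV inverse_eq_divide)

lemma borel_measurable_cis [measurable (raw)]:
  "f \<in> borel_measurable M \<Longrightarrow> (\<lambda>x. cis (f x)) \<in> borel_measurable M"
  unfolding cis_conv_exp by measurable

lemma schwartz_decay:
  assumes "schwartz \<theta>"
  shows "\<exists>C. \<forall>x. \<bar>(deriv ^^ n) \<theta> x\<bar> \<le> C / (1 + x\<^sup>2)"
proof -
  have "bounded (range (\<lambda>x. x ^ 0 * (deriv ^^ n) \<theta> x))" "bounded (range (\<lambda>x. x ^ 2 * (deriv ^^ n) \<theta> x))"
    using assms unfolding schwartz_def by blast+
  then obtain A B where "\<And>x. \<bar>(deriv ^^ n) \<theta> x\<bar> \<le> A" and "\<And>x. \<bar>x\<^sup>2 * (deriv ^^ n) \<theta> x\<bar> \<le> B"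
    by (auto simp: bounded_iff)
  then have "(1 + x\<^sup>2) * \<bar>(deriv ^^ n) \<theta> x\<bar> \<le> A + B" for x
    using add_mono by (fastforce simp: distrib_right abs_mult)
  then have "\<bar>(deriv ^^ n) \<theta> x\<bar> \<le> (A + B) / (1 + x\<^sup>2)" for x
    by (simp add: pos_le_divide_eq add_pos_nonneg mult.commute)
  then show ?thesis by blast
qed

lemma schwartz_has_deriv:
  assumes "schwartz \<theta>"
  shows "((deriv ^^ n) \<theta> has_real_derivative (deriv ^^ Suc n) \<theta> x) (at x)"
proof -
  have "C_k (Suc n) \<theta>" using assms by (simp add: schwartz_def)
  then have "(deriv ^^ n) \<theta> field_differentiable (at x)" by (auto simp: C_k_def)
  then show ?thesis by (simp add: DERIV_deriv_iff_field_differentiable)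
qed

lemma schwartz_continuous: "schwartz \<theta> \<Longrightarrow> continuous_on UNIV ((deriv ^^ n) \<theta>)"
  by (auto simp: schwartz_def C_k_def)

lemma schwartz_integrable:
  assumes "schwartz \<theta>"
  shows "integrable lborel ((deriv ^^ n) \<theta>)"
proof -
  obtain C where C: "\<And>x. \<bar>(deriv ^^ n) \<theta> x\<bar> \<le> C / (1 + x\<^sup>2)" using schwartz_decay[OF assms] by blast
  have "integrable lborel (\<lambda>x::real. C * (1 / (1 + x\<^sup>2)))"
    using has_bochner_integral_inverse_1_plus_square by (intro integrable_mult_right) (auto simp: has_bochner_integral_iff)
  then show ?thesis
    by (rule Bochner_Integration.integrable_bound)
       (use schwartz_continuous[OF assms] in \<open>auto intro!: borel_measurable_continuous_onI AE_I2
         simp only: real_norm_def mult_1_right times_divide_eq_right order.trans[OF C abs_ge_self] measurable_lborel2\<close>)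
qed

lemma schwartz_tendsto_0:
  assumes "schwartz \<theta>"
  shows "((deriv ^^ n) \<theta> \<longlongrightarrow> 0) at_top" "((deriv ^^ n) \<theta> \<longlongrightarrow> 0) at_bot"
proof -
  obtain C where C: "\<And>x. \<bar>(deriv ^^ n) \<theta> x\<bar> \<le> C / (1 + x\<^sup>2)" using schwartz_decay[OF assms] by blast
  have "((\<lambda>x. C / (1 + x\<^sup>2)) \<longlongrightarrow> 0) at_top" "((\<lambda>x. C / (1 + x\<^sup>2)) \<longlongrightarrow> 0) at_bot"
    by real_asymp+
  then show "((deriv ^^ n) \<theta> \<longlongrightarrow> 0) at_top" "((deriv ^^ n) \<theta> \<longlongrightarrow> 0) at_bot"
    using C by (auto intro!: Lim_null_comparison[where g="\<lambda>x. C / (1 + x\<^sup>2)"] always_eventually)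
qed

lemma fourier_altdef: "fourier \<theta> y = (LINT \<xi>|lborel. cis (- (y * \<xi>)) * of_real (\<theta> \<xi>))"
  by (simp add: fourier_def mult.commute)

lemma borel_measurable_fourier:
  assumes [measurable]: "\<theta> \<in> borel_measurable borel"
  shows "fourier \<theta> \<in> borel_measurable borel"
  unfolding fourier_def by measurable

text \<open>The derivative of \<open>cis (- x \<xi>) (\<theta>' + \<i> x \<theta>)\<close> in \<open>\<xi>\<close> is \<open>cis (- x \<xi>) (\<theta>'' + x\<^sup>2 \<theta>)\<close>, which performs both
  integrations by parts at once.\<close>

lemma fourier_second_derivative:
  assumes \<theta>: "schwartz \<theta>"
  shows "x\<^sup>2 * fourier \<theta> x = - fourier ((deriv ^^ 2) \<theta>) x"
proof -
  define F where "F \<xi> = cis (- (x * \<xi>)) * (of_real (deriv \<theta> \<xi>) + \<i> * of_real (x * \<theta> \<xi>))" for \<xi>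
  define f where "f \<xi> = cis (- (x * \<xi>)) * of_real ((deriv ^^ 2) \<theta> \<xi>) + of_real (x\<^sup>2) * (cis (- (x * \<xi>)) * of_real (\<theta> \<xi>))" for \<xi>
  have d0: "(\<theta> has_real_derivative deriv \<theta> y) (at y)" for y using schwartz_has_deriv[OF \<theta>, of 0] by simp
  have d1: "(deriv \<theta> has_real_derivative (deriv ^^ 2) \<theta> y) (at y)" for y
    using schwartz_has_deriv[OF \<theta>, of 1] by (simp add: numeral_2_eq_2)
  have F: "(F has_vector_derivative f \<xi>) (at \<xi>)" for \<xi>
  proof -
    have 1: "((\<lambda>\<xi>. cis (- (x * \<xi>))) has_vector_derivative - x *\<^sub>R (\<i> * cis (- (x * \<xi>)))) (at \<xi>)"
      by (auto intro!: derivative_eq_intros simp: has_vector_derivative_def fun_eq_iff)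
    have 2: "((\<lambda>\<xi>. of_real (deriv \<theta> \<xi>) + \<i> * of_real (x * \<theta> \<xi>)) has_vector_derivative
       (of_real ((deriv ^^ 2) \<theta> \<xi>) + \<i> * of_real (x * deriv \<theta> \<xi>))) (at \<xi>)"
      by (intro has_vector_derivative_add has_vector_derivative_of_real has_vector_derivative_mult_right DERIV_cmult d0 d1)
    show ?thesis
      using has_vector_derivative_mult[OF 1 2] unfolding F_def f_def
      by (simp add: scaleR_conv_of_real algebra_simps power2_eq_square)
  qed
  have int1: "integrable lborel (\<lambda>\<xi>. cis (- (x * \<xi>)) * of_real ((deriv ^^ n) \<theta> \<xi>))" for n
  proof (rule Bochner_Integration.integrable_bound[OF schwartz_integrable[OF \<theta>, of n]])
    have [measurable]: "(deriv ^^ n) \<theta> \<in> borel_measurable borel"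
      using schwartz_continuous[OF \<theta>] by (rule borel_measurable_continuous_onI)
    show "(\<lambda>\<xi>. cis (- (x * \<xi>)) * of_real ((deriv ^^ n) \<theta> \<xi>)) \<in> borel_measurable lborel" by measurable
  qed (simp add: norm_mult)
  have int: "integrable lborel f"
    unfolding f_def using int1[of 2] int1[of 0] by (intro Bochner_Integration.integrable_add integrable_mult_right) auto
  have bdF: "norm (F \<xi>) \<le> \<bar>deriv \<theta> \<xi>\<bar> + \<bar>x\<bar> * \<bar>\<theta> \<xi>\<bar>" for \<xi>
    unfolding F_def by (simp add: norm_mult) (rule order.trans[OF norm_triangle_ineq], simp add: norm_mult abs_mult)
  have "((\<lambda>\<xi>. \<bar>deriv \<theta> \<xi>\<bar> + \<bar>x\<bar> * \<bar>\<theta> \<xi>\<bar>) \<longlongrightarrow> 0) G"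
    if "(deriv \<theta> \<longlongrightarrow> 0) G" "(\<theta> \<longlongrightarrow> 0) G" for G
    using tendsto_add[OF tendsto_rabs[OF that(1)] tendsto_mult[OF tendsto_const[of "\<bar>x\<bar>"] tendsto_rabs[OF that(2)]]]
    by simp
  then have "(F \<longlongrightarrow> 0) G" if "(deriv \<theta> \<longlongrightarrow> 0) G" "(\<theta> \<longlongrightarrow> 0) G" for G
    using that by (intro Lim_null_comparison[OF always_eventually[OF allI[OF bdF]]])
  then have "(F \<longlongrightarrow> 0) at_top" "(F \<longlongrightarrow> 0) at_bot"
    using schwartz_tendsto_0[OF \<theta>, of 0] schwartz_tendsto_0[OF \<theta>, of 1] by simp_all
  then have lim: "((F \<circ> real_of_ereal) \<longlongrightarrow> 0) (at_left \<infinity>)" "((F \<circ> real_of_ereal) \<longlongrightarrow> 0) (at_right (-\<infinity>))"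
    by (simp_all add: ereal_tendsto_simps)
  have cont: "isCont f \<xi>" for \<xi>
  proof -
    have "isCont ((deriv ^^ 2) \<theta>) \<xi>" "isCont \<theta> \<xi>"
      using schwartz_continuous[OF \<theta>, of 2] schwartz_continuous[OF \<theta>, of 0]
      by (simp_all add: continuous_on_eq_continuous_at)
    then show ?thesis unfolding f_def cis_conv_exp by (intro continuous_intros) auto
  qed
  have "(LBINT \<xi>=-\<infinity>..\<infinity>. f \<xi>) = 0 - 0"
    by (rule interval_integral_FTC_integrable[where F=F])
       (use F cont int lim in \<open>auto simp: set_integrable_def einterval_eq_UNIV\<close>)
  then have "(LINT \<xi>|lborel. f \<xi>) = 0"
    by (simp add: interval_lebesgue_integral_def set_lebesgue_integral_def einterval_eq_UNIV)
  moreover have "(LINT \<xi>|lborel. f \<xi>) = fourier ((deriv ^^ 2) \<theta>) x + of_real (x\<^sup>2) * fourier \<theta> x"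
    unfolding f_def fourier_altdef using int1[of 2] int1[of 0]
    by (subst Bochner_Integration.integral_add) (auto intro!: integrable_mult_right)
  ultimately show ?thesis by (simp add: eq_neg_iff_add_eq_0 add.commute)
qed

text \<open>A transform is bounded by the L1 norm, and multiplying it by x^2 amounts to passing to
  the second derivative. Decay like 1/(1 + x^2) is what makes the pairing with a square-integrable
  function converge.\<close>

lemma fourier_decay:
  assumes \<theta>: "schwartz \<theta>"
  shows "\<exists>C. \<forall>x. cmod (fourier \<theta> x) \<le> C / (1 + x\<^sup>2)"
proof -
  define I where "I n = (LINT \<xi>|lborel. \<bar>(deriv ^^ n) \<theta> \<xi>\<bar>)" for n
  have le: "cmod (fourier ((deriv ^^ n) \<theta>) x) \<le> I n" for n x
    unfolding fourier_def I_def
    by (rule order.trans[OF integral_norm_bound]) (simp add: norm_mult)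
  have "(1 + x\<^sup>2) * cmod (fourier \<theta> x) \<le> I 0 + I 2" for x
  proof -
    have "x\<^sup>2 * cmod (fourier \<theta> x) = cmod (x\<^sup>2 * fourier \<theta> x)"
      by (simp add: norm_mult norm_power)
    also have "\<dots> = cmod (fourier ((deriv ^^ 2) \<theta>) x)"
      by (simp add: fourier_second_derivative[OF \<theta>])
    finally show ?thesis using le[of 0 x] le[of 2 x] by (simp add: distrib_right)
  qed
  then have "cmod (fourier \<theta> x) \<le> (I 0 + I 2) / (1 + x\<^sup>2)" for x
    by (simp add: pos_le_divide_eq add_pos_nonneg mult.commute)
  then show ?thesis by blast
qed

text \<open>For b = 1/(1 + (x - a)^2) \<le> 1, AM-GM bounds b times the modulus of v by v^2 + b^2
  \<le> v^2 + b, in place of Cauchy-Schwarz. The centre a is 0 for pairings with transforms and the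
  evaluation point for Gaussian tails.\<close>

lemma integrable_div_1_plus_square:
  fixes v :: "real \<Rightarrow> real"
  assumes [measurable]: "v \<in> borel_measurable borel" and v2: "integrable lborel (\<lambda>x. (v x)\<^sup>2)"
  shows "integrable lborel (\<lambda>x. \<bar>v x\<bar> / (1 + (x - a)\<^sup>2))"
    and "(LINT x|lborel. \<bar>v x\<bar> / (1 + (x - a)\<^sup>2)) \<le> (LINT x|lborel. (v x)\<^sup>2) + pi"
proof -
  have "has_bochner_integral lborel (\<lambda>x. 1 / (1 + (x - a)\<^sup>2)) pi"
    using lborel_has_bochner_integral_real_affine_iff[of 1 "\<lambda>x. 1 / (1 + x\<^sup>2)" pi "-a"]
      has_bochner_integral_inverse_1_plus_square by simp
  then have q: "integrable lborel (\<lambda>x. 1 / (1 + (x - a)\<^sup>2))" "(LINT x|lborel. 1 / (1 + (x - a)\<^sup>2)) = pi"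
    by (auto simp: has_bochner_integral_iff)
  have bd: "\<bar>v x\<bar> / (1 + (x - a)\<^sup>2) \<le> (v x)\<^sup>2 + 1 / (1 + (x - a)\<^sup>2)" for x
  proof -
    define b where "b = 1 / (1 + (x - a)\<^sup>2)"
    have b: "0 \<le> b" "b \<le> 1" by (auto simp: b_def divide_le_eq add_pos_nonneg)
    have "0 \<le> (\<bar>v x\<bar> - b)\<^sup>2" by simp
    then have "2 * (\<bar>v x\<bar> * b) \<le> (v x)\<^sup>2 + b\<^sup>2" by (simp add: power2_diff)
    moreover have "b\<^sup>2 \<le> b" using b by (simp add: power2_eq_square mult_left_le)
    moreover have "0 \<le> \<bar>v x\<bar> * b" using b by simp
    ultimately have "\<bar>v x\<bar> * b \<le> (v x)\<^sup>2 + b" by linarith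
    then show ?thesis by (simp add: b_def)
  qed
  have sum: "integrable lborel (\<lambda>x. (v x)\<^sup>2 + 1 / (1 + (x - a)\<^sup>2))" using v2 q by simp
  show i: "integrable lborel (\<lambda>x. \<bar>v x\<bar> / (1 + (x - a)\<^sup>2))"
    by (rule Bochner_Integration.integrable_bound[OF sum])
       (auto intro!: AE_I2 simp: bd)
  have "(LINT x|lborel. \<bar>v x\<bar> / (1 + (x - a)\<^sup>2)) \<le> (LINT x|lborel. (v x)\<^sup>2 + 1 / (1 + (x - a)\<^sup>2))"
    using i sum bd by (rule Bochner_Integration.integral_mono)
  then show "(LINT x|lborel. \<bar>v x\<bar> / (1 + (x - a)\<^sup>2)) \<le> (LINT x|lborel. (v x)\<^sup>2) + pi"
    using v2 q by simp
qed

lemma integrable_mult_fourier: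
  assumes v [measurable]: "v \<in> borel_measurable borel" and v2: "integrable lborel (\<lambda>x. (v x)\<^sup>2)" and \<theta>: "schwartz \<theta>"
  shows "integrable lborel (\<lambda>x. of_real (v x) * fourier \<theta> x)"
proof -
  obtain C where C: "\<And>x. cmod (fourier \<theta> x) \<le> C / (1 + x\<^sup>2)" using fourier_decay[OF \<theta>] by blast
  have [measurable]: "fourier \<theta> \<in> borel_measurable borel"
    using schwartz_continuous[OF \<theta>, of 0] by (intro borel_measurable_fourier borel_measurable_continuous_onI) simp
  show ?thesis
  proof (rule Bochner_Integration.integrable_bound)
    show "integrable lborel (\<lambda>x. C * (\<bar>v x\<bar> / (1 + (x - 0)\<^sup>2)))"
      by (intro integrable_mult_right integrable_div_1_plus_square v v2)
    show "AE x in lborel. norm (of_real (v x) * fourier \<theta> x) \<le> norm (C * (\<bar>v x\<bar> / (1 + (x - 0)\<^sup>2)))"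
    proof (rule AE_I2)
      fix x
      have "norm (of_real (v x) * fourier \<theta> x) = \<bar>v x\<bar> * cmod (fourier \<theta> x)" by (simp add: norm_mult)
      also have "\<dots> \<le> \<bar>v x\<bar> * (C / (1 + x\<^sup>2))" by (intro mult_left_mono C) simp
      also have "\<dots> = C * (\<bar>v x\<bar> / (1 + (x - 0)\<^sup>2))" by simp
      finally show "norm (of_real (v x) * fourier \<theta> x) \<le> norm (C * (\<bar>v x\<bar> / (1 + (x - 0)\<^sup>2)))"
        using abs_ge_self order.trans real_norm_def by metis
    qed
  qed measurable
qed

section \<open>Fourier inversion by Gaussian summation\<close>

lemma integral_cis_gaussian:
  assumes m: "m > 0"
  shows "(LINT \<xi>|lborel. cis (a * \<xi>) * of_real (exp (- (\<xi>\<^sup>2 / (2 * m\<^sup>2))))) = of_real (2 * pi * (m * std_normal_density (m * a)))"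
proof -
  \<comment> \<open>The characteristic function of the standard normal law at m a becomes the wanted
    integral under \<xi> = m x.\<close>
  have "char std_normal_distribution (m * a) = of_real (exp (- ((m * a)\<^sup>2) / 2))"
    by (simp add: char_std_normal_distribution)
  moreover have "char std_normal_distribution (m * a) = (LINT x|lborel. std_normal_density x *\<^sub>R cis (m * a * x))"
    unfolding char_def by (subst integral_density) (auto simp: cis_conv_exp)
  moreover have "std_normal_density x *\<^sub>R cis (m * a * x) = of_real (1 / sqrt (2 * pi)) * (cis (a * (0 + m * x)) * of_real (exp (- ((0 + m * x)\<^sup>2 / (2 * m\<^sup>2)))))" for x
    using m by (simp add: std_normal_density_def scaleR_conv_of_real power_mult_distrib ac_simps)
  ultimately have 1: "of_real (1 / sqrt (2 * pi)) * (LINT x|lborel. cis (a * (0 + m * x)) * of_real (exp (- ((0 + m * x)\<^sup>2 / (2 * m\<^sup>2))))) = complex_of_real (exp (- ((m * a)\<^sup>2) / 2))"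
    by (simp only: integral_mult_right_zero)
  define I where "I = (LINT x|lborel. cis (a * (0 + m * x)) * complex_of_real (exp (- ((0 + m * x)\<^sup>2 / (2 * m\<^sup>2)))))"
  have "(LINT \<xi>|lborel. cis (a * \<xi>) * of_real (exp (- (\<xi>\<^sup>2 / (2 * m\<^sup>2))))) = \<bar>m\<bar> *\<^sub>R I"
    unfolding I_def by (rule lborel_integral_real_affine) (use m in simp)
  also have "I = of_real (sqrt (2 * pi) * exp (- ((m * a)\<^sup>2) / 2))"
    using 1 unfolding I_def[symmetric] of_real_mult by (simp add: field_simps)
  also have "\<bar>m\<bar> *\<^sub>R complex_of_real (sqrt (2 * pi) * exp (- ((m * a)\<^sup>2) / 2)) = of_real (2 * pi * (m * std_normal_density (m * a)))"
  proof -
    have "2 * pi = sqrt (2 * pi) * sqrt (2 * pi)" by simp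
    then have eq: "2 * pi * (m * std_normal_density (m * a)) = m * (sqrt (2 * pi) * exp (- ((m * a)\<^sup>2) / 2))"
      unfolding std_normal_density_def by (simp add: field_simps)
    show ?thesis unfolding eq using m by (simp add: scaleR_conv_of_real)
  qed
  finally show ?thesis .
qed

text \<open>No global bound on v is at hand, so dominated convergence works only near x.
  \<open>v1\<close> is v cut off to [x - 1, x + 1]; the remainder \<open>v2'\<close> is controlled
  by playing the Gaussian tail against the weight 1/(1 + (y - x)^2).\<close>

lemma gaussian_mollification_tendsto:
  fixes v :: "real \<Rightarrow> real"
  assumes cont: "continuous_on UNIV v" and v2: "integrable lborel (\<lambda>x. (v x)\<^sup>2)"
  shows "(\<lambda>n. LINT y|lborel. v y * (real (Suc n) * std_normal_density (real (Suc n) * (x - y)))) \<longlonglongrightarrow> v x"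
proof -
  have [measurable]: "v \<in> borel_measurable borel" using cont by (rule borel_measurable_continuous_onI)
  let ?K = "\<lambda>n y. real (Suc n) * std_normal_density (real (Suc n) * (x - y))"
  define v1 where "v1 y = v y * indicator {x - 1..x + 1} y" for y
  define v2' where "v2' y = v y * (1 - indicator {x - 1..x + 1} y)" for y
  have [measurable]: "v1 \<in> borel_measurable borel" "v2' \<in> borel_measurable borel"
    unfolding v1_def[abs_def] v2'_def[abs_def] by measurable
  have "compact (v ` {x - 1..x + 1})"
    by (intro compact_continuous_image continuous_on_subset[OF cont]) auto
  then obtain B where B: "\<And>y. y \<in> {x - 1..x + 1} \<Longrightarrow> \<bar>v y\<bar> \<le> B"
    by (force dest!: compact_imp_bounded simp: bounded_iff)
  have B1: "\<bar>v1 y\<bar> \<le> \<bar>B\<bar>" for y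
    using B[of y] by (auto simp: v1_def indicator_def)
  have \<phi>: "integrable lborel std_normal_density" "(LINT z|lborel. std_normal_density z) = 1"
    using integral_normal_density[of 1 0] by (auto intro: integrable_normal_density)
  let ?s = "\<lambda>n z. v1 (x + z / real (Suc n)) * std_normal_density z"
  have int_s: "integrable lborel (?s n)" for n
    by (rule Bochner_Integration.integrable_bound[where f="\<lambda>z. \<bar>B\<bar> * std_normal_density z"])
       (use \<phi> B1 in \<open>auto simp: abs_mult intro!: AE_I2 mult_right_mono\<close>)
  have sub: "v1 (x + (1 / real (Suc n)) * z) * ?K n (x + (1 / real (Suc n)) * z) = real (Suc n) * ?s n z" for n z
    by (simp add: normal_density_def)
  have i1: "integrable lborel (\<lambda>y. v1 y * ?K n y)" for n
    using int_s[of n]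
    by (subst lborel_integrable_real_affine_iff[symmetric, of "1 / real (Suc n)" _ x], simp, unfold sub)
       (intro integrable_mult_right)
  have e1: "(LINT y|lborel. v1 y * ?K n y) = (LINT z|lborel. ?s n z)" for n
    by (subst lborel_integral_real_affine[of "1 / real (Suc n)" _ x], simp, unfold sub) simp
  have l1: "(\<lambda>n. LINT z|lborel. ?s n z) \<longlonglongrightarrow> (LINT z|lborel. v x * std_normal_density z)"
  proof (rule integral_dominated_convergence[where w="\<lambda>z. \<bar>B\<bar> * std_normal_density z"])
    show "AE z in lborel. (\<lambda>n. ?s n z) \<longlonglongrightarrow> v x * std_normal_density z"
    proof (rule AE_I2)
      fix z
      have lim: "(\<lambda>n. x + z / real (Suc n)) \<longlonglongrightarrow> x" by real_asymp
      then have ev: "\<forall>\<^sub>F n in sequentially. x + z / real (Suc n) \<in> {x - 1<..<x + 1}"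
        by (rule topological_tendstoD) auto
      have "isCont v x" using cont by (simp add: continuous_on_eq_continuous_at)
      then have "(\<lambda>n. v (x + z / real (Suc n))) \<longlonglongrightarrow> v x"
        using lim by (rule isCont_tendsto_compose)
      moreover have "\<forall>\<^sub>F n in sequentially. v (x + z / real (Suc n)) = v1 (x + z / real (Suc n))"
        using ev by eventually_elim (auto simp: v1_def)
      ultimately have "(\<lambda>n. v1 (x + z / real (Suc n))) \<longlonglongrightarrow> v x"
        by (rule Lim_transform_eventually)
      then show "(\<lambda>n. ?s n z) \<longlonglongrightarrow> v x * std_normal_density z" by (intro tendsto_intros)
    qed
    show "AE z in lborel. norm (?s n z) \<le> \<bar>B\<bar> * std_normal_density z" for n
      using B1 by (auto simp: abs_mult intro!: AE_I2 mult_right_mono)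
  qed (use \<phi> in auto)
  define J where "J = (LINT y|lborel. (v y)\<^sup>2) + pi"
  \<comment> \<open>From exp(-t) \<le> 1/t at t = m^2 r / 2 comes 2/(m^2 r), and r \<ge> 1 gives 1 +
    r \<le> 2 r, hence 4/(m^2 (1 + r)). The factor m of the kernel leaves 4/m.\<close>
  have tail: "\<bar>v2' y * ?K n y\<bar> \<le> 4 / real (Suc n) * (\<bar>v y\<bar> / (1 + (y - x)\<^sup>2))" for n y
  proof (cases "y \<in> {x - 1..x + 1}")
    case False
    define m where "m = real (Suc n)"
    define r where "r = (x - y)\<^sup>2"
    have m: "m > 0" by (simp add: m_def)
    have "1 < \<bar>x - y\<bar>" using False by auto
    then have r: "1 \<le> r" unfolding r_def by (metis abs_1 abs_le_square_iff less_imp_le one_power2)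
    have "exp (- (m\<^sup>2 * r / 2)) \<le> 1 / (m\<^sup>2 * r / 2)"
      using exp_ge_add_one_self[of "m\<^sup>2 * r / 2"] m r by (simp add: exp_minus field_simps)
    also have "\<dots> \<le> 4 / (m\<^sup>2 * (1 + r))"
    proof -
      have "m\<^sup>2 * (1 + r) \<le> m\<^sup>2 * (2 * r)" using r by (intro mult_left_mono) auto
      then have "4 / (m\<^sup>2 * (2 * r)) \<le> 4 / (m\<^sup>2 * (1 + r))"
        using m r by (intro divide_left_mono) auto
      then show ?thesis by (simp add: mult.commute)
    qed
    finally have e: "exp (- (m\<^sup>2 * r / 2)) \<le> 4 / (m\<^sup>2 * (1 + r))" .
    have "1 \<le> sqrt (2 * pi)" using pi_ge_two by (simp add: real_le_rsqrt)
    then have "std_normal_density (m * (x - y)) \<le> exp (- (m\<^sup>2 * r / 2))"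
      unfolding std_normal_density_def r_def by (simp add: power_mult_distrib divide_le_eq mult_left_le)
    then have "m * std_normal_density (m * (x - y)) \<le> m * (4 / (m\<^sup>2 * (1 + r)))"
      using e m by (intro mult_left_mono) auto
    also have "\<dots> = 4 / m * (1 / (1 + r))" using m by (simp add: power2_eq_square)
    finally have "\<bar>v y\<bar> * (m * std_normal_density (m * (x - y))) \<le> \<bar>v y\<bar> * (4 / m * (1 / (1 + r)))"
      by (intro mult_left_mono) auto
    moreover have "v2' y = v y" using False by (simp add: v2'_def)
    moreover have "r = (y - x)\<^sup>2" by (simp add: r_def power2_commute)
    ultimately show ?thesis unfolding m_def[symmetric] using m by (simp add: abs_mult mult.commute)
  qed (simp add: v2'_def)
  have q: "integrable lborel (\<lambda>y. 4 / real (Suc n) * (\<bar>v y\<bar> / (1 + (y - x)\<^sup>2)))" for n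
    by (intro integrable_mult_right integrable_div_1_plus_square v2) auto
  have i2: "integrable lborel (\<lambda>y. v2' y * ?K n y)" for n
  proof (rule Bochner_Integration.integrable_bound[OF q[of n]])
    show "AE y in lborel. norm (v2' y * ?K n y) \<le> norm (4 / real (Suc n) * (\<bar>v y\<bar> / (1 + (y - x)\<^sup>2)))"
      unfolding real_norm_def by (intro AE_I2 order.trans[OF tail abs_ge_self])
  qed measurable
  have le: "\<bar>LINT y|lborel. v2' y * ?K n y\<bar> \<le> 4 / real (Suc n) * J" for n
  proof -
    have "\<bar>LINT y|lborel. v2' y * ?K n y\<bar> \<le> (LINT y|lborel. 4 / real (Suc n) * (\<bar>v y\<bar> / (1 + (y - x)\<^sup>2)))"
      by (intro order.trans[OF integral_abs_bound] Bochner_Integration.integral_mono integrable_abs i2 q tail)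
    also have "\<dots> = 4 / real (Suc n) * (LINT y|lborel. \<bar>v y\<bar> / (1 + (y - x)\<^sup>2))" by (rule integral_mult_right_zero)
    also have "\<dots> \<le> 4 / real (Suc n) * J"
      unfolding J_def by (intro mult_left_mono integrable_div_1_plus_square v2) auto
    finally show ?thesis .
  qed
  have lim0: "(\<lambda>n. 4 / real (Suc n) * J) \<longlonglongrightarrow> 0" by real_asymp
  have l2: "(\<lambda>n. LINT y|lborel. v2' y * ?K n y) \<longlonglongrightarrow> 0"
    by (rule Lim_null_comparison[OF always_eventually lim0], intro allI, unfold real_norm_def, rule le)
  have "(LINT y|lborel. v y * ?K n y) = (LINT z|lborel. ?s n z) + (LINT y|lborel. v2' y * ?K n y)" for n
  proof -
    have "(LINT y|lborel. v y * ?K n y) = (LINT y|lborel. v1 y * ?K n y + v2' y * ?K n y)"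
      by (simp add: v1_def v2'_def algebra_simps)
    then show ?thesis using i1 i2 e1 by simp
  qed
  then show ?thesis using tendsto_add[OF l1 l2] \<phi> by simp
qed

text \<open>The tempered identity is tested with cis (x \<xi>) times wider and wider Gaussians. One
  side tends to the inversion integral, dominated by the modulus of w; the other is a Gaussian
  mollification of v at x. \<open>fourier\<close> carries no prefactor, hence the 2 pi.\<close>

lemma fourier_inversion:
  assumes cont: "continuous_on UNIV v" and v2: "integrable lborel (\<lambda>x. (v x)\<^sup>2)"
    and ft: "is_fourier_transform v w" and w: "integrable lborel w"
  shows "(LINT \<xi>|lborel. w \<xi> * cis (x * \<xi>)) = of_real (2 * pi * v x)"
proof -
  have [measurable]: "v \<in> borel_measurable borel" using cont by (rule borel_measurable_continuous_onI)
  have [measurable]: "w \<in> borel_measurable borel" using w by auto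
  let ?K = "\<lambda>n y. real (Suc n) * std_normal_density (real (Suc n) * (x - y))"
  let ?g = "\<lambda>n \<xi>. exp (- (1 / (2 * (real (Suc n))\<^sup>2) * \<xi>\<^sup>2))"
  have eq: "(LINT \<xi>|lborel. w \<xi> * (cis (x * \<xi>) * of_real (?g n \<xi>)))
      = of_real (2 * pi * (LINT y|lborel. v y * ?K n y))" for n
  proof -
    \<comment> \<open>Chosen so that \<open>integral_cis_gaussian\<close> with m = Suc n yields 2 pi
      times the kernel \<open>?K n\<close>.\<close>
    define c where "c = 1 / (2 * (real (Suc n))\<^sup>2)"
    have c: "c > 0" by (simp add: c_def)
    define \<theta> where "\<theta> = (\<lambda>\<xi>. cos (x * \<xi>) * exp (- (c * \<xi>\<^sup>2)))"
    define \<eta> where "\<eta> = (\<lambda>\<xi>. sin (x * \<xi>) * exp (- (c * \<xi>\<^sup>2)))"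
    have sch: "schwartz \<theta>" "schwartz \<eta>"
      unfolding \<theta>_def \<eta>_def using c by (rule schwartz_gaussian_cos schwartz_gaussian_sin)+
    have cis: "of_real (\<theta> \<xi>) + \<i> * of_real (\<eta> \<xi>) = cis (x * \<xi>) * of_real (exp (- (c * \<xi>\<^sup>2)))" for \<xi>
      by (simp add: \<theta>_def \<eta>_def complex_eq_iff)
    have ft1: "integrable lborel (\<lambda>\<xi>. w \<xi> * of_real (\<theta> \<xi>))" "(LINT \<xi>|lborel. w \<xi> * of_real (\<theta> \<xi>)) = (LINT x|lborel. of_real (v x) * fourier \<theta> x)"
      and ft2: "integrable lborel (\<lambda>\<xi>. w \<xi> * of_real (\<eta> \<xi>))" "(LINT \<xi>|lborel. w \<xi> * of_real (\<eta> \<xi>)) = (LINT x|lborel. of_real (v x) * fourier \<eta> x)"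
      using ft sch unfolding is_fourier_transform_def by blast+
    have int\<theta>: "integrable lborel (\<lambda>\<xi>. cis (- (y * \<xi>)) * of_real (\<theta> \<xi>))" "integrable lborel (\<lambda>\<xi>. cis (- (y * \<xi>)) * of_real (\<eta> \<xi>))" for y
    proof -
      have "integrable lborel \<theta>" "integrable lborel \<eta>"
        using schwartz_integrable[OF sch(1), of 0] schwartz_integrable[OF sch(2), of 0] by auto
      then have "integrable lborel (\<lambda>\<xi>. norm (cis (- (y * \<xi>)) * of_real (\<theta> \<xi>)))" "integrable lborel (\<lambda>\<xi>. norm (cis (- (y * \<xi>)) * of_real (\<eta> \<xi>)))"
        and [measurable]: "\<theta> \<in> borel_measurable borel" "\<eta> \<in> borel_measurable borel"
        by (auto simp: norm_mult)
      then show "integrable lborel (\<lambda>\<xi>. cis (- (y * \<xi>)) * of_real (\<theta> \<xi>))" "integrable lborel (\<lambda>\<xi>. cis (- (y * \<xi>)) * of_real (\<eta> \<xi>))"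
        by (auto intro!: integrable_norm_cancel)
    qed
    have F: "fourier \<theta> y + \<i> * fourier \<eta> y = of_real (2 * pi * ?K n y)" for y
    proof -
      have "fourier \<theta> y + \<i> * fourier \<eta> y = (LINT \<xi>|lborel. cis (- (y * \<xi>)) * of_real (\<theta> \<xi>) + \<i> * (cis (- (y * \<xi>)) * of_real (\<eta> \<xi>)))"
        unfolding fourier_altdef using int\<theta>[of y] by simp
      also have "\<dots> = (LINT \<xi>|lborel. cis ((x - y) * \<xi>) * of_real (exp (- (\<xi>\<^sup>2 / (2 * (real (Suc n))\<^sup>2)))))"
      proof (intro Bochner_Integration.integral_cong refl)
        fix \<xi>
        have "cis (- (y * \<xi>)) * of_real (\<theta> \<xi>) + \<i> * (cis (- (y * \<xi>)) * of_real (\<eta> \<xi>)) = cis (- (y * \<xi>)) * (of_real (\<theta> \<xi>) + \<i> * of_real (\<eta> \<xi>))"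
          by (simp add: algebra_simps)
        also have "\<dots> = cis ((x - y) * \<xi>) * of_real (exp (- (c * \<xi>\<^sup>2)))"
          unfolding cis by (simp add: mult.assoc[symmetric] cis_mult algebra_simps)
        finally show "cis (- (y * \<xi>)) * of_real (\<theta> \<xi>) + \<i> * (cis (- (y * \<xi>)) * of_real (\<eta> \<xi>))
           = cis ((x - y) * \<xi>) * of_real (exp (- (\<xi>\<^sup>2 / (2 * (real (Suc n))\<^sup>2))))" by (simp add: c_def)
      qed
      also have "\<dots> = of_real (2 * pi * ?K n y)"
        by (rule integral_cis_gaussian) simp
      finally show ?thesis .
    qed
    have "(LINT \<xi>|lborel. w \<xi> * (cis (x * \<xi>) * of_real (?g n \<xi>))) = (LINT \<xi>|lborel. w \<xi> * of_real (\<theta> \<xi>) + \<i> * (w \<xi> * of_real (\<eta> \<xi>)))"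
      unfolding c_def[symmetric] cis[symmetric] by (simp add: algebra_simps)
    also have "\<dots> = (LINT \<xi>|lborel. w \<xi> * of_real (\<theta> \<xi>)) + \<i> * (LINT \<xi>|lborel. w \<xi> * of_real (\<eta> \<xi>))"
      using ft1 ft2 by simp
    also have "\<dots> = (LINT y|lborel. of_real (v y) * fourier \<theta> y + \<i> * (of_real (v y) * fourier \<eta> y))"
      unfolding ft1 ft2 using integrable_mult_fourier[OF _ v2 sch(1)] integrable_mult_fourier[OF _ v2 sch(2)] by simp
    also have "\<dots> = (LINT y|lborel. complex_of_real (2 * pi * (v y * ?K n y)))"
    proof (intro Bochner_Integration.integral_cong refl)
      fix y
      have "of_real (v y) * fourier \<theta> y + \<i> * (of_real (v y) * fourier \<eta> y) = of_real (v y) * (fourier \<theta> y + \<i> * fourier \<eta> y)"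
        by (simp add: algebra_simps)
      then show "of_real (v y) * fourier \<theta> y + \<i> * (of_real (v y) * fourier \<eta> y) = complex_of_real (2 * pi * (v y * ?K n y))"
        unfolding F by simp
    qed
    also have "\<dots> = of_real (2 * pi * (LINT y|lborel. v y * ?K n y))"
      by (simp only: integral_complex_of_real integral_mult_right_zero)
    finally show ?thesis .
  qed
  have "(\<lambda>n. LINT \<xi>|lborel. w \<xi> * (cis (x * \<xi>) * of_real (?g n \<xi>))) \<longlonglongrightarrow> (LINT \<xi>|lborel. w \<xi> * cis (x * \<xi>))"
  proof (rule integral_dominated_convergence[where w="\<lambda>\<xi>. norm (w \<xi>)"])
    show "AE \<xi> in lborel. (\<lambda>n. w \<xi> * (cis (x * \<xi>) * of_real (?g n \<xi>))) \<longlonglongrightarrow> w \<xi> * cis (x * \<xi>)"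
    proof (rule AE_I2)
      fix \<xi>
      have "(\<lambda>n. ?g n \<xi>) \<longlonglongrightarrow> 1" by real_asymp
      then have "(\<lambda>n. w \<xi> * (cis (x * \<xi>) * of_real (?g n \<xi>))) \<longlonglongrightarrow> w \<xi> * (cis (x * \<xi>) * of_real 1)"
        by (intro tendsto_intros)
      then show "(\<lambda>n. w \<xi> * (cis (x * \<xi>) * of_real (?g n \<xi>))) \<longlonglongrightarrow> w \<xi> * cis (x * \<xi>)" by simp
    qed
    show "AE \<xi> in lborel. norm (w \<xi> * (cis (x * \<xi>) * of_real (?g n \<xi>))) \<le> norm (w \<xi>)" for n
      by (intro AE_I2) (simp add: norm_mult mult_left_le)
  qed (use w in auto)
  moreover have "(\<lambda>n. LINT \<xi>|lborel. w \<xi> * (cis (x * \<xi>) * of_real (?g n \<xi>))) \<longlonglongrightarrow> of_real (2 * pi * v x)"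
    unfolding eq by (intro tendsto_intros gaussian_mollification_tendsto cont v2)
  ultimately show ?thesis by (rule LIMSEQ_unique)
qed

section \<open>Embedding into functions with two bounded derivatives\<close>

lemma norm_cis_taylor_le: "cmod (cis y - 1 - \<i> * of_real y) \<le> y\<^sup>2 / 2"
proof -
  have "(\<Sum>k\<le>1. (\<i> * complex_of_real y) ^ k / fact k) = 1 + \<i> * of_real y" by simp
  then have "cmod (cis y - (1 + \<i> * of_real y)) \<le> \<bar>y\<bar> ^ Suc 1 / fact (Suc 1)"
    using iexp_approx1[of y 1] by (simp only: cis_conv_exp)
  then show ?thesis by (simp add: diff_diff_eq power2_eq_square)
qed

text \<open>The quadratic Taylor bound for \<open>cis\<close> makes the remainder at most h^2 times
  the weighted integral, so differentiability follows from an explicit estimate.\<close>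

lemma has_vector_derivative_fourier_integral:
  assumes [measurable]: "g \<in> borel_measurable borel"
    and int: "integrable lborel (\<lambda>\<xi>. (1 + \<xi>\<^sup>2) * cmod (g \<xi>))"
  shows "((\<lambda>x. LINT \<xi>|lborel. g \<xi> * cis (x * \<xi>)) has_vector_derivative
      (LINT \<xi>|lborel. (\<i> * of_real \<xi> * g \<xi>) * cis (x * \<xi>))) (at x)"
proof -
  define F where "F x = (LINT \<xi>|lborel. g \<xi> * cis (x * \<xi>))" for x
  define D where "D = (LINT \<xi>|lborel. (\<i> * of_real \<xi> * g \<xi>) * cis (x * \<xi>))"
  define C where "C = (LINT \<xi>|lborel. (1 + \<xi>\<^sup>2) * cmod (g \<xi>))"
  have abs_le: "\<bar>\<xi>\<bar> \<le> 1 + \<xi>\<^sup>2" for \<xi> :: real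
    using zero_le_power2[of "\<bar>\<xi>\<bar> - 1"] by (simp add: power2_diff)
  have i0: "integrable lborel (\<lambda>\<xi>. g \<xi> * cis (x * \<xi>))" for x
    by (rule Bochner_Integration.integrable_bound[OF int]) (auto simp: norm_mult distrib_right)
  have i1: "integrable lborel (\<lambda>\<xi>. (\<i> * of_real \<xi> * g \<xi>) * cis (x * \<xi>))"
    by (rule Bochner_Integration.integrable_bound[OF int])
       (auto simp: norm_mult abs_mult intro!: mult_right_mono abs_le)
  have bound: "norm (F (x + h) - F x - h *\<^sub>R D) \<le> C * h\<^sup>2" for h
  proof -
    let ?r = "\<lambda>\<xi>. g \<xi> * cis ((x + h) * \<xi>) - g \<xi> * cis (x * \<xi>) - h *\<^sub>R ((\<i> * of_real \<xi> * g \<xi>) * cis (x * \<xi>))"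
    have ir: "integrable lborel ?r" using i0 i1 by simp
    have "F (x + h) - F x - h *\<^sub>R D = (LINT \<xi>|lborel. ?r \<xi>)"
      unfolding F_def D_def using i0 i1 by simp
    moreover have "norm (LINT \<xi>|lborel. ?r \<xi>) \<le> (LINT \<xi>|lborel. h\<^sup>2 * ((1 + \<xi>\<^sup>2) * cmod (g \<xi>)))"
    proof (rule order.trans[OF integral_norm_bound], rule Bochner_Integration.integral_mono)
      fix \<xi>
      have "?r \<xi> = g \<xi> * cis (x * \<xi>) * (cis (h * \<xi>) - 1 - \<i> * of_real (h * \<xi>))"
        by (simp add: algebra_simps cis_mult scaleR_conv_of_real)
      then have "norm (?r \<xi>) = cmod (g \<xi>) * cmod (cis (h * \<xi>) - 1 - \<i> * of_real (h * \<xi>))"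
        by (simp only: norm_mult norm_cis mult_1_right)
      also have "\<dots> \<le> cmod (g \<xi>) * ((h * \<xi>)\<^sup>2 / 2)"
        by (intro mult_left_mono norm_cis_taylor_le) simp
      also have "\<dots> \<le> cmod (g \<xi>) * (h\<^sup>2 * (1 + \<xi>\<^sup>2))"
        by (intro mult_left_mono) (auto simp: power_mult_distrib algebra_simps)
      finally show "norm (?r \<xi>) \<le> h\<^sup>2 * ((1 + \<xi>\<^sup>2) * cmod (g \<xi>))" by (simp add: mult_ac)
    qed (use ir int in auto)
    ultimately show ?thesis by (simp add: C_def mult.commute)
  qed
  have "((\<lambda>h. norm (F (x + h) - F x - h *\<^sub>R D) / norm h) \<longlongrightarrow> 0) (at 0)"
  proof (rule Lim_null_comparison)
    have "((\<lambda>h. C * \<bar>h\<bar>) \<longlongrightarrow> C * \<bar>0\<bar>) (at 0)" by (intro tendsto_intros)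
    then show "((\<lambda>h. C * \<bar>h\<bar>) \<longlongrightarrow> 0) (at 0)" by simp
    show "\<forall>\<^sub>F h in at 0. norm (norm (F (x + h) - F x - h *\<^sub>R D) / norm h) \<le> C * \<bar>h\<bar>"
    proof -
      have "norm (F (x + h) - F x - h *\<^sub>R D) \<le> C * \<bar>h\<bar> * \<bar>h\<bar>" for h
        using bound[of h] by (simp add: power2_eq_square mult.assoc)
      then show ?thesis by (simp add: eventually_at_filter divide_le_eq)
    qed
  qed
  then show ?thesis
    unfolding F_def[symmetric] D_def[symmetric] has_vector_derivative_def has_derivative_at
    by (simp add: bounded_linear_scaleR_left)
qed

text \<open>The factor 1 + \<xi>^2 permits differentiating a Fourier integral, and 1 +
  \<bar>\<xi>\<bar> permits doing so again for the first derivative. Squaring the weight costs three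
  powers of 1 + \<xi>^2, and a fourth pays for the integrable function 1/(1 + \<xi>^2); hence s
  \<ge> 4.\<close>

lemma weighted_L1_le_sobolev:
  fixes w :: "real \<Rightarrow> complex"
  assumes [measurable]: "w \<in> borel_measurable borel" and s: "4 \<le> s"
    and int: "integrable lborel (\<lambda>\<xi>. (1 + \<xi>\<^sup>2) powr s * (cmod (w \<xi>))\<^sup>2)"
  defines "n \<equiv> sqrt (LINT \<xi>|lborel. (1 + \<xi>\<^sup>2) powr s * (cmod (w \<xi>))\<^sup>2)"
  shows "integrable lborel (\<lambda>\<xi>. (1 + \<xi>\<^sup>2) * (1 + \<bar>\<xi>\<bar>) * cmod (w \<xi>))"
    and "(LINT \<xi>|lborel. (1 + \<xi>\<^sup>2) * (1 + \<bar>\<xi>\<bar>) * cmod (w \<xi>)) \<le> (1 / 2 + pi) * n"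
proof -
  let ?a2 = "\<lambda>\<xi>. (1 + \<xi>\<^sup>2) powr s * (cmod (w \<xi>))\<^sup>2"
  let ?W = "\<lambda>\<xi>. (1 + \<xi>\<^sup>2) * (1 + \<bar>\<xi>\<bar>) * cmod (w \<xi>)"
  let ?I = "LINT \<xi>|lborel. (1 + \<xi>\<^sup>2) * (1 + \<bar>\<xi>\<bar>) * cmod (w \<xi>)"
  have n: "n\<^sup>2 = (LINT \<xi>|lborel. ?a2 \<xi>)" "0 \<le> n"
    unfolding n_def by (auto intro!: Bochner_Integration.integral_nonneg)
  have q: "integrable lborel (\<lambda>x::real. 1 / (1 + x\<^sup>2))" "(LINT x|lborel. 1 / (1 + x\<^sup>2)) = pi"
    using has_bochner_integral_inverse_1_plus_square by (auto simp: has_bochner_integral_iff)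
  text \<open>AM-GM: \<open>2 a b \<le> a\<^sup>2 / l + l b\<^sup>2\<close> with \<open>b\<^sup>2 \<le> 2 / (1 + \<xi>\<^sup>2)\<close>.\<close>
  have am_gm: "?W \<xi> \<le> 1 / (2 * l) * ?a2 \<xi> + l * (1 / (1 + \<xi>\<^sup>2))" if l: "l > 0" for l \<xi>
  proof -
    define Q where "Q = 1 + \<xi>\<^sup>2"
    have Q: "Q \<ge> 1" by (simp add: Q_def)
    define X where "X = (1 + \<bar>\<xi>\<bar>) * cmod (w \<xi>)"
    have X2: "X\<^sup>2 \<le> 2 * Q * (cmod (w \<xi>))\<^sup>2"
    proof -
      have "(1 + \<bar>\<xi>\<bar>)\<^sup>2 \<le> 2 * Q"
        using zero_le_power2[of "\<bar>\<xi>\<bar> - 1"] by (simp add: Q_def power2_sum power2_diff)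
      then show ?thesis unfolding X_def power_mult_distrib by (intro mult_right_mono) auto
    qed
    have X0: "0 \<le> X" by (simp add: X_def)
    define A where "A = Q powr s * (cmod (w \<xi>))\<^sup>2"
    have "Q ^ 4 \<le> Q powr s"
      using powr_mono[OF s Q] Q by simp
    then have A: "Q ^ 4 * (cmod (w \<xi>))\<^sup>2 \<le> A" unfolding A_def by (intro mult_right_mono) auto
    have "(Q * X)\<^sup>2 \<le> Q\<^sup>2 * (2 * Q * (cmod (w \<xi>))\<^sup>2)"
      unfolding power_mult_distrib using X2 by (intro mult_left_mono) auto
    also have "\<dots> = 2 * (Q ^ 4 * (cmod (w \<xi>))\<^sup>2) / Q"
      using Q by (simp add: power2_eq_square eval_nat_numeral)
    also have "\<dots> \<le> 2 * A / Q" using A Q by (intro divide_right_mono) auto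
    also have "\<dots> = 4 * (A / (2 * l)) * (l / Q)" using l by simp
    also have "\<dots> \<le> (A / (2 * l) + l / Q)\<^sup>2"
    proof -
      have "4 * a * b \<le> (a + b)\<^sup>2" for a b :: real
        using zero_le_power2[of "a - b"] by (simp add: power2_sum power2_diff)
      then show ?thesis .
    qed
    finally have "Q * X \<le> A / (2 * l) + l / Q"
      by (rule power2_le_imp_le) (use Q l in \<open>simp add: A_def\<close>)
    then show ?thesis by (simp add: Q_def X_def A_def mult.assoc)
  qed
  show ig: "integrable lborel ?W"
  proof (rule Bochner_Integration.integrable_bound)
    show "integrable lborel (\<lambda>\<xi>. 1 / (2 * 1) * ?a2 \<xi> + 1 * (1 / (1 + \<xi>\<^sup>2)))"
      using int q by (intro Bochner_Integration.integrable_add integrable_mult_right)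
    show "AE \<xi> in lborel. norm (?W \<xi>) \<le> norm (1 / (2 * 1) * ?a2 \<xi> + 1 * (1 / (1 + \<xi>\<^sup>2)))"
    proof (rule AE_I2)
      fix \<xi>
      have "norm (?W \<xi>) = ?W \<xi>"
        by (simp add: abs_mult add_nonneg_nonneg)
      also have "\<dots> \<le> 1 / (2 * 1) * ?a2 \<xi> + 1 * (1 / (1 + \<xi>\<^sup>2))" by (rule am_gm) simp
      finally show "norm (?W \<xi>) \<le> norm (1 / (2 * 1) * ?a2 \<xi> + 1 * (1 / (1 + \<xi>\<^sup>2)))"
        unfolding real_norm_def by (rule order.trans[OF _ abs_ge_self])
    qed
  qed measurable
  have le: "?I \<le> 1 / (2 * l) * n\<^sup>2 + l * pi" if l: "l > 0" for l
  proof -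
    have i: "integrable lborel (\<lambda>\<xi>. 1 / (2 * l) * ?a2 \<xi>)" "integrable lborel (\<lambda>\<xi>. l * (1 / (1 + \<xi>\<^sup>2)))"
      by (rule integrable_mult_right[OF int], rule integrable_mult_right[OF q(1)])
    have "?I \<le> (LINT \<xi>|lborel. 1 / (2 * l) * ?a2 \<xi> + l * (1 / (1 + \<xi>\<^sup>2)))"
      using i am_gm[OF l] ig by (intro Bochner_Integration.integral_mono Bochner_Integration.integrable_add) auto
    also have "\<dots> = 1 / (2 * l) * n\<^sup>2 + l * pi"
      using i by (simp only: Bochner_Integration.integral_add integral_mult_right_zero n q)
    finally show ?thesis .
  qed
  have "?I \<le> (1 / 2 + pi) * n + e" if e: "e > 0" for e
  proof -
    \<comment> \<open>The choice l = n would give the claim at once, but n may be 0. With l = n + d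
      the excess is (1/2 + pi) d = e.\<close>
    define d where "d = e / (1 / 2 + pi)"
    have d: "d > 0" using e pi_gt_zero by (simp add: d_def add_pos_pos)
    have "n\<^sup>2 \<le> (n + d) * (n + d)" unfolding power2_eq_square using n(2) d by (intro mult_mono) auto
    then have "1 / (2 * (n + d)) * n\<^sup>2 \<le> 1 / (2 * (n + d)) * ((n + d) * (n + d))"
      using n d by (intro mult_left_mono) auto
    then have "?I \<le> 1 / (2 * (n + d)) * ((n + d) * (n + d)) + (n + d) * pi"
      using le[of "n + d"] n d by linarith
    also have "\<dots> = (1 / 2 + pi) * n + (1 / 2 + pi) * d" using n d by (simp add: field_simps)
    also have "(1 / 2 + pi) * d = e"
    proof -
      have "1 / 2 + pi \<noteq> 0" using pi_gt_zero by linarith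
      then show ?thesis by (simp add: d_def)
    qed
    finally show ?thesis .
  qed
  then show "?I \<le> (1 / 2 + pi) * n" by (rule field_le_epsilon)
qed

text \<open>Inversion represents v by a Fourier integral, and each derivative multiplies its
  integrand by \<i> \<xi>. The transform w is the one chosen inside \<open>sobolev_norm\<close>, so
  the bounds are in terms of that very number.\<close>

lemma sobolev_embedding:
  assumes s: "4 \<le> s" and v: "v \<in> sobolev_space s"
  obtains v' v'' where "\<And>x. (v has_real_derivative v' x) (at x)" "\<And>x. (v' has_real_derivative v'' x) (at x)"
    "\<And>x. \<bar>v x\<bar> \<le> sobolev_norm s v" "\<And>x. \<bar>v' x\<bar> \<le> sobolev_norm s v" "\<And>x. \<bar>v'' x\<bar> \<le> sobolev_norm s v"
proof -
  define w where "w = (SOME w. sobolev_transform s v w)"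
  have cont: "continuous_on UNIV v" and v2: "integrable lborel (\<lambda>x. (v x)\<^sup>2)" and ex: "\<exists>w. sobolev_transform s v w"
    using v by (auto simp: sobolev_space_def)
  have "sobolev_transform s v w" unfolding w_def by (rule someI_ex[OF ex])
  then have ft: "is_fourier_transform v w" and iw: "integrable lborel (\<lambda>\<xi>. (1 + \<xi>\<^sup>2) powr s * (cmod (w \<xi>))\<^sup>2)"
    by (auto simp: sobolev_transform_def)
  have wm [measurable]: "w \<in> borel_measurable borel" using ft by (simp add: is_fourier_transform_def)
  let ?W = "\<lambda>\<xi>. (1 + \<xi>\<^sup>2) * (1 + \<bar>\<xi>\<bar>) * cmod (w \<xi>)"
  have norm_eq: "sobolev_norm s v = sqrt (LINT \<xi>|lborel. (1 + \<xi>\<^sup>2) powr s * (cmod (w \<xi>))\<^sup>2)"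
    by (simp add: sobolev_norm_def w_def)
  have W: "integrable lborel ?W" "(LINT \<xi>|lborel. ?W \<xi>) \<le> (1 / 2 + pi) * sobolev_norm s v"
    unfolding norm_eq using weighted_L1_le_sobolev[OF wm s iw] by auto
  have norm0: "0 \<le> sobolev_norm s v" unfolding norm_eq by (auto intro!: Bochner_Integration.integral_nonneg)
  define g where "g k \<xi> = (\<i> * of_real \<xi>) ^ k * w \<xi>" for k :: nat and \<xi> :: real
  have [measurable]: "g k \<in> borel_measurable borel" for k unfolding g_def[abs_def] by measurable
  define F where "F k x = (LINT \<xi>|lborel. g k \<xi> * cis (x * \<xi>))" for k x
  have norm_g: "cmod (g k \<xi>) = \<bar>\<xi>\<bar> ^ k * cmod (w \<xi>)" for k \<xi> by (simp add: g_def norm_mult norm_power)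
  have gW: "cmod (g k \<xi>) \<le> ?W \<xi>" if "k \<le> 2" for k \<xi>
  proof -
    have "\<bar>\<xi>\<bar> ^ k \<le> (1 + \<xi>\<^sup>2) * (1 + \<bar>\<xi>\<bar>)"
    proof -
      have "(1 + \<xi>\<^sup>2) * (1 + \<bar>\<xi>\<bar>) = 1 + \<bar>\<xi>\<bar> + \<bar>\<xi>\<bar>\<^sup>2 + \<xi>\<^sup>2 * \<bar>\<xi>\<bar>"
        by (simp add: algebra_simps)
      moreover have "0 \<le> \<xi>\<^sup>2 * \<bar>\<xi>\<bar>" "0 \<le> \<bar>\<xi>\<bar>\<^sup>2" by simp_all
      moreover have "k = 0 \<or> k = 1 \<or> k = 2" using that by linarith
      ultimately show ?thesis by auto
    qed
    then show ?thesis unfolding norm_g by (intro mult_right_mono) auto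
  qed
  have dF: "(F k has_vector_derivative F (Suc k) x) (at x)" if "k \<le> 1" for k x
  proof -
    have "integrable lborel (\<lambda>\<xi>. (1 + \<xi>\<^sup>2) * cmod (g k \<xi>))"
    proof (rule Bochner_Integration.integrable_bound[OF W(1)])
      have "\<bar>\<xi>\<bar> ^ k \<le> 1 + \<bar>\<xi>\<bar>" for \<xi> :: real
        using that by (cases "k = 0") (auto simp: le_Suc_eq)
      then have "(1 + \<xi>\<^sup>2) * (\<bar>\<xi>\<bar> ^ k * cmod (w \<xi>)) \<le> ?W \<xi>" for \<xi>
        by (subst mult.assoc) (intro mult_left_mono mult_right_mono, auto)
      then show "AE \<xi> in lborel. norm ((1 + \<xi>\<^sup>2) * cmod (g k \<xi>)) \<le> norm (?W \<xi>)"
        unfolding norm_g by (intro AE_I2) (simp add: abs_mult add_nonneg_nonneg)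
    qed simp
    from has_vector_derivative_fourier_integral[OF _ this, of x]
    show ?thesis unfolding F_def g_def by (simp add: mult.assoc)
  qed
  have bF: "cmod (F k x) \<le> (1 / 2 + pi) * sobolev_norm s v" if "k \<le> 2" for k x
  proof -
    have ig: "integrable lborel (\<lambda>\<xi>. cmod (g k \<xi>))"
      by (rule Bochner_Integration.integrable_bound[OF W(1)]) (auto intro!: AE_I2 gW[OF that])
    have "cmod (F k x) \<le> (LINT \<xi>|lborel. cmod (g k \<xi>))"
      unfolding F_def by (rule order.trans[OF integral_norm_bound]) (simp add: norm_mult)
    also have "\<dots> \<le> (LINT \<xi>|lborel. ?W \<xi>)" using ig W(1) gW[OF that] by (rule Bochner_Integration.integral_mono)
    finally show ?thesis using W(2) by linarith
  qed
  define V where "V k x = Re (F k x) / (2 * pi)" for k x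
  have "cmod (w \<xi>) \<le> ?W \<xi>" for \<xi> using gW[of 0 \<xi>] by (simp add: g_def)
  then have "integrable lborel w"
    by (intro Bochner_Integration.integrable_bound[OF W(1)]) (auto intro!: AE_I2)
  then have "v = V 0"
    using fourier_inversion[OF cont v2 ft] by (auto simp: V_def F_def g_def fun_eq_iff)
  moreover have dV: "(V k has_real_derivative V (Suc k) x) (at x)" if "k \<le> 1" for k x
  proof -
    have "((\<lambda>x. Re (F k x)) has_vector_derivative Re (F (Suc k) x)) (at x)"
      by (rule bounded_linear.has_vector_derivative[OF bounded_linear_Re dF[OF that]])
    then show ?thesis unfolding V_def
      by (intro DERIV_cdivide) (simp add: has_real_derivative_iff_has_vector_derivative)
  qed
  moreover have bV: "\<bar>V k x\<bar> \<le> sobolev_norm s v" if "k \<le> 2" for k x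
  proof -
    have "\<bar>V k x\<bar> \<le> ((1 / 2 + pi) * sobolev_norm s v) / (2 * pi)"
      using abs_Re_le_cmod[of "F k x"] bF[OF that, of x] by (simp add: V_def divide_right_mono)
    \<comment> \<open>1/2 + pi \<le> 2 pi, so the embedding constant can be taken as 1.\<close>
    also have "\<dots> \<le> (2 * pi * sobolev_norm s v) / (2 * pi)"
      using norm0 pi_ge_two by (intro divide_right_mono mult_right_mono) auto
    finally show ?thesis by simp
  qed
  ultimately show ?thesis
    by (intro that[of "V 1" "V 2"]) (use dV[of 0] dV[of 1] bV[of 0] bV[of 1] bV[of 2] in \<open>auto simp: numeral_2_eq_2\<close>)
qed

section \<open>Closure of \<open>sobolev_space\<close> under linear combinations\<close>

lemma is_fourier_transform_cmult:
  assumes "is_fourier_transform v w"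
  shows "is_fourier_transform (\<lambda>x. c * v x) (\<lambda>\<xi>. of_real c * w \<xi>)"
  using assms unfolding is_fourier_transform_def
  by (auto simp: mult.assoc)

text \<open>The integral on the right splits only if both pairings with \<open>fourier\<close>
  converge; continuity and square integrability provide this through
  \<open>integrable_mult_fourier\<close>.\<close>

lemma is_fourier_transform_add:
  assumes v1: "is_fourier_transform v1 w1" "continuous_on UNIV v1" "integrable lborel (\<lambda>x. (v1 x)\<^sup>2)"
    and v2: "is_fourier_transform v2 w2" "continuous_on UNIV v2" "integrable lborel (\<lambda>x. (v2 x)\<^sup>2)"
  shows "is_fourier_transform (\<lambda>x. v1 x + v2 x) (\<lambda>\<xi>. w1 \<xi> + w2 \<xi>)"
  unfolding is_fourier_transform_def
proof (intro conjI allI impI)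
  have [measurable]: "w1 \<in> borel_measurable borel" "w2 \<in> borel_measurable borel"
    using v1 v2 by (auto simp: is_fourier_transform_def)
  show "(\<lambda>\<xi>. w1 \<xi> + w2 \<xi>) \<in> borel_measurable borel" by measurable
  fix \<theta> assume \<theta>: "schwartz \<theta>"
  have i: "integrable lborel (\<lambda>\<xi>. w1 \<xi> * of_real (\<theta> \<xi>))" "integrable lborel (\<lambda>\<xi>. w2 \<xi> * of_real (\<theta> \<xi>))"
    and e: "(LINT \<xi>|lborel. w1 \<xi> * of_real (\<theta> \<xi>)) = (LINT x|lborel. of_real (v1 x) * fourier \<theta> x)"
      "(LINT \<xi>|lborel. w2 \<xi> * of_real (\<theta> \<xi>)) = (LINT x|lborel. of_real (v2 x) * fourier \<theta> x)"
    using v1(1) v2(1) \<theta> unfolding is_fourier_transform_def by blast+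
  have j: "integrable lborel (\<lambda>x. of_real (v1 x) * fourier \<theta> x)" "integrable lborel (\<lambda>x. of_real (v2 x) * fourier \<theta> x)"
    using v1 v2 \<theta> by (auto intro!: integrable_mult_fourier borel_measurable_continuous_onI)
  show "integrable lborel (\<lambda>\<xi>. (w1 \<xi> + w2 \<xi>) * of_real (\<theta> \<xi>))" using i by (simp add: distrib_right)
  show "(LINT \<xi>|lborel. (w1 \<xi> + w2 \<xi>) * of_real (\<theta> \<xi>)) = (LINT x|lborel. of_real (v1 x + v2 x) * fourier \<theta> x)"
    using i e j by (simp add: distrib_right)
qed

lemma sobolev_space_cmult:
  assumes "v \<in> sobolev_space s"
  shows "(\<lambda>x. c * v x) \<in> sobolev_space s"
proof -
  obtain w where v: "continuous_on UNIV v" "integrable lborel (\<lambda>x. (v x)\<^sup>2)" "is_fourier_transform v w"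
    "integrable lborel (\<lambda>\<xi>. (1 + \<xi>\<^sup>2) powr s * (cmod (w \<xi>))\<^sup>2)"
    using assms by (auto simp: sobolev_space_def sobolev_transform_def)
  have "integrable lborel (\<lambda>\<xi>. c\<^sup>2 * ((1 + \<xi>\<^sup>2) powr s * (cmod (w \<xi>))\<^sup>2))"
    using v(4) by (rule integrable_mult_right)
  then have "sobolev_transform s (\<lambda>x. c * v x) (\<lambda>\<xi>. of_real c * w \<xi>)"
    using is_fourier_transform_cmult[OF v(3)]
    by (simp add: sobolev_transform_def norm_mult power_mult_distrib mult_ac)
  then show ?thesis using v by (auto simp: sobolev_space_def power_mult_distrib intro!: continuous_intros)
qed

lemma sobolev_space_add:
  assumes "v1 \<in> sobolev_space s" "v2 \<in> sobolev_space s"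
  shows "(\<lambda>x. v1 x + v2 x) \<in> sobolev_space s"
proof -
  obtain w1 where v1: "continuous_on UNIV v1" "integrable lborel (\<lambda>x. (v1 x)\<^sup>2)" "is_fourier_transform v1 w1"
    "integrable lborel (\<lambda>\<xi>. (1 + \<xi>\<^sup>2) powr s * (cmod (w1 \<xi>))\<^sup>2)"
    using assms by (auto simp: sobolev_space_def sobolev_transform_def)
  obtain w2 where v2: "continuous_on UNIV v2" "integrable lborel (\<lambda>x. (v2 x)\<^sup>2)" "is_fourier_transform v2 w2"
    "integrable lborel (\<lambda>\<xi>. (1 + \<xi>\<^sup>2) powr s * (cmod (w2 \<xi>))\<^sup>2)"
    using assms by (auto simp: sobolev_space_def sobolev_transform_def)
  have [measurable]: "v1 \<in> borel_measurable borel" "v2 \<in> borel_measurable borel"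
    using v1 v2 by (auto intro: borel_measurable_continuous_onI)
  have [measurable]: "w1 \<in> borel_measurable borel" "w2 \<in> borel_measurable borel"
    using v1 v2 by (auto simp: is_fourier_transform_def)
  have sq: "(a + b)\<^sup>2 \<le> 2 * a\<^sup>2 + 2 * b\<^sup>2" for a b :: real
    using zero_le_power2[of "a - b"] by (simp add: power2_sum power2_diff)
  have "integrable lborel (\<lambda>x. 2 * (v1 x)\<^sup>2 + 2 * (v2 x)\<^sup>2)" using v1 v2 by simp
  then have "integrable lborel (\<lambda>x. (v1 x + v2 x)\<^sup>2)"
    by (rule Bochner_Integration.integrable_bound) (auto intro!: AE_I2 sq simp: abs_of_nonneg)
  moreover have "integrable lborel (\<lambda>\<xi>. (1 + \<xi>\<^sup>2) powr s * (cmod (w1 \<xi> + w2 \<xi>))\<^sup>2)"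
  proof (rule Bochner_Integration.integrable_bound)
    show "integrable lborel (\<lambda>\<xi>. 2 * ((1 + \<xi>\<^sup>2) powr s * (cmod (w1 \<xi>))\<^sup>2) + 2 * ((1 + \<xi>\<^sup>2) powr s * (cmod (w2 \<xi>))\<^sup>2))"
      using v1 v2 by simp
    have "(1 + \<xi>\<^sup>2) powr s * (cmod (w1 \<xi> + w2 \<xi>))\<^sup>2 \<le> (1 + \<xi>\<^sup>2) powr s * (2 * (cmod (w1 \<xi>))\<^sup>2 + 2 * (cmod (w2 \<xi>))\<^sup>2)" for \<xi>
      by (intro mult_left_mono order.trans[OF power_mono[OF norm_triangle_ineq] sq]) auto
    then show "AE \<xi> in lborel. norm ((1 + \<xi>\<^sup>2) powr s * (cmod (w1 \<xi> + w2 \<xi>))\<^sup>2)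
      \<le> norm (2 * ((1 + \<xi>\<^sup>2) powr s * (cmod (w1 \<xi>))\<^sup>2) + 2 * ((1 + \<xi>\<^sup>2) powr s * (cmod (w2 \<xi>))\<^sup>2))"
      by (intro AE_I2) (simp add: distrib_left mult_ac)
  qed measurable
  ultimately show ?thesis
    using v1 v2 is_fourier_transform_add[OF v1(3,1,2) v2(3,1,2)]
    by (auto simp: sobolev_space_def sobolev_transform_def intro!: continuous_intros)
qed

section \<open>Differential equations in Banach spaces\<close>

text \<open>Let m be the maximum of norm (z t) exp(-2 \<Lambda> t). Because the exponent carries
  twice the Lipschitz constant, integrating the derivative bound up to the maximiser gives m \<le>
  m/2 + c S.\<close>

lemma gronwall_zero_initial:
  fixes z z' :: "real \<Rightarrow> 'a::real_normed_vector"
  assumes S: "0 < S" and cont: "continuous_on {0..S} z" and z0: "z 0 = 0"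
    and der: "\<And>t. 0 < t \<Longrightarrow> t < S \<Longrightarrow> (z has_vector_derivative z' t) (at t)"
    and le: "\<And>t. 0 < t \<Longrightarrow> t < S \<Longrightarrow> norm (z' t) \<le> \<Lambda> * norm (z t) + c"
    and \<Lambda>: "0 < \<Lambda>" and c: "0 \<le> c" and t: "t \<in> {0..S}"
  shows "norm (z t) \<le> 2 * c * S * exp (2 * \<Lambda> * S)"
proof -
  let ?q = "\<lambda>t. norm (z t) * exp (- (2 * \<Lambda> * t))"
  have "\<exists>x\<in>{0..S}. \<forall>y\<in>{0..S}. ?q y \<le> ?q x"
    using S by (intro continuous_attains_sup continuous_intros cont) auto
  then obtain r where r: "r \<in> {0..S}" and max: "\<And>y. y \<in> {0..S} \<Longrightarrow> ?q y \<le> ?q r" by blast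
  define m where "m = ?q r"
  have m0: "0 \<le> m" by (simp add: m_def)
  have z_le: "norm (z y) \<le> m * exp (2 * \<Lambda> * y)" if "y \<in> {0..S}" for y
    using max[OF that] by (simp add: m_def exp_minus field_simps)
  have "m \<le> m / 2 + c * S"
  proof (cases "r = 0")
    case False
    \<comment> \<open>A primitive of \<open>\<Lambda> * (m * exp (2 * \<Lambda> * t)) + c\<close>,
      the bound on the derivative that follows from \<open>z_le\<close>.\<close>
    define \<phi> where "\<phi> t = m / 2 * exp (2 * \<Lambda> * t) + c * t" for t
    have r0: "0 < r" "r \<le> S" using r False by auto
    have "norm (z r - z 0) \<le> \<phi> r - \<phi> 0"
    proof (rule differentiable_bound_general[OF r0(1)])
      show "continuous_on {0..r} z" using cont r0 by (auto intro: continuous_on_subset)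
      show "continuous_on {0..r} \<phi>" unfolding \<phi>_def by (intro continuous_intros)
      fix x assume x: "0 < x" "x < r"
      then show "(z has_vector_derivative z' x) (at x)" using der r0 by simp
      show "(\<phi> has_vector_derivative (\<Lambda> * (m * exp (2 * \<Lambda> * x)) + c)) (at x)"
        unfolding \<phi>_def has_real_derivative_iff_has_vector_derivative[symmetric]
        by (auto intro!: derivative_eq_intros)
      have "norm (z' x) \<le> \<Lambda> * norm (z x) + c" using le x r0 by simp
      also have "\<dots> \<le> \<Lambda> * (m * exp (2 * \<Lambda> * x)) + c"
        using z_le[of x] x r0 \<Lambda> by (intro add_mono mult_left_mono) auto
      finally show "norm (z' x) \<le> \<Lambda> * (m * exp (2 * \<Lambda> * x)) + c" .
    qed
    then have "norm (z r) \<le> m / 2 * exp (2 * \<Lambda> * r) + c * r - m / 2"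
      by (simp add: z0 \<phi>_def)
    then have "norm (z r) \<le> m / 2 * exp (2 * \<Lambda> * r) + c * r" using m0 by simp
    then have "m \<le> (m / 2 * exp (2 * \<Lambda> * r) + c * r) * exp (- (2 * \<Lambda> * r))"
      unfolding m_def by (intro mult_right_mono) auto
    also have "\<dots> = m / 2 + c * r * exp (- (2 * \<Lambda> * r))"
      by (simp add: distrib_right exp_minus)
    also have "c * r * exp (- (2 * \<Lambda> * r)) \<le> c * S * 1"
      using c r0 \<Lambda> by (intro mult_mono) auto
    finally show ?thesis by simp
  qed (use c S in \<open>simp add: m_def z0\<close>)
  then have "m \<le> 2 * c * S" by simp
  then have "norm (z t) \<le> 2 * c * S * exp (2 * \<Lambda> * t)"
    using z_le[OF t] by (meson exp_ge_zero mult_right_mono order.trans)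
  also have "\<dots> \<le> 2 * c * S * exp (2 * \<Lambda> * S)"
    using c S t \<Lambda> by (intro mult_left_mono) auto
  finally show ?thesis .
qed

text \<open>The library requires a metric domain here, which the index type \<^typ>\<open>int\<close> does not have.\<close>

instance bcontfun :: (topological_space, complete_space) complete_space
proof
  fix f :: "nat \<Rightarrow> ('a, 'b) bcontfun"
  assume f: "Cauchy f"
  have "\<exists>g. uniform_limit UNIV (\<lambda>n. apply_bcontfun (f n)) g sequentially"
    using f uniformly_convergent_eq_cauchy[of "\<lambda>_. True" "\<lambda>n. apply_bcontfun (f n)"]
    unfolding Cauchy_def uniform_limit_sequentially_iff
    by (metis dist_fun_lt_imp_dist_val_lt)
  then obtain g where "uniform_limit UNIV (\<lambda>n. apply_bcontfun (f n)) g sequentially" ..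
  from uniform_limit_bcontfunE[OF this sequentially_bot]
  obtain l' where "f \<longlonglongrightarrow> l'" by metis
  then show "convergent f" by (rule convergentI)
qed

instance bcontfun :: (topological_space, banach) banach ..

lemma contraction_fixed_point:
  fixes \<Phi> :: "'a::{metric_space,complete_space} \<Rightarrow> 'a"
  assumes "\<And>x y. dist (\<Phi> x) (\<Phi> y) \<le> 1 / 2 * dist x y"
  obtains x where "\<Phi> x = x"
  using banach_fix_type[of "1 / 2" \<Phi>] assms by auto

text \<open>The weight \<open>exp (- 2 \<Lambda> t)\<close> makes the Picard operator a contraction on all of \<open>[0, S]\<close>.\<close>

lemma global_picard:
  fixes G :: "'a::banach \<Rightarrow> 'a"
  assumes S: "0 < S" and \<Lambda>: "0 < \<Lambda>" and lip: "\<And>x y. norm (G x - G y) \<le> \<Lambda> * norm (x - y)"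
  shows "\<exists>z. z 0 = z0 \<and> (\<forall>t\<in>{0..S}. (z has_vector_derivative G (z t)) (at t within {0..S}))"
proof -
  \<comment> \<open>Clamping time to [0, S] lets the iterates live in the complete space of bounded
    continuous functions on the whole line.\<close>
  define \<tau> where "\<tau> t = max 0 (min t S)" for t :: real
  have \<tau>: "\<tau> t \<in> {0..S}" "continuous_on A \<tau>" for t A
    using S unfolding \<tau>_def by (auto intro!: continuous_intros)
  have \<tau>_id: "\<tau> t = t" if "t \<in> {0..S}" for t using that by (auto simp: \<tau>_def)
  have G_cont: "continuous_on A G" for A
    using lip \<Lambda> by (intro lipschitz_on_continuous_on[where L=\<Lambda>] lipschitz_onI) (auto simp: dist_norm)
  \<comment> \<open>The unknown y is the solution multiplied by exp(-2 \<Lambda> t); the weight is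
    undone before G is applied.\<close>
  define g where "g y s = G (exp (2 * \<Lambda> * s) *\<^sub>R apply_bcontfun y s)" for y :: "real \<Rightarrow>\<^sub>C 'a" and s
  define I where "I y t = z0 + integral {0..t} (g y)" for y t
  define \<Psi> where "\<Psi> y t = exp (- (2 * \<Lambda> * \<tau> t)) *\<^sub>R I y (\<tau> t)" for y t
  have g_cont: "continuous_on A (g y)" for y A
    unfolding g_def by (rule continuous_on_compose2[OF G_cont[of UNIV]]) (auto intro!: continuous_intros)
  have g_int: "g y integrable_on {a..b}" for y a b
    using g_cont by (rule integrable_continuous_interval)
  have I_der: "(I y has_vector_derivative g y t) (at t within {0..S})" if "t \<in> {0..S}" for y t
    unfolding I_def using integral_has_vector_derivative[OF g_cont that, of y] by (auto intro!: derivative_eq_intros)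
  have I_cont: "continuous_on {0..S} (I y)" for y
    using I_der by (intro continuous_on_vector_derivative)
  have \<Psi>_cont: "continuous_on UNIV (\<Psi> y)" for y
    unfolding \<Psi>_def using \<tau>
    by (intro continuous_intros continuous_on_compose2[OF I_cont]) auto
  have "bounded (range (\<Psi> y))" for y
  proof -
    have "compact ((\<lambda>t. exp (- (2 * \<Lambda> * t)) *\<^sub>R I y t) ` {0..S})"
      by (intro compact_continuous_image continuous_intros I_cont) auto
    moreover have "range (\<Psi> y) \<subseteq> (\<lambda>t. exp (- (2 * \<Lambda> * t)) *\<^sub>R I y t) ` {0..S}"
      unfolding \<Psi>_def using \<tau>(1) by auto
    ultimately show ?thesis using bounded_subset compact_imp_bounded by blast
  qed
  then have mem: "\<Psi> y \<in> bcontfun" for y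
    using \<Psi>_cont by (auto simp: bcontfun_def)
  have contract: "dist (Bcontfun (\<Psi> x)) (Bcontfun (\<Psi> y)) \<le> 1 / 2 * dist x y" for x y
  proof (rule dist_bound)
    fix t
    define r where "r = \<tau> t"
    define D where "D = dist x y"
    have r: "0 \<le> r" "r \<le> S" using \<tau>(1)[of t] by (auto simp: r_def)
    have D0: "0 \<le> D" by (simp add: D_def)
    have gd: "norm (g x s - g y s) \<le> \<Lambda> * (exp (2 * \<Lambda> * s) * D)" for s
    proof -
      have "norm (g x s - g y s) \<le> \<Lambda> * norm (exp (2 * \<Lambda> * s) *\<^sub>R (apply_bcontfun x s - apply_bcontfun y s))"
        unfolding g_def using lip by (simp add: scaleR_diff_right)
      also have "\<dots> = \<Lambda> * (exp (2 * \<Lambda> * s) * dist (apply_bcontfun x s) (apply_bcontfun y s))"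
        by (simp add: dist_norm)
      also have "\<dots> \<le> \<Lambda> * (exp (2 * \<Lambda> * s) * D)"
        unfolding D_def using \<Lambda> by (intro mult_left_mono dist_bounded) auto
      finally show ?thesis .
    qed
    \<comment> \<open>Integrating \<Lambda> exp(2 \<Lambda> s) produces the factor 1/2, which
      becomes the contraction constant.\<close>
    have hi: "((\<lambda>s. \<Lambda> * (exp (2 * \<Lambda> * s) * D)) has_integral (D / 2 * exp (2 * \<Lambda> * r) - D / 2 * exp (2 * \<Lambda> * 0))) {0..r}"
      using r \<Lambda> by (intro fundamental_theorem_of_calculus)
        (auto intro!: derivative_eq_intros simp flip: has_real_derivative_iff_has_vector_derivative)
    have "norm (integral {0..r} (\<lambda>s. g x s - g y s)) \<le> integral {0..r} (\<lambda>s. \<Lambda> * (exp (2 * \<Lambda> * s) * D))"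
      using gd hi g_int by (intro integral_norm_bound_integral integrable_diff) (auto simp: has_integral_integrable)
    also have "\<dots> = D / 2 * exp (2 * \<Lambda> * r) - D / 2"
      by (subst integral_unique[OF hi]) simp
    also have "\<dots> \<le> D / 2 * exp (2 * \<Lambda> * r)" using D0 by simp
    finally have nI: "norm (I x r - I y r) \<le> D / 2 * exp (2 * \<Lambda> * r)"
      unfolding I_def using g_int by (simp add: integral_diff)
    have "dist (\<Psi> x t) (\<Psi> y t) = exp (- (2 * \<Lambda> * r)) * norm (I x r - I y r)"
      by (simp add: \<Psi>_def r_def dist_norm flip: scaleR_diff_right)
    also have "\<dots> \<le> exp (- (2 * \<Lambda> * r)) * (D / 2 * exp (2 * \<Lambda> * r))" using nI by (intro mult_left_mono) auto
    also have "\<dots> = D / 2" by (simp add: exp_minus)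
    finally show "dist (apply_bcontfun (Bcontfun (\<Psi> x)) t) (apply_bcontfun (Bcontfun (\<Psi> y)) t) \<le> 1 / 2 * dist x y"
      using mem by (simp add: Bcontfun_inverse D_def)
  qed
  then obtain y where "Bcontfun (\<Psi> y) = y" by (rule contraction_fixed_point)
  then have y: "apply_bcontfun y t = \<Psi> y t" for t using mem Bcontfun_inverse by metis
  have fix_eq: "exp (2 * \<Lambda> * t) *\<^sub>R apply_bcontfun y t = I y t" if "t \<in> {0..S}" for t
    unfolding y \<Psi>_def using \<tau>_id[OF that] by (simp flip: exp_add)
  show ?thesis
  proof (intro exI[of _ "I y"] conjI ballI)
    show "I y 0 = z0" by (simp add: I_def)
    show "(I y has_vector_derivative G (I y t)) (at t within {0..S})" if "t \<in> {0..S}" for t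
      using I_der[OF that, of y] fix_eq[OF that] by (simp add: g_def)
  qed
qed

section \<open>Sobolev-valued curves on the grid\<close>

lemma sobolev_abs_le:
  assumes "4 \<le> s" "v \<in> sobolev_space s"
  shows "\<bar>v x\<bar> \<le> sobolev_norm s v"
  using assms by (rule sobolev_embedding) blast

lemma apply_grid_seq:
  assumes "\<And>x. \<bar>g x\<bar> \<le> B"
  shows "apply_bcontfun (grid_seq h g) i = g (of_int i * h)"
proof -
  have "(\<lambda>i::int. g (of_int i * h)) \<in> bcontfun"
    unfolding int_bcontfun_iff bounded_iff using assms by auto
  then show ?thesis by (simp add: grid_seq_def Bcontfun_inverse)
qed

lemma apply_grid_seq_sobolev:
  "4 \<le> s \<Longrightarrow> v \<in> sobolev_space s \<Longrightarrow> apply_bcontfun (grid_seq h v) i = v (of_int i * h)"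
  by (rule apply_grid_seq[OF sobolev_abs_le])

lemma sobolev_space_diff:
  assumes "v \<in> sobolev_space s" "w \<in> sobolev_space s"
  shows "(\<lambda>x. v x - w x) \<in> sobolev_space s"
  using sobolev_space_add[OF assms(1) sobolev_space_cmult[OF assms(2), of "-1"]] by simp

lemma sobolev_space_quotient:
  assumes "v \<in> sobolev_space s" "w \<in> sobolev_space s" "r \<in> sobolev_space s"
  shows "(\<lambda>x. (v x - w x) / d - r x) \<in> sobolev_space s"
  using sobolev_space_diff[OF sobolev_space_cmult[OF sobolev_space_diff[OF assms(1,2)], of "1 / d"] assms(3)]
  by simp

text \<open>At every node the embedding bounds the error of the difference quotient by its Sobolev
  norm, so convergence in H^s implies convergence in the supremum norm.
  \<open>sobolev_space_quotient\<close> makes the embedding applicable.\<close>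

lemma grid_seq_has_vector_derivative:
  assumes s: "4 \<le> s" and u: "\<And>t. t \<in> I \<Longrightarrow> u t \<in> sobolev_space s" and u1: "u1 \<in> sobolev_space s"
    and t: "t \<in> I"
    and lim: "((\<lambda>\<tau>. sobolev_norm s (\<lambda>x. (u \<tau> x - u t x) / (\<tau> - t) - u1 x)) \<longlongrightarrow> 0) (at t within I)"
  shows "((\<lambda>t. grid_seq h (u t)) has_vector_derivative grid_seq h u1) (at t within I)"
  unfolding has_vector_derivative_def has_derivative_within
proof (intro conjI bounded_linear_scaleR_left Lim_null_comparison[OF _ lim])
  let ?q = "\<lambda>\<tau>. (1 / norm (\<tau> - t)) *\<^sub>R (grid_seq h (u \<tau>) - (grid_seq h (u t) + (\<tau> - t) *\<^sub>R grid_seq h u1))"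
  have "norm (?q \<tau>)
       \<le> sobolev_norm s (\<lambda>x. (u \<tau> x - u t x) / (\<tau> - t) - u1 x)" if \<tau>: "\<tau> \<in> I" "\<tau> \<noteq> t" for \<tau>
  proof (rule norm_bound)
    fix i
    let ?D = "\<lambda>x. (u \<tau> x - u t x) / (\<tau> - t) - u1 x"
    let ?x = "of_int i * h"
    have "u \<tau> ?x - (u t ?x + (\<tau> - t) * u1 ?x) = (\<tau> - t) * ?D ?x" using \<tau> by (simp add: field_simps)
    then have "apply_bcontfun (?q \<tau>) i
      = 1 / \<bar>\<tau> - t\<bar> * ((\<tau> - t) * ?D ?x)"
      using u[OF \<tau>(1)] u[OF t] u1 s by (simp add: apply_grid_seq_sobolev)
    then have "norm (apply_bcontfun (?q \<tau>) i)
      = \<bar>?D ?x\<bar>" using \<tau> by (simp add: abs_mult del: scaleR_bcontfun.rep_eq)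
    also have "\<dots> \<le> sobolev_norm s ?D"
      using s u \<tau> t u1 by (intro sobolev_abs_le sobolev_space_quotient) auto
    finally show "norm (apply_bcontfun (?q \<tau>) i)
      \<le> sobolev_norm s ?D" .
  qed
  then show "\<forall>\<^sub>F \<tau> in at t within I. norm (?q \<tau>)
       \<le> sobolev_norm s (\<lambda>x. (u \<tau> x - u t x) / (\<tau> - t) - u1 x)"
    by (simp add: eventually_at_filter)
qed

text \<open>One constant for v and both derivatives. Linear combinations then become sums of
  constants, and no triangle inequality for \<open>sobolev_norm\<close> is called for.\<close>

definition C2_bound :: "real \<Rightarrow> (real \<Rightarrow> real) \<Rightarrow> bool" where
  "C2_bound M v \<longleftrightarrow> (\<exists>v' v''. (\<forall>x. (v has_real_derivative v' x) (at x)) \<and> (\<forall>x. (v' has_real_derivative v'' x) (at x)) \<and>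
     (\<forall>x. \<bar>v x\<bar> \<le> M) \<and> (\<forall>x. \<bar>v' x\<bar> \<le> M) \<and> (\<forall>x. \<bar>v'' x\<bar> \<le> M))"

lemma C2_bound_sobolev: "4 \<le> s \<Longrightarrow> v \<in> sobolev_space s \<Longrightarrow> C2_bound (sobolev_norm s v) v"
  by (erule (1) sobolev_embedding) (auto simp: C2_bound_def)

lemma C2_bound_mono: "C2_bound M v \<Longrightarrow> M \<le> M' \<Longrightarrow> C2_bound M' v"
  unfolding C2_bound_def by (meson order.trans)

lemma C2_bound_lincomb:
  assumes "C2_bound A v" "C2_bound B w" "\<bar>c\<bar> \<le> 1"
  shows "C2_bound (A + B) (\<lambda>x. v x + c * w x)"
proof -
  obtain v' v'' where v: "\<And>x. (v has_real_derivative v' x) (at x)" "\<And>x. (v' has_real_derivative v'' x) (at x)"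
     "\<And>x. \<bar>v x\<bar> \<le> A" "\<And>x. \<bar>v' x\<bar> \<le> A" "\<And>x. \<bar>v'' x\<bar> \<le> A"
    using assms(1) by (auto simp: C2_bound_def)
  obtain w' w'' where w: "\<And>x. (w has_real_derivative w' x) (at x)" "\<And>x. (w' has_real_derivative w'' x) (at x)"
     "\<And>x. \<bar>w x\<bar> \<le> B" "\<And>x. \<bar>w' x\<bar> \<le> B" "\<And>x. \<bar>w'' x\<bar> \<le> B"
    using assms(2) by (auto simp: C2_bound_def)
  have b: "\<bar>a + c * b\<bar> \<le> A + B" if "\<bar>a\<bar> \<le> A" "\<bar>b\<bar> \<le> B" for a b
  proof -
    have "\<bar>c * b\<bar> \<le> 1 * B" unfolding abs_mult using that assms(3) by (intro mult_mono) auto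
    then show ?thesis using that by linarith
  qed
  show ?thesis unfolding C2_bound_def
    by (rule exI[of _ "\<lambda>x. v' x + c * w' x"], rule exI[of _ "\<lambda>x. v'' x + c * w'' x"])
       (intro conjI allI b DERIV_add DERIV_cmult v w)
qed

text \<open>Near t one has u \<tau> = u t + (\<tau> - t) (D + u1 t), where the error D of the
  difference quotient has norm below 1. This gives a local bound, and compactness of [0, T] a
  uniform one.\<close>

lemma sobolev_curve_C2_bound:
  assumes s: "4 \<le> s" and u: "\<And>t. t \<in> {0..T} \<Longrightarrow> u t \<in> sobolev_space s" "\<And>t. t \<in> {0..T} \<Longrightarrow> u1 t \<in> sobolev_space s"
    and lim: "\<And>t. t \<in> {0..T} \<Longrightarrow> ((\<lambda>\<tau>. sobolev_norm s (\<lambda>x. (u \<tau> x - u t x) / (\<tau> - t) - u1 t x)) \<longlongrightarrow> 0) (at t within {0..T})"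
  shows "\<exists>M\<ge>0. \<forall>t\<in>{0..T}. C2_bound M (u t)"
proof -
  have local: "\<exists>d>0. \<exists>M. \<forall>\<tau>\<in>{0..T}. \<bar>\<tau> - t\<bar> < d \<longrightarrow> C2_bound M (u \<tau>)" if t: "t \<in> {0..T}" for t
  proof -
    have "\<forall>\<^sub>F \<tau> in at t within {0..T}. sobolev_norm s (\<lambda>x. (u \<tau> x - u t x) / (\<tau> - t) - u1 t x) < 1"
      using lim[OF t] by (rule order_tendstoD) simp
    then obtain d where d: "d > 0" "\<And>\<tau>. \<tau> \<in> {0..T} \<Longrightarrow> \<tau> \<noteq> t \<Longrightarrow> \<bar>\<tau> - t\<bar> < d \<Longrightarrow>
        sobolev_norm s (\<lambda>x. (u \<tau> x - u t x) / (\<tau> - t) - u1 t x) < 1"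
      by (auto simp: eventually_at dist_real_def)
    define M where "M = sobolev_norm s (u t) + (1 + sobolev_norm s (u1 t))"
    \<comment> \<open>The radius is capped at 1 because \<open>C2_bound_lincomb\<close> wants a
      coefficient \<tau> - t of modulus at most 1.\<close>
    have "C2_bound M (u \<tau>)" if \<tau>: "\<tau> \<in> {0..T}" "\<bar>\<tau> - t\<bar> < min d 1" for \<tau>
    proof (cases "\<tau> = t")
      case True
      have "0 \<le> sobolev_norm s (u1 t)" using sobolev_abs_le[OF s u(2)[OF t], of 0] by linarith
      then show ?thesis using True C2_bound_mono[OF C2_bound_sobolev[OF s u(1)[OF t]], of M] by (simp add: M_def)
    next
      case False
      let ?D = "\<lambda>x. (u \<tau> x - u t x) / (\<tau> - t) - u1 t x"
      have "C2_bound 1 ?D"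
        using d(2)[OF \<tau>(1) False] \<tau> u t s
        by (intro C2_bound_mono[OF C2_bound_sobolev[OF s]] sobolev_space_quotient) auto
      then have "C2_bound (1 + sobolev_norm s (u1 t)) (\<lambda>x. ?D x + 1 * u1 t x)"
        by (rule C2_bound_lincomb[OF _ C2_bound_sobolev[OF s u(2)[OF t]]]) simp
      then have "C2_bound M (\<lambda>x. u t x + (\<tau> - t) * (?D x + 1 * u1 t x))"
        unfolding M_def by (rule C2_bound_lincomb[OF C2_bound_sobolev[OF s u(1)[OF t]]]) (use \<tau> in simp)
      moreover have "(\<lambda>x. u t x + (\<tau> - t) * (?D x + 1 * u1 t x)) = u \<tau>" using False by auto
      ultimately show ?thesis by simp
    qed
    then show ?thesis using d(1) by (intro exI[of _ "min d 1"] conjI exI[of _ M]) auto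
  qed
  define d where "d t = (SOME d. 0 < d \<and> (\<exists>M. \<forall>\<tau>\<in>{0..T}. \<bar>\<tau> - t\<bar> < d \<longrightarrow> C2_bound M (u \<tau>)))" for t
  have d: "0 < d t \<and> (\<exists>M. \<forall>\<tau>\<in>{0..T}. \<bar>\<tau> - t\<bar> < d t \<longrightarrow> C2_bound M (u \<tau>))" if "t \<in> {0..T}" for t
    unfolding d_def using local[OF that] by (rule someI_ex)
  define m where "m t = (SOME M. \<forall>\<tau>\<in>{0..T}. \<bar>\<tau> - t\<bar> < d t \<longrightarrow> C2_bound M (u \<tau>))" for t
  have m: "\<forall>\<tau>\<in>{0..T}. \<bar>\<tau> - t\<bar> < d t \<longrightarrow> C2_bound (m t) (u \<tau>)" if "t \<in> {0..T}" for t
    unfolding m_def using d[OF that, THEN conjunct2] by (rule someI_ex)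
  obtain C where C: "C \<subseteq> {0..T}" "finite C" "{0..T} \<subseteq> (\<Union>t\<in>C. ball t (d t))"
  proof (rule compactE_image[of "{0..T}" "{0..T}" "\<lambda>t. ball t (d t)"])
    show "{0..T} \<subseteq> (\<Union>t\<in>{0..T}. ball t (d t))" using d by auto
  qed auto
  define M where "M = (\<Sum>t\<in>C. \<bar>m t\<bar>)"
  show ?thesis
  proof (intro exI[of _ M] conjI ballI)
    show "0 \<le> M" by (simp add: M_def sum_nonneg)
    fix \<tau> assume \<tau>: "\<tau> \<in> {0..T}"
    then obtain t where t: "t \<in> C" "\<bar>\<tau> - t\<bar> < d t" using C(3) by (auto simp: dist_real_def abs_minus_commute)
    then have "C2_bound (m t) (u \<tau>)" using m \<tau> C(1) by blast
    moreover have "m t \<le> M"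
      using member_le_sum[of t C "\<lambda>t. \<bar>m t\<bar>"] t C(2) by (simp add: M_def)
    ultimately show "C2_bound M (u \<tau>)" by (rule C2_bound_mono)
  qed
qed

text \<open>Gronwall for the pair (v - w, v1 - w1): the first component contributes 1 to the
  Lipschitz constant, the second \<kappa>. Here a - b is bounded by stability plus a residual
  c.\<close>

lemma second_order_comparison:
  fixes v v1 a w w1 b :: "real \<Rightarrow> 'a::real_normed_vector"
  assumes S: "0 < S" and cont: "continuous_on {0..S} v" "continuous_on {0..S} v1" "continuous_on {0..S} w" "continuous_on {0..S} w1"
    and init: "v 0 = w 0" "v1 0 = w1 0"
    and v: "\<And>t. 0 < t \<Longrightarrow> t < S \<Longrightarrow> (v has_vector_derivative v1 t) (at t)" "\<And>t. 0 < t \<Longrightarrow> t < S \<Longrightarrow> (v1 has_vector_derivative a t) (at t)"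
    and w: "\<And>t. 0 < t \<Longrightarrow> t < S \<Longrightarrow> (w has_vector_derivative w1 t) (at t)" "\<And>t. 0 < t \<Longrightarrow> t < S \<Longrightarrow> (w1 has_vector_derivative b t) (at t)"
    and le: "\<And>t. 0 < t \<Longrightarrow> t < S \<Longrightarrow> norm (a t - b t) \<le> \<kappa> * norm (v t - w t) + c"
    and \<kappa>: "0 \<le> \<kappa>" and c: "0 \<le> c" and t: "t \<in> {0..S}"
  shows "norm (v t - w t) \<le> 2 * c * S * exp (2 * (1 + \<kappa>) * S) \<and> norm (v1 t - w1 t) \<le> 2 * c * S * exp (2 * (1 + \<kappa>) * S)"
proof -
  define z where "z t = (v t - w t, v1 t - w1 t)" for t
  have "norm (z t) \<le> 2 * c * S * exp (2 * (1 + \<kappa>) * S)"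
  proof (rule gronwall_zero_initial[OF S])
    show "continuous_on {0..S} z" unfolding z_def by (intro continuous_intros cont)
    show "z 0 = 0" by (simp add: z_def init zero_prod_def)
    fix t assume t: "0 < t" "t < S"
    show "(z has_vector_derivative (v1 t - w1 t, a t - b t)) (at t)"
      unfolding z_def using v w t by (intro has_vector_derivative_Pair has_vector_derivative_diff)
    have "norm (v1 t - w1 t, a t - b t) \<le> norm (v1 t - w1 t) + norm (a t - b t)" by (rule norm_Pair_le)
    also have "\<dots> \<le> norm (z t) + (\<kappa> * norm (z t) + c)"
    proof (intro add_mono order.trans[OF le[OF t]] order_refl mult_left_mono \<kappa>)
      show "norm (v1 t - w1 t) \<le> norm (z t)" "norm (v t - w t) \<le> norm (z t)"
        by (simp_all add: z_def norm_fst_le norm_snd_le)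
    qed
    finally show "norm (v1 t - w1 t, a t - b t) \<le> (1 + \<kappa>) * norm (z t) + c" by (simp add: distrib_right)
  qed (use \<kappa> c t in auto)
  then show ?thesis
    unfolding z_def by (meson norm_fst_le norm_snd_le order.trans)
qed

section \<open>The nonlinearity: truncation and composition\<close>

lemma C_k_derivs:
  assumes "C_k k f" "3 \<le> k"
  obtains f1 f2 where "\<And>x. (f has_real_derivative f1 x) (at x)" "\<And>x. (f1 has_real_derivative f2 x) (at x)" "continuous_on UNIV f2"
proof -
  have d: "((deriv ^^ j) f has_real_derivative (deriv ^^ Suc j) f x) (at x)" if "j < 3" for j x
    using assms that by (auto simp: C_k_def DERIV_deriv_iff_field_differentiable)
  show ?thesis
  proof (rule that)
    show "(f has_real_derivative deriv f x) (at x)" for x using d[of 0] by simp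
    show "(deriv f has_real_derivative (deriv ^^ 2) f x) (at x)" for x using d[of 1] by (simp add: numeral_2_eq_2)
    show "continuous_on UNIV ((deriv ^^ 2) f)"
      using d[of 2] DERIV_isCont by (intro continuous_at_imp_continuous_on) fastforce
  qed
qed

lemma continuous_bounded_interval:
  fixes g :: "real \<Rightarrow> real"
  assumes "continuous_on UNIV g"
  obtains B where "0 \<le> B" "\<And>x. \<bar>x\<bar> \<le> R \<Longrightarrow> \<bar>g x\<bar> \<le> B"
proof -
  have "compact (g ` {-R..R})"
    by (intro compact_continuous_image continuous_on_subset[OF assms]) auto
  then have "bounded (g ` {-R..R})" by (rule compact_imp_bounded)
  then obtain B where B: "\<forall>x\<in>{-R..R}. \<bar>g x\<bar> \<le> B" by (auto simp: bounded_iff)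
  have "\<bar>g x\<bar> \<le> \<bar>B\<bar>" if "\<bar>x\<bar> \<le> R" for x
  proof -
    have "x \<in> {-R..R}" using that by auto
    then have "\<bar>g x\<bar> \<le> B" using B by blast
    then show ?thesis by linarith
  qed
  then show ?thesis by (intro that[of "\<bar>B\<bar>"]) auto
qed

text \<open>f after clamping its argument to [-R, R]. The result may have corners, which is
  harmless: the differential equation asks for a Lipschitz function, and consistency uses the
  derivatives of f itself.\<close>

lemma lipschitz_truncation:
  assumes f: "C_k k f" "3 \<le> k" and R: "0 \<le> R"
  shows "\<exists>F L B. (\<forall>x. \<bar>x\<bar> \<le> R \<longrightarrow> F x = f x) \<and> 0 \<le> L \<and> (\<forall>x y. \<bar>F x - F y\<bar> \<le> L * \<bar>x - y\<bar>) \<and> (\<forall>x. \<bar>F x\<bar> \<le> B)"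
proof -
  obtain f1 f2 where f1: "\<And>x. (f has_real_derivative f1 x) (at x)" and f2: "\<And>x. (f1 has_real_derivative f2 x) (at x)"
    using C_k_derivs[OF f] by metis
  have "continuous_on UNIV f1" "continuous_on UNIV f"
    by (auto intro!: continuous_at_imp_continuous_on DERIV_isCont f1 f2)
  then obtain L B where L: "0 \<le> L" "\<And>x. \<bar>x\<bar> \<le> R \<Longrightarrow> \<bar>f1 x\<bar> \<le> L" and B: "\<And>x. \<bar>x\<bar> \<le> R \<Longrightarrow> \<bar>f x\<bar> \<le> B"
    using continuous_bounded_interval by metis
  define p where "p x = max (- R) (min R x)" for x
  have p: "\<bar>p x\<bar> \<le> R" "\<bar>p x - p y\<bar> \<le> \<bar>x - y\<bar>" for x y
    using R by (auto simp: p_def)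
  have lip: "\<bar>f x - f y\<bar> \<le> L * \<bar>x - y\<bar>" if "\<bar>x\<bar> \<le> R" "\<bar>y\<bar> \<le> R" for x y
  proof -
    have "norm (f x - f y) \<le> L * norm (x - y)"
    proof (rule field_differentiable_bound[where S="{-R..R}" and f'=f1])
      show "(f has_field_derivative f1 z) (at z within {- R..R})" for z
        using f1 by (rule has_field_derivative_at_within)
    qed (use L that in \<open>auto simp: abs_le_iff\<close>)
    then show ?thesis by simp
  qed
  show ?thesis
  proof (rule exI[of _ "\<lambda>x. f (p x)"], rule exI[of _ L], rule exI[of _ B], intro conjI allI impI)
    show "\<bar>f (p x)\<bar> \<le> B" for x by (rule B[OF p(1)])
    show "\<bar>f (p x) - f (p y)\<bar> \<le> L * \<bar>x - y\<bar>" for x y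
      using lip[OF p(1) p(1), of x y] mult_left_mono[OF p(2) L(1), of x y] by linarith
  qed (use p B L in \<open>auto simp: p_def\<close>)
qed

text \<open>B depends on M and not on v, so a single constant serves all times.\<close>

lemma C2_bound_compose:
  assumes f: "C_k k f" "3 \<le> k"
  shows "\<exists>B. \<forall>v. C2_bound M v \<longrightarrow> C2_bound B (\<lambda>x. f (v x))"
proof -
  obtain f1 f2 where f1: "\<And>x. (f has_real_derivative f1 x) (at x)" and f2: "\<And>x. (f1 has_real_derivative f2 x) (at x)"
    and c2: "continuous_on UNIV f2"
    using C_k_derivs[OF f] by metis
  have "continuous_on UNIV f1" "continuous_on UNIV f"
    by (auto intro!: continuous_at_imp_continuous_on DERIV_isCont f1 f2)
  then obtain B0 B1 B2 where B: "0 \<le> B0" "0 \<le> B1" "0 \<le> B2"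
     "\<And>x. \<bar>x\<bar> \<le> M \<Longrightarrow> \<bar>f x\<bar> \<le> B0" "\<And>x. \<bar>x\<bar> \<le> M \<Longrightarrow> \<bar>f1 x\<bar> \<le> B1" "\<And>x. \<bar>x\<bar> \<le> M \<Longrightarrow> \<bar>f2 x\<bar> \<le> B2"
    using continuous_bounded_interval c2 by metis
  define B where "B = B0 + B1 * M + (B2 * M * M + B1 * M)"
  show ?thesis
  proof (rule exI[of _ B], intro allI impI)
    fix v assume "C2_bound M v"
    then obtain v' v'' where v: "\<And>x. (v has_real_derivative v' x) (at x)" "\<And>x. (v' has_real_derivative v'' x) (at x)"
      and bv: "\<And>x. \<bar>v x\<bar> \<le> M" "\<And>x. \<bar>v' x\<bar> \<le> M" "\<And>x. \<bar>v'' x\<bar> \<le> M"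
      by (auto simp: C2_bound_def)
    have M: "0 \<le> M" using bv(1)[of 0] by linarith
    have 0: "((\<lambda>x. f (v x)) has_real_derivative f1 (v x) * v' x) (at x)" for x
      by (rule DERIV_chain2[OF f1 v(1)])
    have 1: "((\<lambda>x. f1 (v x) * v' x) has_real_derivative f1 (v x) * v'' x + f2 (v x) * v' x * v' x) (at x)" for x
      by (rule DERIV_mult'[OF DERIV_chain2[OF f2 v(1)] v(2)])
    have b1: "\<bar>f1 (v x) * v' x\<bar> \<le> B1 * M" for x
      unfolding abs_mult using B bv M by (intro mult_mono) auto
    have b2: "\<bar>f1 (v x) * v'' x + f2 (v x) * v' x * v' x\<bar> \<le> B1 * M + B2 * M * M" for x
    proof (rule order.trans[OF abs_triangle_ineq], rule add_mono)
      show "\<bar>f1 (v x) * v'' x\<bar> \<le> B1 * M" unfolding abs_mult using B bv M by (intro mult_mono) auto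
      show "\<bar>f2 (v x) * v' x * v' x\<bar> \<le> B2 * M * M" unfolding abs_mult using B bv M by (intro mult_mono) auto
    qed
    have nonneg: "0 \<le> B1 * M" "0 \<le> B2 * M * M" using B(2,3) M by simp_all
    have b0: "\<bar>f (v x)\<bar> \<le> B0" for x using B(4) bv(1) by simp
    have "\<bar>f (v x)\<bar> \<le> B" for x using b0[of x] nonneg unfolding B_def by linarith
    moreover have "\<bar>f1 (v x) * v' x\<bar> \<le> B" for x using b1[of x] nonneg B(1) unfolding B_def by linarith
    moreover have "\<bar>f1 (v x) * v'' x + f2 (v x) * v' x * v' x\<bar> \<le> B" for x
      using b2[of x] nonneg B(1) unfolding B_def by linarith
    ultimately show "C2_bound B (\<lambda>x. f (v x))"
      unfolding C2_bound_def using 0 1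
      by (intro exI[of _ "\<lambda>x. f1 (v x) * v' x"] exI[of _ "\<lambda>x. f1 (v x) * v'' x + f2 (v x) * v' x * v' x"]) simp
  qed
qed

section \<open>The semi-discrete problem\<close>

lemma semidiscrete_rhs_cong:
  "(\<And>j. f (v j) = g (w j)) \<Longrightarrow> semidiscrete_rhs \<beta> f h v = semidiscrete_rhs \<beta> g h w"
  by (simp add: semidiscrete_rhs_def)

lemma abs_apply_linf_le: "\<bar>apply_bcontfun (v :: linf) i\<bar> \<le> norm v"
  using norm_bounded[of v i] by simp

context second_derivative_kernel
begin

definition rhs_op :: "(real \<Rightarrow> real) \<Rightarrow> real \<Rightarrow> linf \<Rightarrow> linf" where
  "rhs_op F h v = Bcontfun (semidiscrete_rhs \<beta> F h (apply_bcontfun v))"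

text \<open>\<open>Bcontfun\<close> is meaningful only on bounded sequences. Comparison with the
  zero nonlinearity bounds this one by \<open>mass * B\<close>, which is why the operator is used
  with a bounded F.\<close>

lemma apply_rhs_op:
  assumes h: "h > 0" and B: "\<And>x. \<bar>F x\<bar> \<le> B"
  shows "apply_bcontfun (rhs_op F h v) i = semidiscrete_rhs \<beta> F h (apply_bcontfun v) i"
proof -
  have zero: "semidiscrete_rhs \<beta> (\<lambda>_. 0) h (\<lambda>_. 0) i = 0" for i
    by (simp add: semidiscrete_rhs_def D_plus_def D_minus_def discrete_convol_def)
  have "\<bar>semidiscrete_rhs \<beta> F h (apply_bcontfun v) i\<bar> \<le> mass * B" for i
    using abs_semidiscrete_rhs_diff_le[where f=F and g="\<lambda>_. 0" and v="apply_bcontfun v" and w="\<lambda>_. 0" and D=B and i=i and B'=0, OF h B]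
      B zero by simp
  then have "semidiscrete_rhs \<beta> F h (apply_bcontfun v) \<in> bcontfun"
    unfolding int_bcontfun_iff bounded_iff by auto
  then show ?thesis by (simp add: rhs_op_def Bcontfun_inverse)
qed

lemma norm_rhs_op_diff_le:
  assumes h: "h > 0" and B: "\<And>x. \<bar>F x\<bar> \<le> B" and L: "0 \<le> L" "\<And>x y. \<bar>F x - F y\<bar> \<le> L * \<bar>x - y\<bar>"
  shows "norm (rhs_op F h v - rhs_op F h w) \<le> mass * L * norm (v - w)"
proof (rule norm_bound)
  fix i
  have "\<bar>F (apply_bcontfun v j) - F (apply_bcontfun w j)\<bar> \<le> L * norm (v - w)" for j
    using L(2)[of "apply_bcontfun v j" "apply_bcontfun w j"] mult_left_mono[OF abs_apply_linf_le[of "v - w" j] L(1)]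
    by simp
  then show "norm (apply_bcontfun (rhs_op F h v - rhs_op F h w) i) \<le> mass * L * norm (v - w)"
    using abs_semidiscrete_rhs_diff_le[where f=F and g=F and v="apply_bcontfun v" and w="apply_bcontfun w" and D="L * norm (v - w)" and i=i, OF h B B]
    by (simp add: apply_rhs_op[OF h B] mult.assoc)
qed

text \<open>f is only locally Lipschitz, but both solutions are bounded on the compact interval
  [0, t], where f may be replaced by a truncation. The comparison with residual 0 then forces
  equality.\<close>

lemma semidiscrete_solution_unique:
  assumes f: "C_k k f" "3 \<le> k" and h: "h > 0"
    and v: "semidiscrete_solution \<beta> f \<phi> \<psi> h Tv v v1" and w: "semidiscrete_solution \<beta> f \<phi> \<psi> h Tw w w1"
    and t: "0 \<le> t" "ereal t < Tv" "ereal t < Tw"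
  shows "v t = w t" "v1 t = w1 t"
proof -
  have "v t = w t \<and> v1 t = w1 t"
  proof (cases "t = 0")
    case True
    then show ?thesis using v w by (simp add: semidiscrete_solution_def Let_def)
  next
    case False
    then have t0: "0 < t" using t by simp
    let ?Iv = "{t. 0 \<le> t \<and> ereal t < Tv}" and ?Iw = "{t. 0 \<le> t \<and> ereal t < Tw}"
    have sub: "{0..t} \<subseteq> ?Iv" "{0..t} \<subseteq> ?Iw"
      using t by (auto intro: le_less_trans[of _ "ereal t"])
    obtain v2 where v2: "\<And>t. t \<in> ?Iv \<Longrightarrow> (v has_vector_derivative v1 t) (at t within ?Iv)"
      "\<And>t. t \<in> ?Iv \<Longrightarrow> (v1 has_vector_derivative v2 t) (at t within ?Iv)"
      "\<And>t i. t \<in> ?Iv \<Longrightarrow> apply_bcontfun (v2 t) i = semidiscrete_rhs \<beta> f h (apply_bcontfun (v t)) i"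
      using v unfolding semidiscrete_solution_def Let_def by blast
    obtain w2 where w2: "\<And>t. t \<in> ?Iw \<Longrightarrow> (w has_vector_derivative w1 t) (at t within ?Iw)"
      "\<And>t. t \<in> ?Iw \<Longrightarrow> (w1 has_vector_derivative w2 t) (at t within ?Iw)"
      "\<And>t i. t \<in> ?Iw \<Longrightarrow> apply_bcontfun (w2 t) i = semidiscrete_rhs \<beta> f h (apply_bcontfun (w t)) i"
      using w unfolding semidiscrete_solution_def Let_def by blast
    have cont: "continuous_on {0..t} v" "continuous_on {0..t} v1" "continuous_on {0..t} w" "continuous_on {0..t} w1"
      using continuous_on_subset[OF continuous_on_vector_derivative[OF v2(1)] sub(1)]
        continuous_on_subset[OF continuous_on_vector_derivative[OF v2(2)] sub(1)]
        continuous_on_subset[OF continuous_on_vector_derivative[OF w2(1)] sub(2)]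
        continuous_on_subset[OF continuous_on_vector_derivative[OF w2(2)] sub(2)] by blast+
    have int: "at x within {0..t} = at x" if "0 < x" "x < t" for x
      using that by (intro at_within_Icc_at)
    have "compact (v ` {0..t} \<union> w ` {0..t})"
      by (intro compact_Un compact_continuous_image cont) auto
    then have "bounded (v ` {0..t} \<union> w ` {0..t})" by (rule compact_imp_bounded)
    then obtain R where "\<forall>x\<in>v ` {0..t} \<union> w ` {0..t}. norm x \<le> R" by (auto simp: bounded_iff)
    then have R: "norm (v x) \<le> \<bar>R\<bar>" "norm (w x) \<le> \<bar>R\<bar>" if "x \<in> {0..t}" for x
      using that by force+
    obtain F L B where "\<forall>x. \<bar>x\<bar> \<le> \<bar>R\<bar> \<longrightarrow> F x = f x" "0 \<le> L" "\<forall>x y. \<bar>F x - F y\<bar> \<le> L * \<bar>x - y\<bar>" "\<forall>x. \<bar>F x\<bar> \<le> B"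
      using lipschitz_truncation[OF f abs_ge_zero[of R]] by (elim exE conjE)
    then have F: "\<And>x. \<bar>x\<bar> \<le> \<bar>R\<bar> \<Longrightarrow> F x = f x" and L: "0 \<le> L" "\<And>x y. \<bar>F x - F y\<bar> \<le> L * \<bar>x - y\<bar>" and B: "\<And>x. \<bar>F x\<bar> \<le> B"
      by simp_all
    have op: "a = rhs_op F h b" if "\<And>i. apply_bcontfun a i = semidiscrete_rhs \<beta> f h (apply_bcontfun b) i" "norm b \<le> \<bar>R\<bar>" for a b
    proof (rule bcontfun_eqI)
      fix i
      have "F (apply_bcontfun b j) = f (apply_bcontfun b j)" for j
        using that(2) abs_apply_linf_le[of b j] by (intro F) linarith
      then have "semidiscrete_rhs \<beta> f h (apply_bcontfun b) = semidiscrete_rhs \<beta> F h (apply_bcontfun b)"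
        by (intro semidiscrete_rhs_cong) simp
      then show "apply_bcontfun a i = apply_bcontfun (rhs_op F h b) i"
        by (simp add: that(1) apply_rhs_op[OF h B])
    qed
    have "norm (v t - w t) \<le> 2 * 0 * t * exp (2 * (1 + mass * L) * t) \<and> norm (v1 t - w1 t) \<le> 2 * 0 * t * exp (2 * (1 + mass * L) * t)"
    proof (rule second_order_comparison[OF t0 cont, where a=v2 and b=w2])
      fix x assume x: "0 < x" "x < t"
      then have x': "x \<in> {0..t}" by simp
      then have x'': "x \<in> ?Iv" "x \<in> ?Iw" using sub by blast+
      show "(v has_vector_derivative v1 x) (at x)" "(v1 has_vector_derivative v2 x) (at x)"
        using has_vector_derivative_within_subset[OF v2(1)[OF x''(1)] sub(1)]
          has_vector_derivative_within_subset[OF v2(2)[OF x''(1)] sub(1)] int[OF x] by simp_all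
      show "(w has_vector_derivative w1 x) (at x)" "(w1 has_vector_derivative w2 x) (at x)"
        using has_vector_derivative_within_subset[OF w2(1)[OF x''(2)] sub(2)]
          has_vector_derivative_within_subset[OF w2(2)[OF x''(2)] sub(2)] int[OF x] by simp_all
      have "v2 x = rhs_op F h (v x)" using v2(3)[OF x''(1)] R(1)[OF x'] by (intro op)
      moreover have "w2 x = rhs_op F h (w x)" using w2(3)[OF x''(2)] R(2)[OF x'] by (intro op)
      ultimately show "norm (v2 x - w2 x) \<le> mass * L * norm (v x - w x) + 0"
        using norm_rhs_op_diff_le[OF h B L] by simp
    next
      show "v 0 = w 0" "v1 0 = w1 0" using v w by (simp_all add: semidiscrete_solution_def Let_def)
    qed (use t mass_nonneg L(1) in simp_all)
    then show ?thesis by simp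
  qed
  then show "v t = w t" "v1 t = w1 t" by auto
qed

end

context second_derivative_kernel
begin

lemma truncated_solution_exists:
  assumes S: "0 < S" and h: "0 < h" and B: "\<And>x. \<bar>F x\<bar> \<le> B" and L: "0 \<le> L" "\<And>x y. \<bar>F x - F y\<bar> \<le> L * \<bar>x - y\<bar>"
  shows "\<exists>w w1. w 0 = a \<and> w1 0 = b \<and> (\<forall>t\<in>{0..S}. (w has_vector_derivative w1 t) (at t within {0..S}) \<and>
      (w1 has_vector_derivative rhs_op F h (w t)) (at t within {0..S}))"
proof -
  define G where "G z = (snd z, rhs_op F h (fst z))" for z :: "linf \<times> linf"
  have lip: "norm (G y - G z) \<le> (1 + mass * L) * norm (y - z)" for y z
  proof -
    have fst: "norm (fst x) \<le> norm x" and snd: "norm (snd x) \<le> norm x" for x :: "linf \<times> linf"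
      using norm_fst_le[of "fst x" "snd x"] norm_snd_le[of "snd x" "fst x"] by simp_all
    have "norm (G y - G z) = norm (snd (y - z), rhs_op F h (fst y) - rhs_op F h (fst z))"
      by (simp add: G_def)
    also have "\<dots> \<le> norm (snd (y - z)) + norm (rhs_op F h (fst y) - rhs_op F h (fst z))"
      by (rule norm_Pair_le)
    also have "\<dots> \<le> norm (y - z) + mass * L * norm (fst (y - z))"
      using norm_rhs_op_diff_le[OF h B L, of "fst y" "fst z"] snd[of "y - z"]
      by (intro add_mono) (simp_all add: fst_diff)
    also have "\<dots> \<le> norm (y - z) + mass * L * norm (y - z)"
      using mass_nonneg L(1) by (intro add_mono mult_left_mono fst order_refl) simp
    finally show ?thesis by (simp add: distrib_right)
  qed
  have pos: "0 < 1 + mass * L" using mass_nonneg L(1) by (simp add: add_pos_nonneg)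
  obtain z where z: "z 0 = (a, b)" "\<And>t. t \<in> {0..S} \<Longrightarrow> (z has_vector_derivative G (z t)) (at t within {0..S})"
    using global_picard[where G=G and S=S, OF S pos lip, of "(a, b)"] by blast
  have "((\<lambda>t. fst (z t)) has_vector_derivative snd (z t)) (at t within {0..S})"
    "((\<lambda>t. snd (z t)) has_vector_derivative rhs_op F h (fst (z t))) (at t within {0..S})" if "t \<in> {0..S}" for t
    using bounded_linear.has_vector_derivative[OF bounded_linear_fst z(2)[OF that]]
      bounded_linear.has_vector_derivative[OF bounded_linear_snd z(2)[OF that]] by (simp_all add: G_def)
  then show ?thesis
    by (intro exI[of _ "\<lambda>t. fst (z t)"] exI[of _ "\<lambda>t. snd (z t)"]) (simp add: z)
qed

text \<open>As long as the norm of w stays below R, the truncation is invisible. The new interval is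
  half-open because \<open>semidiscrete_solution\<close> uses times strictly before the existence
  time.\<close>

lemma truncated_solution_is_solution:
  assumes h: "0 < h" and B: "\<And>x. \<bar>F x\<bar> \<le> B" and L: "0 \<le> L" "\<And>x y. \<bar>F x - F y\<bar> \<le> L * \<bar>x - y\<bar>"
    and F: "\<And>x. \<bar>x\<bar> \<le> R \<Longrightarrow> F x = f x"
    and w: "w 0 = grid_seq h \<phi>" "w1 0 = grid_seq h \<psi>"
      "\<And>t. t \<in> {0..S} \<Longrightarrow> (w has_vector_derivative w1 t) (at t within {0..S})"
      "\<And>t. t \<in> {0..S} \<Longrightarrow> (w1 has_vector_derivative rhs_op F h (w t)) (at t within {0..S})"
    and S': "0 < S'" "S' \<le> S" and R: "\<And>t. t \<in> {0..S'} \<Longrightarrow> norm (w t) \<le> R"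
  shows "semidiscrete_solution \<beta> f \<phi> \<psi> h (ereal S') w w1"
proof -
  have I: "{t. 0 \<le> t \<and> ereal t < ereal S'} = {0..<S'}" by auto
  have sub: "{0..<S'} \<subseteq> {0..S}" using S' by auto
  have contw: "continuous_on {0..<S'} w"
    using continuous_on_subset[OF continuous_on_vector_derivative[OF w(3)] sub] by blast
  have "continuous_on UNIV (rhs_op F h)"
    using norm_rhs_op_diff_le[OF h B L] mass_nonneg L(1)
    by (intro lipschitz_on_continuous_on[where L="mass * L"] lipschitz_onI) (auto simp: dist_norm)
  then have "continuous_on {0..<S'} (\<lambda>t. rhs_op F h (w t))"
    by (rule continuous_on_compose2[OF _ contw]) simp
  moreover have "apply_bcontfun (rhs_op F h (w t)) i = semidiscrete_rhs \<beta> f h (apply_bcontfun (w t)) i"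
    if "t \<in> {0..<S'}" for t i
  proof -
    have "F (apply_bcontfun (w t) j) = f (apply_bcontfun (w t) j)" for j
      using R[of t] that abs_apply_linf_le[of "w t" j] by (intro F) simp
    then have "semidiscrete_rhs \<beta> F h (apply_bcontfun (w t)) = semidiscrete_rhs \<beta> f h (apply_bcontfun (w t))"
      by (intro semidiscrete_rhs_cong) simp
    then show ?thesis by (simp add: apply_rhs_op[OF h B])
  qed
  moreover have "(w has_vector_derivative w1 t) (at t within {0..<S'})"
    "(w1 has_vector_derivative rhs_op F h (w t)) (at t within {0..<S'})" if "t \<in> {0..<S'}" for t
    using has_vector_derivative_within_subset[OF w(3) sub] has_vector_derivative_within_subset[OF w(4) sub] that sub by blast+
  ultimately show ?thesis
    unfolding semidiscrete_solution_def Let_def I using w(1,2) S'(1)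
    by (intro conjI exI[of _ "\<lambda>t. rhs_op F h (w t)"] ballI allI) (simp_all add: zero_ereal_def)
qed

text \<open>By the equation, z at a node is an integral of f(v) against \<open>P\<close> and
  \<open>N\<close>; the discrete operator is the same integral of the interpolant. Since F and f
  agree on the range of v, the residual is the interpolation error of f(v).\<close>

lemma residual_bound:
  assumes s: "4 \<le> s" and h: "0 < h" and B: "\<And>x. \<bar>F x\<bar> \<le> B'"
    and F: "\<And>x. \<bar>x\<bar> \<le> M \<Longrightarrow> F x = f x" and v: "v \<in> sobolev_space s" "\<And>x. \<bar>v x\<bar> \<le> M" and fv: "C2_bound B (\<lambda>x. f (v x))"
    and z: "z \<in> sobolev_space s"
    and pde: "\<And>x. (convol \<beta> (\<lambda>y. f (v y)) has_real_derivative W x) (at x)" "\<And>x. (W has_real_derivative z x) (at x)"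
  shows "norm (grid_seq h z - rhs_op F h (grid_seq h v)) \<le> mass * (B * h\<^sup>2)"
proof (rule norm_bound)
  fix i
  let ?g = "\<lambda>x. f (v x)"
  let ?x = "of_int i * h"
  obtain g' g'' where g: "\<And>x. (?g has_real_derivative g' x) (at x)" "\<And>x. (g' has_real_derivative g'' x) (at x)"
    and gB: "\<And>x. \<bar>?g x\<bar> \<le> B" "\<And>x. \<bar>g' x\<bar> \<le> B" "\<And>x. \<bar>g'' x\<bar> \<le> B"
    using fv by (auto simp: C2_bound_def)
  have lip: "\<bar>?g x - ?g y\<bar> \<le> B * \<bar>x - y\<bar>" for x y
  proof -
    have "norm (?g x - ?g y) \<le> B * norm (x - y)"
      by (rule field_differentiable_bound[where S=UNIV and f'=g']) (use g(1) gB(2) in auto)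
    then show ?thesis by simp
  qed
  have z_eq: "z ?x = (LINT y|P. ?g (?x - y)) - (LINT y|N. ?g (?x - y))"
    by (rule convol_second_derivative[OF gB(1) lip pde])
  have Fv: "F (apply_bcontfun (grid_seq h v) j) = ?g (of_int j * h)" for j
    using F[OF v(2)] by (simp add: apply_grid_seq_sobolev[OF s v(1)])
  have "\<bar>semidiscrete_rhs \<beta> F h (apply_bcontfun (grid_seq h v)) i - z ?x\<bar> \<le> mass * (B * h\<^sup>2)"
    unfolding z_eq by (rule semidiscrete_rhs_consistency[where g="?g" and f=F and v="apply_bcontfun (grid_seq h v)", OF h g gB(1,3) Fv])
  then show "norm (apply_bcontfun (grid_seq h z - rhs_op F h (grid_seq h v)) i) \<le> mass * (B * h\<^sup>2)"
    by (simp add: apply_rhs_op[OF h B] apply_grid_seq_sobolev[OF s z] abs_minus_commute)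
qed

end

section \<open>Convergence and the lower bound for the existence time\<close>

theorem theorem4p1:
  fixes s T :: real
    and \<beta> f \<phi> \<psi> :: "real \<Rightarrow> real"
    and u u1 :: "real \<Rightarrow> real \<Rightarrow> real"
  assumes "admissible_kernel \<beta>"
    and "s > 9 / 2" and "T > 0"
    and "C_k (nat \<lfloor>s\<rfloor> + 1) f" and "f 0 = 0"
    and "\<phi> \<in> sobolev_space s" and "\<psi> \<in> sobolev_space s"
    and "continuous_solution \<beta> f \<phi> \<psi> s T u u1"
  shows "\<exists>h0>0. \<exists>C. \<forall>h. 0 < h \<and> h \<le> h0 \<longrightarrow>
           (\<forall>Th uh uh1. maximal_semidiscrete_solution \<beta> f \<phi> \<psi> h Th uh uh1 \<longrightarrow>
              ereal T \<le> Th \<and>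
              (\<forall>t\<in>{0..T}. norm (grid_seq h (u t) - uh t) + norm (grid_seq h (u1 t) - uh1 t)
                            \<le> C * h\<^sup>2))"
proof -
  obtain P N where "second_derivative_kernel P N \<beta>"
    by (rule admissible_kernel_second_difference[OF assms(1)])
  then interpret second_derivative_kernel P N \<beta> .
  have s: "4 \<le> s" using assms(2) by simp
  then have "4 \<le> \<lfloor>s\<rfloor>" by (simp add: le_floor_iff)
  then have k: "3 \<le> nat \<lfloor>s\<rfloor> + 1" by linarith
  note f = assms(4) k and T = \<open>T > 0\<close>
  obtain u2 where C2: "sobolev_C2 s T u u1 u2"
    and pde: "\<And>t. 0 < t \<Longrightarrow> t \<le> T \<Longrightarrow> \<exists>w. (\<forall>x. (convol \<beta> (\<lambda>y. f (u t y)) has_real_derivative w x) (at x)) \<and>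
                (\<forall>x. (w has_real_derivative u2 t x) (at x))"
    and init: "u 0 = \<phi>" "u1 0 = \<psi>"
    using assms(8) unfolding continuous_solution_def by blast
  have uH: "u t \<in> sobolev_space s" and u1H: "u1 t \<in> sobolev_space s" and u2H: "u2 t \<in> sobolev_space s"
    and lim: "((\<lambda>\<tau>. sobolev_norm s (\<lambda>x. (u \<tau> x - u t x) / (\<tau> - t) - u1 t x)) \<longlongrightarrow> 0) (at t within {0..T})"
      "((\<lambda>\<tau>. sobolev_norm s (\<lambda>x. (u1 \<tau> x - u1 t x) / (\<tau> - t) - u2 t x)) \<longlongrightarrow> 0) (at t within {0..T})"
    if "t \<in> {0..T}" for t
    using C2 that unfolding sobolev_C2_def by blast+
  have "\<exists>M\<ge>0. \<forall>t\<in>{0..T}. C2_bound M (u t)"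
    using s uH u1H lim(1) by (rule sobolev_curve_C2_bound)
  then obtain M where M: "0 \<le> M" "\<And>t. t \<in> {0..T} \<Longrightarrow> C2_bound M (u t)" by blast
  have uM: "\<bar>u t x\<bar> \<le> M" if "t \<in> {0..T}" for t x
    using M(2)[OF that] by (auto simp: C2_bound_def)
  obtain B where "\<forall>v. C2_bound M v \<longrightarrow> C2_bound B (\<lambda>x. f (v x))"
    using C2_bound_compose[OF f] by blast
  then have B: "C2_bound B (\<lambda>x. f (u t x))" if "t \<in> {0..T}" for t using M(2)[OF that] by blast
  have B0: "0 \<le> B"
  proof -
    have "\<bar>f (u 0 0)\<bar> \<le> B" using B[of 0] T by (auto simp: C2_bound_def)
    then show ?thesis by linarith
  qed
  \<comment> \<open>The exact solution takes values in [-M, M]; agreement up to M + 1 leaves a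
    margin of 1 for the discrete error.\<close>
  obtain F L B' where "\<forall>x. \<bar>x\<bar> \<le> M + 1 \<longrightarrow> F x = f x" "0 \<le> L" "\<forall>x y. \<bar>F x - F y\<bar> \<le> L * \<bar>x - y\<bar>" "\<forall>x. \<bar>F x\<bar> \<le> B'"
    using lipschitz_truncation[OF f, of "M + 1"] M(1) by auto
  then have F: "\<And>x. \<bar>x\<bar> \<le> M + 1 \<Longrightarrow> F x = f x" and L: "0 \<le> L" "\<And>x y. \<bar>F x - F y\<bar> \<le> L * \<bar>x - y\<bar>"
    and B': "\<And>x. \<bar>F x\<bar> \<le> B'"
    by simp_all
  \<comment> \<open>The constant of \<open>second_order_comparison\<close> on [0, T] for the
    residual \<open>mass * (B * h\<^sup>2)\<close>, with the factor h^2 taken out.\<close>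
  define K where "K = 2 * (mass * B) * T * exp (2 * (1 + mass * L) * T)"
  have K: "0 \<le> K" using mass_nonneg B0 T by (simp add: K_def)
  \<comment> \<open>h \<le> 1/(K + 1) gives h \<le> 1 and K h^2 < 1. The constant 2 K adds the error
    bounds for the solution and for its time derivative.\<close>
  have main: "ereal T \<le> Th \<and> (\<forall>t\<in>{0..T}. norm (grid_seq h (u t) - uh t) + norm (grid_seq h (u1 t) - uh1 t) \<le> 2 * K * h\<^sup>2)"
    if h: "0 < h" "h \<le> 1 / (K + 1)" and max: "maximal_semidiscrete_solution \<beta> f \<phi> \<psi> h Th uh uh1" for h Th uh uh1
  proof -
    let ?U = "\<lambda>t. grid_seq h (u t)" and ?U1 = "\<lambda>t. grid_seq h (u1 t)" and ?U2 = "\<lambda>t. grid_seq h (u2 t)"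
    have dU: "(?U has_vector_derivative ?U1 t) (at t within {0..T})" "(?U1 has_vector_derivative ?U2 t) (at t within {0..T})"
      if "t \<in> {0..T}" for t
      using grid_seq_has_vector_derivative[OF s uH u1H[OF that] that lim(1)[OF that]]
        grid_seq_has_vector_derivative[OF s u1H u2H[OF that] that lim(2)[OF that]] by blast+
    \<comment> \<open>The surplus beyond T is there to let the discrete solution be continued past
      T; its length is arbitrary.\<close>
    have "0 < T + 1" using T by simp
    from truncated_solution_exists[OF this h(1) B' L, of "?U 0" "?U1 0"]
    obtain w w1 where w0: "w 0 = ?U 0" "w1 0 = ?U1 0"
      and dw: "\<And>t. t \<in> {0..T + 1} \<Longrightarrow> (w has_vector_derivative w1 t) (at t within {0..T + 1})"
        "\<And>t. t \<in> {0..T + 1} \<Longrightarrow> (w1 has_vector_derivative rhs_op F h (w t)) (at t within {0..T + 1})"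
      by blast
    have cw: "continuous_on {0..T + 1} w" "continuous_on {0..T + 1} w1"
      using continuous_on_vector_derivative[OF dw(1)] continuous_on_vector_derivative[OF dw(2)] by blast+
    have sub: "{0..T} \<subseteq> {0..T + 1}" by auto
    have err: "norm (?U t - w t) \<le> K * h\<^sup>2 \<and> norm (?U1 t - w1 t) \<le> K * h\<^sup>2" if t: "t \<in> {0..T}" for t
    proof -
      have "norm (?U t - w t) \<le> 2 * (mass * (B * h\<^sup>2)) * T * exp (2 * (1 + mass * L) * T) \<and>
        norm (?U1 t - w1 t) \<le> 2 * (mass * (B * h\<^sup>2)) * T * exp (2 * (1 + mass * L) * T)"
      proof (rule second_order_comparison[OF T, where a="?U2" and b="\<lambda>t. rhs_op F h (w t)"])
        show "continuous_on {0..T} ?U" "continuous_on {0..T} ?U1"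
          using continuous_on_vector_derivative[OF dU(1)] continuous_on_vector_derivative[OF dU(2)] by blast+
        show "continuous_on {0..T} w" "continuous_on {0..T} w1"
          using cw sub by (blast intro: continuous_on_subset)+
        show "?U 0 = w 0" "?U1 0 = w1 0" by (simp_all add: w0)
        fix x assume x: "0 < x" "x < T"
        then have x': "x \<in> {0..T}" "x \<in> {0..T + 1}" "0 < x" "x \<le> T" by simp_all
        have at: "at x within {0..T} = at x" "at x within {0..T + 1} = at x"
          using x by (simp_all add: at_within_Icc_at)
        show "(?U has_vector_derivative ?U1 x) (at x)" "(?U1 has_vector_derivative ?U2 x) (at x)"
          using dU[OF x'(1)] unfolding at by blast+
        show "(w has_vector_derivative w1 x) (at x)" "(w1 has_vector_derivative rhs_op F h (w x)) (at x)"
          using dw[OF x'(2)] unfolding at by blast+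
        obtain W where W: "\<And>y. (convol \<beta> (\<lambda>y. f (u x y)) has_real_derivative W y) (at y)"
            "\<And>y. (W has_real_derivative u2 x y) (at y)"
          using pde[OF x'(3,4)] by blast
        have FM: "F y = f y" if "\<bar>y\<bar> \<le> M" for y using F that by simp
        have res: "norm (?U2 x - rhs_op F h (?U x)) \<le> mass * (B * h\<^sup>2)"
          by (rule residual_bound[OF s h(1) B' FM uH[OF x'(1)] uM[OF x'(1)] B[OF x'(1)] u2H[OF x'(1)] W])
        have "norm (?U2 x - rhs_op F h (w x)) \<le> norm (?U2 x - rhs_op F h (?U x)) + norm (rhs_op F h (?U x) - rhs_op F h (w x))"
          using norm_triangle_ineq[of "?U2 x - rhs_op F h (?U x)" "rhs_op F h (?U x) - rhs_op F h (w x)"] by simp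
        then show "norm (?U2 x - rhs_op F h (w x)) \<le> mass * L * norm (?U x - w x) + mass * (B * h\<^sup>2)"
          using res norm_rhs_op_diff_le[OF h(1) B' L, of "?U x" "w x"] by linarith
      qed (use t mass_nonneg L(1) B0 in simp_all)
      moreover have eq: "2 * (mass * (B * h\<^sup>2)) * T * exp (2 * (1 + mass * L) * T) = K * h\<^sup>2"
        by (simp add: K_def mult_ac)
      ultimately show ?thesis by (simp only:)
    qed
    have Kh: "K * h\<^sup>2 < 1"
    proof -
      have h1: "h \<le> 1" using h K by (simp add: order.trans[OF h(2)])
      have "K * h\<^sup>2 \<le> K * h" using h1 h(1) K by (intro mult_left_mono) (simp_all add: power2_eq_square mult_left_le)
      also have "\<dots> \<le> K * (1 / (K + 1))" using h K by (intro mult_left_mono)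
      also have "\<dots> < 1" using K by simp
      finally show ?thesis .
    qed
    have normU: "norm (?U t) \<le> M" if "t \<in> {0..T}" for t
      by (rule norm_bound) (simp add: apply_grid_seq_sobolev[OF s uH[OF that]] uM[OF that])
    have wT: "norm (w t) < M + 1" if "t \<in> {0..T}" for t
    proof -
      have "norm (w t) \<le> norm (?U t) + norm (?U t - w t)"
        using norm_triangle_ineq4[of "?U t" "?U t - w t"] by simp
      then show ?thesis using normU[OF that] err[OF that] Kh by linarith
    qed
    \<comment> \<open>The strict bound at T persists slightly longer, so w solves the original
      problem up to some S > T. Hence \<open>uh\<close> will be defined at T itself, and the
      estimate includes that endpoint.\<close>
    have "continuous (at T within {0..T + 1}) w"
      using cw(1) T by (simp add: continuous_on_eq_continuous_within)
    then have "\<forall>\<^sub>F t in at T within {0..T + 1}. norm (w t) < M + 1"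
      using wT[of T] T by (intro order_tendstoD(2)[OF tendsto_norm]) (auto simp: continuous_within)
    then obtain d where d: "0 < d" "\<And>t. t \<in> {0..T + 1} \<Longrightarrow> t \<noteq> T \<Longrightarrow> \<bar>t - T\<bar> < d \<Longrightarrow> norm (w t) < M + 1"
      by (auto simp: eventually_at dist_real_def)
    define S where "S = T + min (d / 2) 1"
    have S: "0 < S" "S \<le> T + 1" "T < S" using T d(1) by (auto simp: S_def)
    have wS: "norm (w t) \<le> M + 1" if "t \<in> {0..S}" for t
    proof (cases "t \<le> T")
      case True
      then show ?thesis using wT[of t] that by simp
    next
      case False
      then have "\<bar>t - T\<bar> < d" using that d(1) by (auto simp: S_def)
      then show ?thesis using d(2)[of t] that S(2) False by simp
    qed
    have w_sol: "semidiscrete_solution \<beta> f \<phi> \<psi> h (ereal S) w w1"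
      by (rule truncated_solution_is_solution[OF h(1) B' L F _ _ dw S(1,2) wS]) (simp_all add: w0 init)
    have uh_sol: "semidiscrete_solution \<beta> f \<phi> \<psi> h Th uh uh1"
      and no_ext: "\<not> (\<exists>Tm' w w1. Th < Tm' \<and> semidiscrete_solution \<beta> f \<phi> \<psi> h Tm' w w1 \<and> (\<forall>t. 0 \<le> t \<and> ereal t < Th \<longrightarrow> w t = uh t))"
      using max unfolding maximal_semidiscrete_solution_def by blast+
    note unique = semidiscrete_solution_unique[OF f h(1) w_sol uh_sol]
    \<comment> \<open>If \<open>Th\<close> were smaller than S, then w would agree with
      \<open>uh\<close> before \<open>Th\<close> by uniqueness and so be a proper extension, against
      maximality.\<close>
    have "ereal S \<le> Th"
    proof (rule ccontr)
      assume "\<not> ereal S \<le> Th"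
      then have lt: "Th < ereal S" by simp
      have "w t = uh t" if "0 \<le> t" "ereal t < Th" for t
        using unique(1)[OF that(1) less_trans[OF that(2) lt] that(2)] .
      then show False using no_ext lt w_sol by blast
    qed
    then have TTh: "ereal T < Th" using S(3) less_le_trans[of "ereal T" "ereal S" Th] by simp
    have "norm (?U t - uh t) + norm (?U1 t - uh1 t) \<le> 2 * K * h\<^sup>2" if t: "t \<in> {0..T}" for t
    proof -
      have "ereal t < ereal S" "ereal t < Th" using t S(3) le_less_trans[OF _ TTh, of "ereal t"] by simp_all
      then have "w t = uh t" "w1 t = uh1 t" using unique t by simp_all
      then show ?thesis using err[OF t] by simp
    qed
    then show ?thesis using TTh by simp
  qed
  show ?thesis
    by (rule exI[of _ "1 / (K + 1)"], rule conjI, simp add: K add_nonneg_pos,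
        rule exI[of _ "2 * K"], intro allI impI, elim conjE, rule main)
qed

end
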